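(* Let $n\ge 2$ and let $\mathcal{C}\subset\mathbb{R}^n$ be a $C^1$ curve as described in the context, with closure $\bar{\mathcal{C}}$. If $\Omega\subseteq\mathbb{R}^n$ is any open, bounded set such that $\bar{\mathcal{C}}\subseteq\Omega$, then $$\lim_{\sigma\uparrow 1}(1-\sigma)\,\mathrm{Len}_\sigma(\mathcal{C},\Omega)=\frac{4\pi^{n-1}}{\Gamma\left(\tfrac{n+1}{2}\right)\Gamma\left(\tfrac{n-1}{2}\right)(n-1)}\,\mathcal{H}^1(\bar{\mathcal{C}}),$$ where $\Gamma$ is the gamma function and $\mathrm{Len}_\sigma(\mathcal{C},\Omega)$, $0<\sigma<1$, is the $\sigma$-length defined in the context.
   Context: $\mathcal{H}^k$ is $k$-dimensional Hausdorff measure. $\mathcal{C}$ is a $C^1$ curve in $\mathbb{R}^n$ (a one-dimensional $C^1$ submanifold), not assumed connected, whose closure $\bar{\mathcal{C}}$ is a $C^1$, compact curve with boundary points $\partial\mathcal{C}$ (a finite set with a positive, even number of points) such that $\bar{\mathcal{C}}=\mathcal{C}\cup\partial\mathcal{C}$. $\bar{\mathcal{C}}$ is oriented, with unit tangent $\mathbf{t}(z)$ at $z\in\bar{\mathcal{C}}$. Discs: $\mathcal{U}_n$ is the set of unit vectors of $\mathbb{R}^n$, $\{\mathbf{u}\}^\perp$ is the set of vectors orthogonal to $\mathbf{u}$. Set $\mathcal{D}:=\mathbb{R}^n\times\mathcal{U}_n\times(0,\infty)$. For $(p,\mathbf{u},r)\in\mathcal{D}$ let $D(p,\mathbf{u},r):=\{p+\xi\mathbf{v}\mid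 \mathbf{v}\in\mathcal{U}_n\cap\{\mathbf{u}\}^\perp,\ \xi\in[0,r)\}$, $\partial D(p,\mathbf{u},r):=\{p+r\mathbf{v}\mid\mathbf{v}\in\mathcal{U}_n\cap\{\mathbf{u}\}^\perp\}$, and $\bar D(p,\mathbf{u},r):=D(p,\mathbf{u},r)\cup\partial D(p,\mathbf{u},r)$. Let - $\mathcal{D}_{\partial\mathcal{C}}$ be the set of $(p,\mathbf{u},r)\in\mathcal{D}$ with $\bar D(p,\mathbf{u},r)\cap\partial\mathcal{C}\neq\emptyset$; - $\mathcal{D}_{\rm tan}$ be the set of $(p,\mathbf{u},r)\in\mathcal{D}$ for which there is $z\in\bar D(p,\mathbf{u},r)\cap\bar{\mathcal{C}}$ with $\mathbf{t}(z)\cdot\mathbf{u}=0$; - $\mathcal{D}_\partial$ be the set of $(p,\mathbf{u},r)\in\mathcal{D}$ with $\partial D(p,\mathbf{u},r)\cap\mathcal{C}\neq\emptyset$; - $\mathcal{D}(\mathcal{C})=\mathcal{D}_{\rm odd}$ be the set of $(p,\mathbf{u},r)\in\mathcal{D}\setminus(\mathcal{D}_{\partial\mathcal{C}}\cup\mathcal{D}_{\rm tan}\cup\mathcal{D}_\partial)$ such that $\mathcal{H}^0(D(p,\mathbf{u},r)\cap\mathcal{C})$ is an odd number. For $0<\sigma<1$ and $\Omega$ open, bounded, containing $\bar{\mathcal{C}}$, the $\sigma$-length of $\mathcal{C}$ relative to $\Omega$ is $$\mathrm{Len}_\sigma(\mathcal{C},\Omega):=\int_{\mathcal{D}(\mathcal{C})}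 r^{1-n-\sigma}\sup_{\mathbf{a}\in\mathcal{U}_n\cap\{\mathbf{u}\}^\perp}\chi_\Omega(p+r\mathbf{a})\,d\mathcal{H}^{2n}(p,\mathbf{u},r),$$ where $\chi_\Omega$ is the characteristic function of $\Omega$ and $\mathcal{D}\subset\mathbb{R}^{2n+1}$ carries $\mathcal{H}^{2n}$. *)

theory Defs
  imports "HOL-Analysis.Analysis"
begin

section \<open>Hausdorff measure\<close>

text \<open>
  The normalisation is the usual one: \<open>unit_ball_vol k\<close> is the volume of the \<open>k\<close>-dimensional unit
  ball, so that \<open>k\<close>-dimensional Hausdorff measure on \<open>k\<close>-dimensional Euclidean space is Lebesgue
  measure.  For \<open>k = 0\<close> nonempty sets have weight \<open>1\<close> (as \<open>0 ^ 0 = 1\<close>), whereas the empty set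
  always has weight \<open>0\<close>; hence \<open>hausdorff 0\<close> counts points.
\<close>

definition hausdorff_weight :: "nat \<Rightarrow> 'a::metric_space set \<Rightarrow> ennreal" where
  "hausdorff_weight k S =
     (if S = {} then 0 else ennreal (unit_ball_vol (real k) * (diameter S / 2) ^ k))"

text \<open>Boundedness is required explicitly since \<open>diameter\<close> is unspecified on unbounded sets.\<close>

definition hausdorff_covers :: "real \<Rightarrow> 'a::metric_space set \<Rightarrow> (nat \<Rightarrow> 'a set) set" where
  "hausdorff_covers \<delta> A =
     {S. A \<subseteq> (\<Union>i. S i) \<and> (\<forall>i. bounded (S i) \<and> diameter (S i) \<le> \<delta>)}"

definition hausdorff_content :: "nat \<Rightarrow> real \<Rightarrow> 'a::metric_space set \<Rightarrow> ennreal" where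
  "hausdorff_content k \<delta> A = (INF S\<in>hausdorff_covers \<delta> A. \<Sum>i. hausdorff_weight k (S i))"

definition hausdorff :: "nat \<Rightarrow> 'a::metric_space set \<Rightarrow> ennreal" where
  "hausdorff k A = (SUP \<delta>\<in>{0<..}. hausdorff_content k \<delta> A)"

text \<open>The measure on the sets that are measurable in the sense of Caratheodory.\<close>

definition hausdorff_measure :: "nat \<Rightarrow> 'a::metric_space measure" where
  "hausdorff_measure k =
     measure_of UNIV (lambda_system UNIV UNIV (hausdorff k)) (hausdorff k)"

lemma hausdorff_content_empty:
  assumes "\<delta> > 0"
  shows "hausdorff_content k \<delta> ({} :: 'a::metric_space set) = 0"
proof -
  from assms have "(\<lambda>_. {} :: 'a set) \<in> hausdorff_covers \<delta> {}"
    by (simp add: hausdorff_covers_def)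
  then have "hausdorff_content k \<delta> ({} :: 'a set) \<le> (\<Sum>i::nat. hausdorff_weight k ({} :: 'a set))"
    unfolding hausdorff_content_def
    by (rule INF_lower2) simp
  then show ?thesis
    by (simp add: hausdorff_weight_def)
qed

lemma hausdorff_content_mono: "A \<subseteq> B \<Longrightarrow> hausdorff_content k \<delta> A \<le> hausdorff_content k \<delta> B"
  unfolding hausdorff_content_def
  by (rule INF_superset_mono) (auto simp: hausdorff_covers_def)

lemma hausdorff_content_subadditive:
  "hausdorff_content k \<delta> (\<Union>i. A i) \<le> (\<Sum>i. hausdorff_content k \<delta> (A i))"
proof (cases "(\<Sum>i. hausdorff_content k \<delta> (A i)) = top")
  case True
  then show ?thesis by simp
next
  case False
  have fin: "hausdorff_content k \<delta> (A i) < top" for i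
    using ennreal_suminf_lessD[of "\<lambda>i. hausdorff_content k \<delta> (A i)" top i] False
    by (simp add: less_top)
  show ?thesis
  proof (rule ennreal_le_epsilon)
    fix e :: real
    assume e: "e > 0"
    have "\<exists>S\<in>hausdorff_covers \<delta> (A i).
        (\<Sum>j. hausdorff_weight k (S j)) < hausdorff_content k \<delta> (A i) + ennreal (e * (1/2) ^ Suc i)" for i
    proof -
      have "hausdorff_content k \<delta> (A i) < hausdorff_content k \<delta> (A i) + ennreal (e * (1/2) ^ Suc i)"
        using fin[of i] e by (simp add: ennreal_add_left_cancel_less[of _ 0, simplified])
      then show ?thesis
        by (subst (asm) hausdorff_content_def) (simp only: INF_less_iff)
    qed
    then obtain S where S: "\<And>i. S i \<in> hausdorff_covers \<delta> (A i)"
      "\<And>i. (\<Sum>j. hausdorff_weight k (S i j)) < hausdorff_content k \<delta> (A i) + ennreal (e * (1/2) ^ Suc i)"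
      by metis
    define T where "T = (\<lambda>m. case prod_decode m of (i, j) \<Rightarrow> S i j)"
    have "T \<in> hausdorff_covers \<delta> (\<Union>i. A i)"
      unfolding hausdorff_covers_def
    proof (intro CollectI conjI allI subsetI)
      fix x assume "x \<in> (\<Union>i. A i)"
      then obtain i where "x \<in> A i" by blast
      then obtain j where "x \<in> S i j" using S(1)[of i] unfolding hausdorff_covers_def by blast
      then have "x \<in> T (prod_encode (i, j))" by (simp add: T_def)
      then show "x \<in> (\<Union>i. T i)" by blast
    qed (use S(1) in \<open>auto simp: T_def hausdorff_covers_def split: prod.split\<close>)
    then have "hausdorff_content k \<delta> (\<Union>i. A i) \<le> (\<Sum>m. hausdorff_weight k (T m))"
      unfolding hausdorff_content_def by (rule INF_lower)
    also have "(\<Sum>m. hausdorff_weight k (T m)) = (\<Sum>i. \<Sum>j. hausdorff_weight k (S i j))"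
    proof -
      have "(\<Sum>m. (case_prod (\<lambda>i j. hausdorff_weight k (S i j))) (prod_decode m)) =
          (\<Sum>i. \<Sum>j. hausdorff_weight k (S i j))"
        using suminf_ennreal_2dimen[of "\<lambda>i. \<Sum>j. hausdorff_weight k (S i j)"
            "case_prod (\<lambda>i j. hausdorff_weight k (S i j))"]
        by (simp add: comp_def)
      then show ?thesis by (simp add: T_def split_def)
    qed
    also have "\<dots> \<le> (\<Sum>i. hausdorff_content k \<delta> (A i) + ennreal (e * (1/2) ^ Suc i))"
      by (intro suminf_le summableI less_imp_le S(2))
    also have "\<dots> = (\<Sum>i. hausdorff_content k \<delta> (A i)) + (\<Sum>i. ennreal (e * (1/2) ^ Suc i))"
      by (rule suminf_add[symmetric]) auto
    also have "(\<Sum>i. ennreal (e * (1/2) ^ Suc i)) = ennreal e"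
      using e power_half_series[THEN sums_mult, of e]
      by (subst suminf_ennreal_eq[where x = e]) auto
    finally show "hausdorff_content k \<delta> (\<Union>i. A i) \<le> (\<Sum>i. hausdorff_content k \<delta> (A i)) + ennreal e" .
  qed
qed

lemma outer_measure_space_hausdorff:
  "outer_measure_space UNIV (hausdorff k :: 'a::metric_space set \<Rightarrow> ennreal)"
  unfolding outer_measure_space_def
proof (intro conjI)
  show "positive UNIV (hausdorff k)"
    by (simp add: positive_def hausdorff_def hausdorff_content_empty)
  show "increasing UNIV (hausdorff k)"
    unfolding increasing_def hausdorff_def by (blast intro: SUP_mono hausdorff_content_mono)
  show "countably_subadditive UNIV (hausdorff k :: 'a set \<Rightarrow> ennreal)"
    unfolding countably_subadditive_def
  proof (intro allI impI)
    fix A :: "nat \<Rightarrow> 'a set"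
    have "hausdorff_content k \<delta> (\<Union>i. A i) \<le> (\<Sum>i. hausdorff k (A i))" if "\<delta> > 0" for \<delta>
    proof -
      have "hausdorff_content k \<delta> (A i) \<le> hausdorff k (A i)" for i
        unfolding hausdorff_def using that by (intro SUP_upper) simp
      then have "(\<Sum>i. hausdorff_content k \<delta> (A i)) \<le> (\<Sum>i. hausdorff k (A i))"
        by (intro suminf_le) auto
      then show ?thesis
        using hausdorff_content_subadditive order_trans by blast
    qed
    then show "hausdorff k (\<Union>i. A i) \<le> (\<Sum>i. hausdorff k (A i))"
      by (subst hausdorff_def) (auto intro!: SUP_least)
  qed
qed

lemma measure_space_hausdorff:
  "measure_space UNIV (lambda_system UNIV UNIV (hausdorff k))
     (hausdorff k :: 'a::metric_space set \<Rightarrow> ennreal)"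
proof -
  interpret sigma_algebra UNIV "UNIV :: 'a set set"
    using sigma_algebra_Pow[of "UNIV :: 'a set"] by simp
  show ?thesis
    by (rule caratheodory_lemma[OF outer_measure_space_hausdorff])
qed

lemma space_hausdorff_measure [simp]: "space (hausdorff_measure k) = UNIV"
  by (simp add: hausdorff_measure_def)

lemma sets_hausdorff_measure:
  "sets (hausdorff_measure k) = lambda_system UNIV UNIV (hausdorff k)"
  using measure_space_hausdorff[of k, where 'a = 'a]
  by (simp add: hausdorff_measure_def measure_space_def sigma_algebra.sigma_sets_eq)

lemma emeasure_hausdorff_measure:
  "A \<in> sets (hausdorff_measure k) \<Longrightarrow> emeasure (hausdorff_measure k) A = hausdorff k A"
  using measure_space_hausdorff[of k, where 'a = 'a]
  by (simp add: sets_hausdorff_measure)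
     (simp add: hausdorff_measure_def measure_space_def emeasure_measure_of_sigma)


section \<open>Curves as one-dimensional submanifolds\<close>

text \<open>
  A regular \<open>C\<^sup>1\<close> parametrization of a relatively open piece of \<open>M\<close> by the parameter set \<open>I\<close>,
  sending \<open>0\<close> to \<open>z\<close>.  On a half-open interval \<open>{0..<\<epsilon>}\<close>, being \<open>C\<^sup>1\<close> means being the restriction
  of a map that is differentiable also at \<open>0\<close> in the two-sided sense, which is no restriction:
  a map that is \<open>C\<^sup>1\<close> up to the endpoint can be continued affinely to negative parameters.
\<close>

definition C1_chart :: "real set \<Rightarrow> (real \<Rightarrow> 'a::euclidean_space) \<Rightarrow> 'a set \<Rightarrow> 'a \<Rightarrow> bool" where
  "C1_chart I \<gamma> M z \<longleftrightarrow>
     \<gamma> C1_differentiable_on I \<and> (\<forall>s\<in>I. vector_derivative \<gamma> (at s) \<noteq> 0) \<and> \<gamma> 0 = z \<and>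
     (\<exists>U g. open U \<and> z \<in> U \<and> homeomorphism I (M \<inter> U) \<gamma> g)"

definition interior_chart :: "(real \<Rightarrow> 'a::euclidean_space) \<Rightarrow> 'a set \<Rightarrow> 'a \<Rightarrow> bool" where
  "interior_chart \<gamma> M z \<longleftrightarrow> (\<exists>\<epsilon>>0. C1_chart {-\<epsilon><..<\<epsilon>} \<gamma> M z)"

definition boundary_chart :: "(real \<Rightarrow> 'a::euclidean_space) \<Rightarrow> 'a set \<Rightarrow> 'a \<Rightarrow> bool" where
  "boundary_chart \<gamma> M z \<longleftrightarrow> (\<exists>\<epsilon>>0. C1_chart {0..<\<epsilon>} \<gamma> M z)"

definition C1_curve :: "'a::euclidean_space set \<Rightarrow> bool" where
  "C1_curve M \<longleftrightarrow> (\<forall>z\<in>M. \<exists>\<gamma>. interior_chart \<gamma> M z)"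

definition C1_curve_with_boundary :: "'a::euclidean_space set \<Rightarrow> bool" where
  "C1_curve_with_boundary M \<longleftrightarrow> (\<forall>z\<in>M. \<exists>\<gamma>. interior_chart \<gamma> M z \<or> boundary_chart \<gamma> M z)"

text \<open>The boundary in the sense of manifolds, not the topological \<open>frontier\<close>.\<close>

definition curve_boundary :: "'a::euclidean_space set \<Rightarrow> 'a set" where
  "curve_boundary M = {z\<in>M. \<exists>\<gamma>. boundary_chart \<gamma> M z}"

definition tangent_line :: "'a::euclidean_space set \<Rightarrow> 'a \<Rightarrow> 'a set" where
  "tangent_line M z =
     {c *\<^sub>R vector_derivative \<gamma> (at 0) |c \<gamma>. interior_chart \<gamma> M z \<or> boundary_chart \<gamma> M z}"

definition curve_orientation :: "'a::euclidean_space set \<Rightarrow> ('a \<Rightarrow> 'a) \<Rightarrow> bool" where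
  "curve_orientation M t \<longleftrightarrow>
     continuous_on M t \<and> (\<forall>z\<in>M. norm (t z) = 1 \<and> t z \<in> tangent_line M z)"

text \<open>
  The standing assumptions on the curve \<open>C\<close>, whose closure is oriented by the unit tangent field
  \<open>t\<close>; the boundary points of \<open>C\<close> are those of its closure.
\<close>

definition admissible_curve :: "'a::euclidean_space set \<Rightarrow> ('a \<Rightarrow> 'a) \<Rightarrow> bool" where
  "admissible_curve C t \<longleftrightarrow>
     C1_curve C \<and>
     C1_curve_with_boundary (closure C) \<and> compact (closure C) \<and>
     finite (curve_boundary (closure C)) \<and>
     card (curve_boundary (closure C)) > 0 \<and> even (card (curve_boundary (closure C))) \<and>
     closure C = C \<union> curve_boundary (closure C) \<and>
     curve_orientation (closure C) t"


section \<open>Discs\<close>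

definition unit_perp :: "'a::euclidean_space \<Rightarrow> 'a set" where
  "unit_perp u = sphere 0 1 \<inter> {u}\<^sup>\<bottom>"

definition disc :: "'a::euclidean_space \<Rightarrow> 'a \<Rightarrow> real \<Rightarrow> 'a set" where
  "disc p u r = {p + \<xi> *\<^sub>R v |v \<xi>. v \<in> unit_perp u \<and> \<xi> \<in> {0..<r}}"

definition disc_boundary :: "'a::euclidean_space \<Rightarrow> 'a \<Rightarrow> real \<Rightarrow> 'a set" where
  "disc_boundary p u r = {p + r *\<^sub>R v |v. v \<in> unit_perp u}"

definition closed_disc :: "'a::euclidean_space \<Rightarrow> 'a \<Rightarrow> real \<Rightarrow> 'a set" where
  "closed_disc p u r = disc p u r \<union> disc_boundary p u r"

text \<open>
  The metric of the product type is the Euclidean one, so \<open>'a \<times> 'a \<times> real\<close> plays the role of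
  the Euclidean space of dimension \<open>2 * DIM('a) + 1\<close>.
\<close>

definition discs :: "('a::euclidean_space \<times> 'a \<times> real) set" where
  "discs = UNIV \<times> sphere 0 1 \<times> {0<..}"

definition discs_boundary_pt :: "'a::euclidean_space set \<Rightarrow> ('a \<times> 'a \<times> real) set" where
  "discs_boundary_pt C =
     {(p, u, r) \<in> discs. closed_disc p u r \<inter> curve_boundary (closure C) \<noteq> {}}"

definition discs_tan ::
    "'a::euclidean_space set \<Rightarrow> ('a \<Rightarrow> 'a) \<Rightarrow> ('a \<times> 'a \<times> real) set" where
  "discs_tan C t = {(p, u, r) \<in> discs. \<exists>z \<in> closed_disc p u r \<inter> closure C. t z \<bullet> u = 0}"

definition discs_touching :: "'a::euclidean_space set \<Rightarrow> ('a \<times> 'a \<times> real) set" where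
  "discs_touching C = {(p, u, r) \<in> discs. disc_boundary p u r \<inter> C \<noteq> {}}"

definition discs_odd ::
    "'a::euclidean_space set \<Rightarrow> ('a \<Rightarrow> 'a) \<Rightarrow> ('a \<times> 'a \<times> real) set" where
  "discs_odd C t =
     {(p, u, r) \<in> discs - (discs_boundary_pt C \<union> discs_tan C t \<union> discs_touching C).
        \<exists>m::nat. odd m \<and> hausdorff 0 (disc p u r \<inter> C) = of_nat m}"


section \<open>The \<open>\<sigma>\<close>-length\<close>

definition sigma_length ::
    "real \<Rightarrow> 'a::euclidean_space set \<Rightarrow> ('a \<Rightarrow> 'a) \<Rightarrow> 'a set \<Rightarrow> ennreal" where
  "sigma_length \<sigma> C t \<Omega> =
     (\<integral>\<^sup>+ (p, u, r) \<in> discs_odd C t.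
        ennreal (r powr (1 - real DIM('a) - \<sigma>)) * (SUP a\<in>unit_perp u. indicator \<Omega> (p + r *\<^sub>R a))
      \<partial>hausdorff_measure (2 * DIM('a)))"

end

theory Submission
  imports Defs
begin

text \<open>
  Write \<open>\<omega>\<close> for the volume of the unit ball of a hyperplane, \<open>M\<close> for the closure of the curve and
  \<open>L\<close> for its length.  For fixed \<open>u\<close> and a piece of \<open>M\<close> of small diameter \<open>d\<close> with tangent close to
  \<open>t\<close>, the centres \<open>p\<close> of the discs of radius \<open>r\<close> that meet the piece fill, up to small errors, a
  cylinder of height \<open>d \<bar>t \<bullet> u\<bar>\<close> over a ball of radius \<open>r\<close>.  As the integral of \<open>\<bar>t \<bullet> u\<bar>\<close> over the
  sphere is \<open>2 \<omega>\<close>, the discs of radius \<open>r\<close> that meet \<open>M\<close> have measure at most \<open>2 \<omega>\<^sup>2 L r ^ (n - 1)\<close>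
  for every \<open>r\<close>.  If \<open>r\<close> is small and \<open>\<bar>t \<bullet> u\<bar> > \<epsilon>\<close> at some point of the disc on \<open>M\<close>, this is the only
  such point, so these discs are odd, and their measure is at least
  \<open>(2 \<omega>\<^sup>2 - O(\<epsilon>)) L r ^ (n - 1)\<close>.  Against the weight \<open>r powr (1 - n - \<sigma>)\<close> the radii in \<open>{0..a}\<close>
  contribute \<open>a powr (1 - \<sigma>) / (1 - \<sigma>)\<close> times these constants.  For large \<open>r\<close> the centre of a
  disc that meets \<open>M\<close> and has a boundary point in \<open>\<Omega>\<close> lies in a cylindrical shell of measure
  \<open>O(r ^ (n - 2))\<close>, so that large radii contribute a bounded amount.

  The measure on the space of discs is the product of Lebesgue measure, the cone measure of
  the sphere and Lebesgue measure: both measures agree up to factors close to \<open>1\<close> on small caps of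
  the sphere, since an orthogonal projection is almost an isometry there, and on Euclidean space
  Hausdorff and Lebesgue measure agree by the Vitali covering theorem and the isodiametric
  inequality, which follows from Steiner symmetrization.
\<close>

section \<open>Slicing by hyperplanes\<close>

text \<open>The set \<open>discs_odd\<close> is only trapped between Borel sets:
  \<open>crossing_discs\<close>, whose discs have exactly one curve point, and
  \<open>meeting_discs\<close> (for large radii \<open>far_discs\<close>). These are Borel because
  quantification over a compact curve yields closed sets, and \<open>nn_integral_mono\<close>
  compares the integrals of arbitrary functions. One factor \<omega> is the cross-section of the
  cylinders of centres, the other comes with the mean of \<bar>t \<bullet> u\<bar>. Since a powr (1
  - \<sigma>) tends to 1 for each fixed a > 0, the lower bound may restrict the radii to an interval
  that depends on \<epsilon>, and \<epsilon> is fixed before \<sigma> tends to 1. Length enters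
  through diameters alone: arbitrary covers bound the discs from above, a partition into disjoint
  connected pieces bounds them from below. Connectedness makes the heights of a piece over the line
  of \<open>u\<close> an interval; disjointness and uniqueness of the crossing make the cylinders
  disjoint. All quantities are in \<open>ennreal\<close>, so infinite length costs only a case
  distinction in \<open>crofton_upper_bound\<close>.\<close>

lemma nn_integral_lborel_translate:
  fixes f :: "'a::euclidean_space \<Rightarrow> ennreal"
  assumes [measurable]: "f \<in> borel_measurable borel"
  shows "(\<integral>\<^sup>+x. f (x + c) \<partial>lborel) = (\<integral>\<^sup>+x. f x \<partial>lborel)"
proof -
  have "(\<integral>\<^sup>+x. f x \<partial>lborel) = (\<integral>\<^sup>+x. f x \<partial>distr lborel borel ((+) c))"
    by (simp add: lborel_distr_plus)
  also have "\<dots> = (\<integral>\<^sup>+x. f (c + x) \<partial>lborel)"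
    by (subst nn_integral_distr) auto
  finally show ?thesis by (simp add: add.commute)
qed

lemma nn_integral_lborel_scale:
  fixes f :: "'a::euclidean_space \<Rightarrow> ennreal"
  assumes [measurable]: "f \<in> borel_measurable borel" and c: "c > 0"
  shows "(\<integral>\<^sup>+x. f x \<partial>lborel) = ennreal (c ^ DIM('a)) * (\<integral>\<^sup>+x. f (c *\<^sub>R x) \<partial>lborel)"
proof -
  have "(\<integral>\<^sup>+x. f x \<partial>lborel) =
      (\<integral>\<^sup>+x. f x \<partial>density (distr lborel borel (\<lambda>x. 0 + c *\<^sub>R x)) (\<lambda>_. \<bar>c\<bar> ^ DIM('a)))"
    using lborel_affine[of c "0::'a"] c by simp
  also have "\<dots> = (\<integral>\<^sup>+x. ennreal (c ^ DIM('a)) * f (c *\<^sub>R x) \<partial>lborel)"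
    using c by (subst nn_integral_density) (auto simp: nn_integral_distr)
  also have "\<dots> = ennreal (c ^ DIM('a)) * (\<integral>\<^sup>+x. f (c *\<^sub>R x) \<partial>lborel)"
    by (rule nn_integral_cmult) measurable
  finally show ?thesis .
qed

text \<open>For unit \<open>b\<close> this is the orthogonal projection onto the hyperplane with
  normal \<open>b\<close>. The formula is jointly continuous in both arguments, as needed where the
  normal \<open>u\<close> is itself a variable.\<close>

definition perp :: "'a::euclidean_space \<Rightarrow> 'a \<Rightarrow> 'a" where
  "perp b x = x - (x \<bullet> b) *\<^sub>R b"

lemma perp_add: "perp b (x + y) = perp b x + perp b y"
  by (simp add: perp_def algebra_simps inner_add_left)

lemma perp_diff: "perp b (x - y) = perp b x - perp b y"
  by (simp add: perp_def algebra_simps inner_diff_left)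

lemma perp_scaleR: "perp b (c *\<^sub>R x) = c *\<^sub>R perp b x"
  by (simp add: perp_def algebra_simps)

lemma continuous_on_perp [continuous_intros]:
  "continuous_on A f \<Longrightarrow> continuous_on A g \<Longrightarrow> continuous_on A (\<lambda>x. perp (f x) (g x))"
  unfolding perp_def by (intro continuous_intros)

lemma measurable_perp [measurable (raw)]:
  "f \<in> borel_measurable M \<Longrightarrow> g \<in> borel_measurable M \<Longrightarrow> (\<lambda>x. perp (f x) (g x)) \<in> borel_measurable M"
  unfolding perp_def by (intro borel_measurable_diff borel_measurable_scaleR borel_measurable_inner)

context
  fixes b :: "'a::euclidean_space"
  assumes b: "norm b = 1"
begin

lemma inner_unit_self: "b \<bullet> b = 1"
  using b by (simp add: norm_eq_1)

lemma perp_self: "perp b b = 0"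
  by (simp add: perp_def inner_unit_self)

lemma perp_line: "perp b (x + s *\<^sub>R b) = perp b x"
  by (simp add: perp_add perp_scaleR perp_self)

lemma perp_inner_unit [simp]: "perp b x \<bullet> b = 0"
  by (simp add: perp_def inner_diff_left inner_unit_self)

lemma perp_perp [simp]: "perp b (perp b x) = perp b x"
  by (subst (1) perp_def) simp

lemma perp_perp_line [simp]: "perp b (perp b x + s *\<^sub>R b) = perp b x"
  by (simp add: perp_line)

lemma norm_perp_decomp: "(norm x)\<^sup>2 = (norm (perp b x))\<^sup>2 + (x \<bullet> b)\<^sup>2"
  unfolding perp_def power2_norm_eq_inner
  by (simp add: inner_diff_left inner_diff_right inner_unit_self inner_commute power2_eq_square algebra_simps)

lemma norm_perp_le: "norm (perp b x) \<le> norm x"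
  by (rule power2_le_imp_le) (simp_all add: norm_perp_decomp[of x])

text \<open>The coordinate swap \<open>(x, s) \<mapsto> (perp b x + s b, - x \<bullet> b)\<close> is a product of three shears, each of
  which preserves Lebesgue measure by translation invariance.\<close>

lemma nn_integral_coordinate_swap:
  fixes F :: "'a \<times> real \<Rightarrow> ennreal"
  assumes [measurable]: "F \<in> borel_measurable borel"
  shows "(\<integral>\<^sup>+x. \<integral>\<^sup>+s. F (x, s) \<partial>lborel \<partial>lborel) =
    (\<integral>\<^sup>+x. \<integral>\<^sup>+s. F (perp b x + s *\<^sub>R b, - (x \<bullet> b)) \<partial>lborel \<partial>lborel)"
proof -
  have [measurable]: "F \<in> borel_measurable (borel \<Otimes>\<^sub>M borel)"
    using assms by (simp add: borel_prod)
  have shear: "(\<integral>\<^sup>+x. \<integral>\<^sup>+s. G (x, s) \<partial>lborel \<partial>lborel) = (\<integral>\<^sup>+x. \<integral>\<^sup>+s. G (x + s *\<^sub>R b, s) \<partial>lborel \<partial>lborel)"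
    if [measurable]: "G \<in> borel_measurable borel" for G :: "'a \<times> real \<Rightarrow> ennreal"
  proof -
    have "(\<integral>\<^sup>+x. \<integral>\<^sup>+s. G (x, s) \<partial>lborel \<partial>lborel) = (\<integral>\<^sup>+s. \<integral>\<^sup>+x. G (x, s) \<partial>lborel \<partial>lborel)"
      by (rule lborel_pair.Fubini'[symmetric]) (simp add: lborel_prod)
    also have "\<dots> = (\<integral>\<^sup>+s. \<integral>\<^sup>+x. G (x + s *\<^sub>R b, s) \<partial>lborel \<partial>lborel)"
      by (intro nn_integral_cong nn_integral_lborel_translate[symmetric]) measurable
    also have "\<dots> = (\<integral>\<^sup>+x. \<integral>\<^sup>+s. G (x + s *\<^sub>R b, s) \<partial>lborel \<partial>lborel)"
      by (rule lborel_pair.Fubini') (simp add: split_def)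
    finally show ?thesis .
  qed
  let ?F1 = "\<lambda>y::'a \<times> real. F (fst y + snd y *\<^sub>R b, snd y)"
  let ?F2 = "\<lambda>y::'a \<times> real. ?F1 (fst y, snd y + - (fst y \<bullet> b))"
  have "(\<integral>\<^sup>+x. \<integral>\<^sup>+s. F (x, s) \<partial>lborel \<partial>lborel) = (\<integral>\<^sup>+x. \<integral>\<^sup>+s. ?F1 (x, s) \<partial>lborel \<partial>lborel)"
    by (subst shear) auto
  also have "\<dots> = (\<integral>\<^sup>+x. \<integral>\<^sup>+s. ?F2 (x, s) \<partial>lborel \<partial>lborel)"
    unfolding fst_conv snd_conv
    by (intro nn_integral_cong nn_integral_lborel_translate[symmetric]) measurable
  also have "\<dots> = (\<integral>\<^sup>+x. \<integral>\<^sup>+s. ?F2 (x + s *\<^sub>R b, s) \<partial>lborel \<partial>lborel)"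
    by (rule shear) (unfold borel_prod[symmetric], measurable)
  also have "\<dots> = (\<integral>\<^sup>+x. \<integral>\<^sup>+s. F (perp b x + s *\<^sub>R b, - (x \<bullet> b)) \<partial>lborel \<partial>lborel)"
    by (simp add: perp_def inner_add_left inner_unit_self algebra_simps)
  finally show ?thesis .
qed

text \<open>Fubini along the lines parallel to \<open>b\<close> without a measure on the hyperplane:
  every such line runs through the slab 0 \<le> x \<bullet> b \<le> 1 in a unit segment, so
  integrating over the slab integrates once over the lines.\<close>

lemma nn_integral_slices:
  fixes f :: "'a \<Rightarrow> ennreal"
  assumes [measurable]: "f \<in> borel_measurable borel"
  shows "(\<integral>\<^sup>+x. f x \<partial>lborel) =
    (\<integral>\<^sup>+x. indicator {0..1} (x \<bullet> b) * (\<integral>\<^sup>+s. f (perp b x + s *\<^sub>R b) \<partial>lborel) \<partial>lborel)"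
proof -
  \<comment> \<open>A factor of integral 1 in the auxiliary variable; the swap turns it into the
    condition that \<open>x\<close> lies in the unit slab.\<close>
  have "(\<integral>\<^sup>+x. f x \<partial>lborel) = (\<integral>\<^sup>+x. \<integral>\<^sup>+s. f x * indicator {-1..0::real} s \<partial>lborel \<partial>lborel)"
    by (simp add: nn_integral_cmult)
  also have "\<dots> = (\<integral>\<^sup>+x. \<integral>\<^sup>+s. (\<lambda>(x, s). f x * indicator {-1..0::real} s) (x, s) \<partial>lborel \<partial>lborel)"
    by simp
  also have "\<dots> = (\<integral>\<^sup>+x. \<integral>\<^sup>+s. (\<lambda>(x, s). f x * indicator {-1..0::real} s) (perp b x + s *\<^sub>R b, - (x \<bullet> b)) \<partial>lborel \<partial>lborel)"
    by (rule nn_integral_coordinate_swap) (simp add: split_def borel_prod[symmetric])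
  also have "\<dots> = (\<integral>\<^sup>+x. (\<integral>\<^sup>+s. f (perp b x + s *\<^sub>R b) \<partial>lborel) * indicator {-1..0} (- (x \<bullet> b)) \<partial>lborel)"
    by (simp add: nn_integral_multc)
  also have "\<dots> = (\<integral>\<^sup>+x. indicator {0..1} (x \<bullet> b) * (\<integral>\<^sup>+s. f (perp b x + s *\<^sub>R b) \<partial>lborel) \<partial>lborel)"
    by (intro nn_integral_cong) (auto simp: indicator_def)
  finally show ?thesis .
qed

text \<open>Height 1 makes its volume the (n-1)-dimensional volume of a ball of radius \<rho> in the
  hyperplane, with no lower-dimensional measure involved.\<close>

definition unit_cylinder :: "real \<Rightarrow> 'a set" where
  "unit_cylinder \<rho> = {x. x \<bullet> b \<in> {0..1} \<and> norm (perp b x) \<le> \<rho>}"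

lemma sets_unit_cylinder [measurable]: "unit_cylinder \<rho> \<in> sets borel"
  unfolding unit_cylinder_def by measurable

lemma emeasure_cylinder_aux:
  assumes [measurable]: "J \<in> sets borel"
  shows "emeasure lborel {p. p \<bullet> b \<in> J \<and> norm (perp b (p - z)) \<le> \<rho>} =
    emeasure lborel J * emeasure lborel (unit_cylinder \<rho>)"
proof -
  let ?f = "\<lambda>p. indicator {p. p \<bullet> b \<in> J \<and> norm (perp b (p - z)) \<le> \<rho>} p :: ennreal"
  let ?g = "\<lambda>x. indicator {x. x \<bullet> b \<in> {0..1} \<and> norm (perp b (x - perp b z)) \<le> \<rho>} x :: ennreal"
  have *: "?f (perp b x + s *\<^sub>R b) = indicator {x. norm (perp b (x - z)) \<le> \<rho>} x * indicator J s" for x s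
    by (auto simp: indicator_def perp_diff inner_add_left inner_unit_self)
  have "emeasure lborel {p. p \<bullet> b \<in> J \<and> norm (perp b (p - z)) \<le> \<rho>} = (\<integral>\<^sup>+x. ?f x \<partial>lborel)"
    by (rule nn_integral_indicator[symmetric]) measurable
  also have "\<dots> = (\<integral>\<^sup>+x. indicator {0..1} (x \<bullet> b) * (indicator {x. norm (perp b (x - z)) \<le> \<rho>} x * emeasure lborel J) \<partial>lborel)"
    by (subst nn_integral_slices) (simp_all only: *, auto simp: nn_integral_cmult)
  also have "\<dots> = (\<integral>\<^sup>+x. emeasure lborel J * ?g x \<partial>lborel)"
    by (intro nn_integral_cong) (auto simp: indicator_def perp_diff)
  also have "\<dots> = emeasure lborel J * (\<integral>\<^sup>+x. ?g x \<partial>lborel)"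
    by (rule nn_integral_cmult) measurable
  \<comment> \<open>The shift by \<open>perp b z\<close> moves the centre to the axis; being
    orthogonal to \<open>b\<close>, it preserves the slab.\<close>
  also have "(\<integral>\<^sup>+x. ?g x \<partial>lborel) = (\<integral>\<^sup>+x. ?g (x + perp b z) \<partial>lborel)"
    by (rule nn_integral_lborel_translate[symmetric]) measurable
  also have "\<dots> = (\<integral>\<^sup>+x. indicator (unit_cylinder \<rho>) x \<partial>lborel)"
    by (intro nn_integral_cong) (auto simp: indicator_def unit_cylinder_def inner_add_left)
  finally show ?thesis by simp
qed

text \<open>The cylinder of height and radius \<rho> is the unit cylinder dilated by \<rho>;
  cancelling its height leaves the exponent n - 1.\<close>

lemma emeasure_unit_cylinder_scale:
  assumes "\<rho> > 0"
  shows "emeasure lborel (unit_cylinder \<rho>) = ennreal (\<rho> ^ (DIM('a) - 1)) * emeasure lborel (unit_cylinder 1)"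
proof -
  let ?S = "{x. x \<bullet> b \<in> {0..\<rho>} \<and> norm (perp b (x - 0)) \<le> \<rho>}"
  have "ennreal \<rho> * emeasure lborel (unit_cylinder \<rho>) = emeasure lborel ?S"
    using assms by (subst emeasure_cylinder_aux) auto
  also have "\<dots> = (\<integral>\<^sup>+x. indicator ?S x \<partial>lborel)"
    by (rule nn_integral_indicator[symmetric]) measurable
  also have "\<dots> = ennreal (\<rho> ^ DIM('a)) * (\<integral>\<^sup>+x. indicator ?S (\<rho> *\<^sub>R x) \<partial>lborel)"
    by (rule nn_integral_lborel_scale[OF _ assms]) measurable
  also have "(\<lambda>x. indicator ?S (\<rho> *\<^sub>R x) :: ennreal) = indicator (unit_cylinder 1)"
    using assms by (auto simp: fun_eq_iff indicator_def unit_cylinder_def perp_scaleR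
        mult_le_cancel_left1 zero_le_mult_iff)
  also have "ennreal (\<rho> ^ DIM('a)) = ennreal \<rho> * ennreal (\<rho> ^ (DIM('a) - 1))"
    using assms by (subst ennreal_mult[symmetric]) (auto simp flip: power_Suc)
  finally have "ennreal \<rho> * emeasure lborel (unit_cylinder \<rho>) =
      ennreal \<rho> * (ennreal (\<rho> ^ (DIM('a) - 1)) * emeasure lborel (unit_cylinder 1))"
    by (simp add: mult_ac)
  then show ?thesis
    using assms by (simp add: ennreal_mult_cancel_left)
qed

text \<open>The slice of the ball at height \<open>s\<close> is a ball of radius sqrt (1 - s^2) in
  the hyperplane; exchanging the integrals leaves one over the height.\<close>

lemma nn_integral_unit_ball:
  fixes \<phi> :: "real \<Rightarrow> ennreal"
  assumes [measurable]: "\<phi> \<in> borel_measurable borel"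
  shows "(\<integral>\<^sup>+x. \<phi> (x \<bullet> b) * indicator (cball 0 1) x \<partial>lborel) =
    emeasure lborel (unit_cylinder 1) *
    (\<integral>\<^sup>+s. \<phi> s * ennreal (indicator {-1..1} s * sqrt (1 - s\<^sup>2) ^ (DIM('a) - 1)) \<partial>lborel)"
proof -
  let ?I = "\<lambda>x s. indicator {0..1} (x \<bullet> b) * (\<phi> s * indicator {(x, s). (norm (perp b x))\<^sup>2 + s\<^sup>2 \<le> 1} (x, s))"
  have ball: "norm (perp b x + s *\<^sub>R b) \<le> 1 \<longleftrightarrow> (norm (perp b x))\<^sup>2 + s\<^sup>2 \<le> 1" for x s
    using abs_square_le_1[of "norm (perp b x + s *\<^sub>R b)"]
    by (simp add: norm_perp_decomp[of "perp b x + s *\<^sub>R b"] inner_add_left inner_unit_self)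
  have "(\<integral>\<^sup>+x. \<phi> (x \<bullet> b) * indicator (cball 0 1) x \<partial>lborel) =
      (\<integral>\<^sup>+x. indicator {0..1} (x \<bullet> b) * (\<integral>\<^sup>+s. \<phi> s * indicator {(x, s). (norm (perp b x))\<^sup>2 + s\<^sup>2 \<le> 1} (x, s) \<partial>lborel) \<partial>lborel)"
    by (subst nn_integral_slices)
       (auto simp: ball inner_add_left inner_unit_self indicator_def intro!: nn_integral_cong)
  also have "\<dots> = (\<integral>\<^sup>+x. \<integral>\<^sup>+s. ?I x s \<partial>lborel \<partial>lborel)"
    by (intro nn_integral_cong nn_integral_cmult[symmetric]) measurable
  also have "\<dots> = (\<integral>\<^sup>+s. \<integral>\<^sup>+x. ?I x s \<partial>lborel \<partial>lborel)"
    by (rule lborel_pair.Fubini'[symmetric]) measurable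
  also have "\<dots> = (\<integral>\<^sup>+s. emeasure lborel (unit_cylinder 1) *
      (\<phi> s * ennreal (indicator {-1..1} s * sqrt (1 - s\<^sup>2) ^ (DIM('a) - 1))) \<partial>lborel)"
  proof (rule nn_integral_cong_AE)
    \<comment> \<open>At s = 1 and s = -1 the radius degenerates to 0, which the scaling lemma
      excludes.\<close>
    have "AE s in lborel. s \<notin> {1, -1::real}"
      by (intro AE_not_in countable_imp_null_set_lborel) auto
    then show "AE s in lborel. (\<integral>\<^sup>+x. ?I x s \<partial>lborel) = emeasure lborel (unit_cylinder 1) *
      (\<phi> s * ennreal (indicator {-1..1} s * sqrt (1 - s\<^sup>2) ^ (DIM('a) - 1)))"
    proof eventually_elim
      case (elim s)
      show ?case
      proof (cases "s \<in> {-1<..<1}")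
        case True
        then have s: "s\<^sup>2 < 1" by (auto simp: abs_square_less_1)
        have "(\<integral>\<^sup>+x. ?I x s \<partial>lborel) = (\<integral>\<^sup>+x. \<phi> s * indicator (unit_cylinder (sqrt (1 - s\<^sup>2))) x \<partial>lborel)"
        proof (intro nn_integral_cong)
          fix x
          have "norm (perp b x) \<le> sqrt (1 - s\<^sup>2) \<longleftrightarrow> (norm (perp b x))\<^sup>2 + s\<^sup>2 \<le> 1"
            using s real_sqrt_le_iff[of "(norm (perp b x))\<^sup>2" "1 - s\<^sup>2"] by (auto simp: algebra_simps)
          then show "?I x s = \<phi> s * indicator (unit_cylinder (sqrt (1 - s\<^sup>2))) x"
            by (auto simp: indicator_def unit_cylinder_def)
        qed
        also have "\<dots> = \<phi> s * emeasure lborel (unit_cylinder (sqrt (1 - s\<^sup>2)))"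
          by (simp add: nn_integral_cmult)
        also have "\<dots> = \<phi> s * (ennreal (sqrt (1 - s\<^sup>2) ^ (DIM('a) - 1)) * emeasure lborel (unit_cylinder 1))"
          using s by (subst emeasure_unit_cylinder_scale) auto
        finally show ?thesis
          using True by (simp add: mult_ac)
      next
        case False
        with elim have s: "s \<notin> {-1..1}" by auto
        then have "s\<^sup>2 > 1" by (meson abs_le_iff abs_square_le_1 atLeastAtMost_iff linorder_not_le minus_le_iff)
        then have "\<not> (norm (perp b x))\<^sup>2 + s\<^sup>2 \<le> 1" for x
          by (smt (verit) zero_le_power2)
        then show ?thesis using s by simp
      qed
    qed
  qed
  also have "\<dots> = emeasure lborel (unit_cylinder 1) *
      (\<integral>\<^sup>+s. \<phi> s * ennreal (indicator {-1..1} s * sqrt (1 - s\<^sup>2) ^ (DIM('a) - 1)) \<partial>lborel)"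
    by (rule nn_integral_cmult) measurable
  finally show ?thesis .
qed

text \<open>The factor is the Beta integral over the heights of the slices of the ball, in the form
  in which \<open>emeasure_cball_aux_integral\<close> states it.\<close>

lemma unit_ball_vol_rec:
  "unit_ball_vol (real (Suc n)) = unit_ball_vol (real n) * Beta (1 / 2) (real n / 2 + 1)"
proof -
  have "Gamma (real n / 2 + 1) > 0"
    by (rule Gamma_real_pos) simp
  then have G: "Gamma (real n / 2 + 1) \<noteq> 0" by (metis less_irrefl)
  have "pi powr (real (Suc n) / 2) = pi powr (real n / 2) * sqrt pi"
    by (simp add: powr_half_sqrt[symmetric] powr_add[symmetric] add_divide_distrib add.commute)
  moreover have "real (Suc n) / 2 + 1 = 1 / 2 + (real n / 2 + 1)"
    by (simp add: field_simps)
  ultimately show ?thesis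
    using G unfolding unit_ball_vol_def Beta_def Gamma_one_half_real by simp
qed

text \<open>The ball volume computed by slices is the cylinder volume times a Beta value; comparison
  with the recursion for \<open>unit_ball_vol\<close> determines the cylinder volume.\<close>

lemma emeasure_unit_cylinder:
  "emeasure lborel (unit_cylinder 1) = ennreal (unit_ball_vol (real (DIM('a) - 1)))"
proof -
  have n: "Suc (DIM('a) - 1) = DIM('a)" by simp
  let ?B = "Beta (1 / 2) (real (DIM('a) - 1) / 2 + 1)"
  have B: "?B > 0"
    unfolding Beta_def by (intro divide_pos_pos mult_pos_pos Gamma_real_pos) (auto intro: add_nonneg_pos add_pos_nonneg)
  have "ennreal ?B * ennreal (unit_ball_vol (real (DIM('a) - 1))) = ennreal (unit_ball_vol (real (DIM('a))))"
    using unit_ball_vol_rec[of "DIM('a) - 1"] B by (simp add: n ennreal_mult'' mult.commute)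
  also have "\<dots> = (\<integral>\<^sup>+x. 1 * indicator (cball (0::'a) 1) x \<partial>lborel)"
    by (simp add: emeasure_cball)
  also have "\<dots> = emeasure lborel (unit_cylinder 1) * ennreal ?B"
    using nn_integral_unit_ball[of "\<lambda>_. 1"] by (simp only: mult_1_left emeasure_cball_aux_integral borel_measurable_const)
  also have "\<dots> = ennreal ?B * emeasure lborel (unit_cylinder 1)"
    by (rule mult.commute)
  finally show ?thesis
    using B by (subst (asm) ennreal_mult_cancel_left) auto
qed

lemma emeasure_cylinder:
  assumes J: "J \<in> sets borel" and \<rho>: "\<rho> > 0"
  shows "emeasure lborel {p. p \<bullet> b \<in> J \<and> norm (perp b (p - z)) \<le> \<rho>} =
    emeasure lborel J * ennreal (unit_ball_vol (real (DIM('a) - 1)) * \<rho> ^ (DIM('a) - 1))"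
  using emeasure_cylinder_aux[OF J] emeasure_unit_cylinder_scale[OF \<rho>] \<rho>
  by (simp add: emeasure_unit_cylinder ennreal_mult' mult_ac)

lemma emeasure_perp_shell:
  assumes J: "J \<in> sets borel" and \<rho>: "\<rho>' > 0" "\<rho>' < \<rho>" and fin: "emeasure lborel J < top"
  shows "emeasure lborel {p. p \<bullet> b \<in> J \<and> \<rho>' < norm (perp b p) \<and> norm (perp b p) \<le> \<rho>} =
    emeasure lborel J * ennreal (unit_ball_vol (real (DIM('a) - 1)) * (\<rho> ^ (DIM('a) - 1) - \<rho>' ^ (DIM('a) - 1)))"
proof -
  let ?m = "DIM('a) - 1"
  let ?S = "\<lambda>\<rho>. {p. p \<bullet> b \<in> J \<and> norm (perp b p) \<le> \<rho>}"
  have [measurable]: "J \<in> sets borel" by fact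
  have c: "emeasure lborel (?S s) = emeasure lborel J * ennreal (unit_ball_vol (real ?m) * s ^ ?m)" if "s > 0" for s
    using emeasure_cylinder[OF J that, of 0] by simp
  have "{p. p \<bullet> b \<in> J \<and> \<rho>' < norm (perp b p) \<and> norm (perp b p) \<le> \<rho>} = ?S \<rho> - ?S \<rho>'"
    by auto
  moreover have "emeasure lborel (?S \<rho> - ?S \<rho>') = emeasure lborel (?S \<rho>) - emeasure lborel (?S \<rho>')"
  proof (rule emeasure_Diff)
    show "emeasure lborel (?S \<rho>') \<noteq> \<infinity>"
      using fin \<rho> by (subst c) (auto simp: ennreal_mult_eq_top_iff)
  qed (use \<rho> in auto)
  moreover have "emeasure lborel (?S \<rho>) - emeasure lborel (?S \<rho>') =
      emeasure lborel J * (ennreal (unit_ball_vol (real ?m) * \<rho> ^ ?m) - ennreal (unit_ball_vol (real ?m) * \<rho>' ^ ?m))"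
    using \<rho> fin
    by (subst (1 2) c) (auto simp: ennreal_mult_eq_top_iff intro!: ennreal_right_diff_distrib[symmetric])
  ultimately show ?thesis
    using \<rho> by (simp add: ennreal_minus right_diff_distrib)
qed

section \<open>The mean of \<bar>x \<bullet> b\<bar> over the directions x\<close>

lemma nn_integral_abs_inner_ball:
  "(\<integral>\<^sup>+x. ennreal \<bar>x \<bullet> b\<bar> * indicator (cball 0 1) x \<partial>lborel) =
     ennreal (2 * unit_ball_vol (real (DIM('a) - 1)) / (real (DIM('a)) + 1))"
proof -
  define m where "m = DIM('a) - 1"
  have m: "real (DIM('a)) = real m + 1" by (simp add: m_def of_nat_diff)
  let ?f = "\<lambda>s. s * sqrt (1 - s\<^sup>2) ^ m"
  let ?h = "\<lambda>s. ennreal (?f s) * indicator {0..1} s"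
  \<comment> \<open>The antiderivative is minus the power m + 2 of sqrt (1 - s^2), divided by m + 2.
    It is differentiated only in the interior, because the square root has no derivative at
    0.\<close>
  have "(?f has_integral ((- (sqrt (1 - 1\<^sup>2) ^ (m + 2)) / (real m + 2)) - (- (sqrt (1 - 0\<^sup>2) ^ (m + 2)) / (real m + 2)))) {0..1}"
  proof (rule fundamental_theorem_of_calculus_interior)
    fix s :: real assume s: "s \<in> {0<..<1}"
    then have s2: "s\<^sup>2 < 1" by (simp add: power_less_one_iff)
    have "((\<lambda>s. sqrt (1 - s\<^sup>2)) has_real_derivative (inverse (sqrt (1 - s\<^sup>2)) / 2 * (- 2 * s))) (at s)"
      using s2 by (auto intro!: derivative_eq_intros)
    from DERIV_cdivide[OF DERIV_minus[OF DERIV_power[OF this, of "m + 2"]], of "real m + 2"]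
    have "((\<lambda>s. - (sqrt (1 - s\<^sup>2) ^ (m + 2)) / (real m + 2)) has_real_derivative
        - (real (m + 2) * sqrt (1 - s\<^sup>2) ^ (m + 1) * (inverse (sqrt (1 - s\<^sup>2)) / 2 * (- 2 * s))) / (real m + 2)) (at s)"
      by (simp add: mult_ac)
    moreover have "- (real (m + 2) * sqrt (1 - s\<^sup>2) ^ (m + 1) * (inverse (sqrt (1 - s\<^sup>2)) / 2 * (- 2 * s))) / (real m + 2) = ?f s"
    proof -
      have *: "- (real (m + 2) * q ^ (m + 1) * (inverse q / 2 * (- 2 * s))) / (real m + 2) = s * q ^ m"
        if "q > 0" for q :: real
      proof -
        have "- (real (m + 2) * q ^ (m + 1) * (inverse q / 2 * (- 2 * s))) = (real m + 2) * (s * (q * inverse q * q ^ m))"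
          by (simp add: algebra_simps)
        moreover have "q * inverse q = 1" using that by simp
        ultimately show ?thesis by (simp only:) simp
      qed
      show ?thesis using s2 by (intro *) simp
    qed
    ultimately show "((\<lambda>s. - (sqrt (1 - s\<^sup>2) ^ (m + 2)) / (real m + 2)) has_vector_derivative ?f s) (at s)"
      by (simp add: has_real_derivative_iff_has_vector_derivative)
  qed (auto intro!: continuous_intros)
  then have "(?f has_integral 1 / (real m + 2)) {0..1}"
    by simp
  moreover have "0 \<le> ?f s" if "s \<in> {0..1}" for s
    using that by (auto simp: abs_square_le_1)
  ultimately have "(\<integral>\<^sup>+s. ennreal (indicator {0..1} s * ?f s) \<partial>lborel) = ennreal (1 / (real m + 2))"
    by (intro nn_integral_has_integral_lebesgue) auto
  moreover have "ennreal (indicator {0..1} s * ?f s) = ?h s" for s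
    by (simp add: indicator_def)
  ultimately have half: "(\<integral>\<^sup>+s. ?h s \<partial>lborel) = ennreal (1 / (real m + 2))"
    by simp
  have "(\<integral>\<^sup>+s. ennreal \<bar>s\<bar> * ennreal (indicator {-1..1} s * sqrt (1 - s\<^sup>2) ^ m) \<partial>lborel) =
      (\<integral>\<^sup>+s. ?h s + ?h (- s) \<partial>lborel)"
  proof (rule nn_integral_cong)
    fix s :: real
    have "s\<^sup>2 \<le> 1" if "-1 \<le> s" "s \<le> 1"
      using that by (simp add: abs_square_le_1 abs_le_iff)
    then show "ennreal \<bar>s\<bar> * ennreal (indicator {-1..1} s * sqrt (1 - s\<^sup>2) ^ m) = ?h s + ?h (- s)"
      by (cases s "0::real" rule: linorder_cases)
         (auto simp: indicator_def ennreal_mult[symmetric])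
  qed
  also have "\<dots> = (\<integral>\<^sup>+s. ?h s \<partial>lborel) + (\<integral>\<^sup>+s. ?h (- s) \<partial>lborel)"
    by (rule nn_integral_add) measurable
  also have "(\<integral>\<^sup>+s. ?h (- s) \<partial>lborel) = (\<integral>\<^sup>+s. ?h s \<partial>lborel)"
    using nn_integral_real_affine[of ?h "-1" 0] by simp
  also have "(\<integral>\<^sup>+s. ?h s \<partial>lborel) + (\<integral>\<^sup>+s. ?h s \<partial>lborel) = ennreal (2 / (real m + 2))"
    by (simp add: half flip: ennreal_plus)
  finally show ?thesis
    using nn_integral_unit_ball[of "\<lambda>s. ennreal \<bar>s\<bar>"] m
    unfolding m_def[symmetric] m emeasure_unit_cylinder
    by (simp add: ennreal_mult'[symmetric] mult.commute add.commute)
qed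

text \<open>The integrand is homogeneous of degree \<open>0\<close>; multiplying it by \<open>norm x\<close> and integrating in polar
  coordinates changes the integral over the ball by the factor \<open>n / (n + 1)\<close>.\<close>

lemma nn_integral_abs_inner_direction:
  "ennreal (real (DIM('a))) * (\<integral>\<^sup>+x. ennreal (\<bar>(x /\<^sub>R norm x) \<bullet> b\<bar>) * indicator (cball 0 1) x \<partial>lborel) =
     ennreal (2 * unit_ball_vol (real (DIM('a) - 1)))"
proof -
  define n where "n = DIM('a)"
  define G where "G = (\<integral>\<^sup>+x. ennreal (\<bar>(x /\<^sub>R norm x) \<bullet> b\<bar>) * indicator (cball 0 1) x \<partial>lborel)"
  have [measurable]: "cball (0::'a) 1 \<in> sets borel" by simp
  let ?g = "\<lambda>x. ennreal \<bar>(x /\<^sub>R norm x) \<bullet> b\<bar>"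
  have le1: "\<bar>(x /\<^sub>R norm x) \<bullet> b\<bar> \<le> 1" for x
    using Cauchy_Schwarz_ineq2[of "x /\<^sub>R norm x" b] b by (cases "x = 0") auto
  have "G \<le> (\<integral>\<^sup>+x. 1 * indicator (cball (0::'a) 1) x \<partial>lborel)"
    unfolding G_def using le1 by (intro nn_integral_mono mult_right_mono) (auto simp: ennreal_le_1)
  also have "\<dots> < top"
    by (simp add: emeasure_cball)
  finally obtain g where g: "G = ennreal g" "g \<ge> 0"
    by (cases G) auto
  have inner: "(\<integral>\<^sup>+x. ?g x * indicator (cball 0 s) x \<partial>lborel) = ennreal (s ^ n) * G" if "s > 0" for s
  proof -
    have "(\<integral>\<^sup>+x. ?g x * indicator (cball 0 s) x \<partial>lborel) =
        ennreal (s ^ n) * (\<integral>\<^sup>+x. ?g (s *\<^sub>R x) * indicator (cball 0 s) (s *\<^sub>R x) \<partial>lborel)"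
      unfolding n_def by (rule nn_integral_lborel_scale[OF _ that]) (intro borel_measurable_times_ennreal borel_measurable_indicator, auto)
    also have "(\<integral>\<^sup>+x. ?g (s *\<^sub>R x) * indicator (cball 0 s) (s *\<^sub>R x) \<partial>lborel) = G"
    proof -
      have "(s *\<^sub>R x) /\<^sub>R norm (s *\<^sub>R x) = x /\<^sub>R norm x" for x :: 'a
        using that by simp
      note * = this
      show ?thesis
        unfolding G_def using that
        by (intro nn_integral_cong) (simp only: *, simp add: indicator_def mult_le_cancel_left1)
    qed
    finally show ?thesis .
  qed
  \<comment> \<open>The radial variable \<open>s\<close> fills (0, 1]. The part \<open>?A\<close>,
    where s < norm x, supplies the missing factor norm x; the part \<open>?B\<close>, where norm x
    \<le> s, scales to s^n \<open>G\<close>; together they give \<open>G\<close>. Hence G = 2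
    \<omega> / (n + 1) + G / (n + 1).\<close>
  let ?A = "\<lambda>x s. ?g x * indicator (cball 0 1) x * (indicator {0<..1} s * indicator {(x, s). s < norm x} (x, s))"
  let ?B = "\<lambda>x s. indicator {0<..1} s * (?g x * indicator {(x, s). norm x \<le> s} (x, s))"
  have "(\<integral>\<^sup>+x. ennreal \<bar>x \<bullet> b\<bar> * indicator (cball 0 1) x \<partial>lborel) = (\<integral>\<^sup>+x. \<integral>\<^sup>+s. ?A x s \<partial>lborel \<partial>lborel)"
  proof (rule nn_integral_cong)
    fix x :: 'a
    have "(\<integral>\<^sup>+s. ?A x s \<partial>lborel) = ?g x * indicator (cball 0 1) x * (\<integral>\<^sup>+s. indicator {0<..1} s * indicator {(x, s). s < norm x} (x, s) \<partial>lborel)"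
      by (rule nn_integral_cmult) measurable
    also have "\<dots> = ?g x * indicator (cball 0 1) x * (\<integral>\<^sup>+s. indicator {0<..<norm x} s \<partial>lborel)"
    proof (cases "norm x \<le> 1")
      case True
      have "(\<integral>\<^sup>+s. indicator {0<..1} s * indicator {(x, s). s < norm x} (x, s) \<partial>lborel) = (\<integral>\<^sup>+s. indicator {0<..<norm x} s \<partial>lborel)"
        using True by (intro nn_integral_cong) (auto simp: indicator_def)
      then show ?thesis by simp
    qed simp
    also have "(\<integral>\<^sup>+s. indicator {0<..<norm x} s \<partial>lborel) = ennreal (norm x)"
      by simp
    also have "?g x * indicator (cball 0 1) x * ennreal (norm x) = ennreal \<bar>x \<bullet> b\<bar> * indicator (cball 0 1) x"
      by (cases "x = 0") (auto simp: indicator_def abs_mult ennreal_mult[symmetric])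
    finally show "ennreal \<bar>x \<bullet> b\<bar> * indicator (cball 0 1) x = (\<integral>\<^sup>+s. ?A x s \<partial>lborel)" by simp
  qed
  also have "\<dots> = (\<integral>\<^sup>+s. \<integral>\<^sup>+x. ?A x s \<partial>lborel \<partial>lborel)"
    by (rule lborel_pair.Fubini'[symmetric]) measurable
  finally have 1: "ennreal (2 * unit_ball_vol (real (DIM('a) - 1)) / (real n + 1)) = (\<integral>\<^sup>+s. \<integral>\<^sup>+x. ?A x s \<partial>lborel \<partial>lborel)"
    by (simp add: nn_integral_abs_inner_ball n_def)
  have "(\<integral>\<^sup>+s. ennreal (s ^ n) * indicator {0..1} s \<partial>lborel) = ennreal (1 ^ Suc n / real (Suc n) - 0 ^ Suc n / real (Suc n))"
    by (rule nn_integral_FTC_Icc) (auto intro!: derivative_eq_intros simp del: power_Suc)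
  then have "ennreal (1 / (real n + 1)) = (\<integral>\<^sup>+s. ennreal (s ^ n) * indicator {0..1} s \<partial>lborel)"
    by (simp add: add.commute)
  also have "\<dots> = (\<integral>\<^sup>+s. ennreal (s ^ n) * indicator {0<..1} s \<partial>lborel)"
    by (intro nn_integral_cong) (auto simp: indicator_def n_def)
  finally have pow: "(\<integral>\<^sup>+s. ennreal (s ^ n) * indicator {0<..1} s \<partial>lborel) = ennreal (1 / (real n + 1))" ..
  have "(\<integral>\<^sup>+s. \<integral>\<^sup>+x. ?B x s \<partial>lborel \<partial>lborel) = (\<integral>\<^sup>+s. ennreal (s ^ n) * indicator {0<..1} s * G \<partial>lborel)"
  proof (rule nn_integral_cong)
    fix s :: real
    have "(\<integral>\<^sup>+x. ?B x s \<partial>lborel) = indicator {0<..1} s * (\<integral>\<^sup>+x. ?g x * indicator {(x, s). norm x \<le> s} (x, s) \<partial>lborel)"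
      by (rule nn_integral_cmult) measurable
    moreover have "?g x * indicator {(x, s). norm x \<le> s} (x, s) = ?g x * indicator (cball 0 s) x" for x
      by (auto simp: indicator_def)
    ultimately have "(\<integral>\<^sup>+x. ?B x s \<partial>lborel) = indicator {0<..1} s * (\<integral>\<^sup>+x. ?g x * indicator (cball 0 s) x \<partial>lborel)"
      by (simp only:)
    note * = this
    show "(\<integral>\<^sup>+x. ?B x s \<partial>lborel) = ennreal (s ^ n) * indicator {0<..1} s * G"
    proof (cases "s > 0")
      case True
      show ?thesis
        unfolding * inner[OF True] by (simp only: mult_ac)
    qed simp
  qed
  also have "\<dots> = ennreal (1 / (real n + 1)) * G"
    by (subst nn_integral_multc) (auto simp: pow)
  finally have 2: "(\<integral>\<^sup>+s. \<integral>\<^sup>+x. ?B x s \<partial>lborel \<partial>lborel) = ennreal (1 / (real n + 1)) * G" .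
  have "(\<integral>\<^sup>+s. \<integral>\<^sup>+x. ?A x s \<partial>lborel \<partial>lborel) + (\<integral>\<^sup>+s. \<integral>\<^sup>+x. ?B x s \<partial>lborel \<partial>lborel) =
      (\<integral>\<^sup>+s. (\<integral>\<^sup>+x. ?A x s \<partial>lborel) + (\<integral>\<^sup>+x. ?B x s \<partial>lborel) \<partial>lborel)"
    by (rule nn_integral_add[symmetric]) measurable
  also have "\<dots> = (\<integral>\<^sup>+s. \<integral>\<^sup>+x. ?A x s + ?B x s \<partial>lborel \<partial>lborel)"
    by (intro nn_integral_cong nn_integral_add[symmetric]) measurable
  also have "\<dots> = (\<integral>\<^sup>+s. \<integral>\<^sup>+x. indicator {0<..1::real} s * (?g x * indicator (cball 0 1) x) \<partial>lborel \<partial>lborel)"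
    by (intro nn_integral_cong) (auto simp: indicator_def)
  also have "\<dots> = (\<integral>\<^sup>+s. indicator {0<..1::real} s * G \<partial>lborel)"
    unfolding G_def by (intro nn_integral_cong nn_integral_cmult) measurable
  also have "\<dots> = G"
    by (simp add: nn_integral_multc)
  finally have "ennreal (2 * unit_ball_vol (real (DIM('a) - 1)) / (real n + 1)) + ennreal (1 / (real n + 1)) * G = G"
    by (simp only: 1 2)
  then have "2 * unit_ball_vol (real (DIM('a) - 1)) / (real n + 1) + 1 / (real n + 1) * g = g"
    using g by (simp add: ennreal_mult'[symmetric] flip: ennreal_plus)
  then have "(2 * unit_ball_vol (real (DIM('a) - 1)) + g) / (real n + 1) = g"
    by (simp only: add_divide_distrib) simp
  then have "2 * unit_ball_vol (real (DIM('a) - 1)) + g = g * (real n + 1)"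
    by (subst (asm) nonzero_divide_eq_eq) auto
  then have "real n * g = 2 * unit_ball_vol (real (DIM('a) - 1))"
    by (simp add: distrib_left mult.commute)
  then show ?thesis
    unfolding G_def[symmetric] g(1) using g(2) by (simp add: n_def flip: ennreal_mult')
qed

end

section \<open>The isodiametric inequality\<close>

text \<open>Steiner symmetrization: on each line parallel to \<open>b\<close> the section of
  \<open>A\<close> is replaced by the open interval of the same length centred in the hyperplane.
  The strict inequality drops lines with a null section, so every point of the result lies on a line
  that meets \<open>A\<close>.\<close>

definition steiner :: "'a::euclidean_space \<Rightarrow> 'a set \<Rightarrow> 'a set" where
  "steiner b A = {x. ennreal (2 * \<bar>x \<bullet> b\<bar>) < (\<integral>\<^sup>+s. indicator A (perp b x + s *\<^sub>R b) \<partial>lborel)}"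

lemma sets_steiner [measurable]:
  assumes [measurable]: "A \<in> sets borel"
  shows "steiner b A \<in> sets borel"
  unfolding steiner_def by measurable

lemma emeasure_symmetric_interval:
  "(\<integral>\<^sup>+s. indicator {s::real. ennreal (2 * \<bar>s\<bar>) < L} s \<partial>lborel) = L"
proof (cases L)
  case (real l)
  then have "{s::real. ennreal (2 * \<bar>s\<bar>) < L} = {- (l / 2) <..< l / 2}"
    by (auto simp: ennreal_less_iff)
  then show ?thesis using real by simp
next
  case top
  then have "(\<integral>\<^sup>+s. indicator {s::real. ennreal (2 * \<bar>s\<bar>) < L} s \<partial>lborel) = (\<integral>\<^sup>+s. indicator (UNIV::real set) s \<partial>lborel)"
    by (intro nn_integral_cong) auto
  then show ?thesis using top by simp
qed

lemma emeasure_steiner: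
  assumes b: "norm b = 1" and [measurable]: "A \<in> sets borel"
  shows "emeasure lborel (steiner b A) = emeasure lborel A"
proof -
  have "emeasure lborel (steiner b A) = (\<integral>\<^sup>+x. indicator (steiner b A) x \<partial>lborel)"
    by simp
  also have "\<dots> = (\<integral>\<^sup>+x. indicator {0..1} (x \<bullet> b) * (\<integral>\<^sup>+s. indicator (steiner b A) (perp b x + s *\<^sub>R b) \<partial>lborel) \<partial>lborel)"
    by (rule nn_integral_slices[OF b, of "indicator (steiner b A)"]) measurable
  also have "\<dots> = (\<integral>\<^sup>+x. indicator {0..1} (x \<bullet> b) * (\<integral>\<^sup>+s. indicator A (perp b x + s *\<^sub>R b) \<partial>lborel) \<partial>lborel)"
  proof (rule nn_integral_cong, rule arg_cong[where f = "\<lambda>y. _ * y"])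
    fix x
    let ?L = "\<integral>\<^sup>+s. indicator A (perp b x + s *\<^sub>R b) \<partial>lborel"
    have "(\<integral>\<^sup>+s. indicator (steiner b A) (perp b x + s *\<^sub>R b) \<partial>lborel) =
        (\<integral>\<^sup>+s. indicator {s. ennreal (2 * \<bar>s\<bar>) < ?L} s \<partial>lborel)"
      by (intro nn_integral_cong)
         (auto simp: indicator_def steiner_def b inner_add_left inner_unit_self)
    then show "(\<integral>\<^sup>+s. indicator (steiner b A) (perp b x + s *\<^sub>R b) \<partial>lborel) = ?L"
      by (simp add: emeasure_symmetric_interval)
  qed
  also have "\<dots> = (\<integral>\<^sup>+x. indicator A x \<partial>lborel)"
    by (rule nn_integral_slices[OF b, of "indicator A", symmetric]) measurable
  finally show ?thesis by simp
qed

text \<open>\<open>A\<close> lies in [Sup B - D, Inf B + D] and \<open>B\<close> in [Inf B, Sup B];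
  the two lengths add up to 2 D.\<close>

lemma sum_emeasure_le_of_dist_le:
  fixes A B :: "real set"
  assumes ne: "A \<noteq> {}" "B \<noteq> {}" and D: "\<And>s t. s \<in> A \<Longrightarrow> t \<in> B \<Longrightarrow> \<bar>s - t\<bar> \<le> D"
  shows "emeasure lborel A + emeasure lborel B \<le> ennreal (2 * D)"
proof -
  obtain s0 t0 where st: "s0 \<in> A" "t0 \<in> B" using ne by auto
  have bdd: "bdd_above B" "bdd_below B"
    using D[OF st(1)] by (auto intro!: bdd_aboveI[of _ "s0 + D"] bdd_belowI[of _ "s0 - D"] simp: abs_le_iff algebra_simps)
  have "A \<subseteq> {Sup B - D .. Inf B + D}"
  proof
    fix s assume s: "s \<in> A"
    have "Sup B \<le> s + D" using D[OF s] ne by (intro cSup_least) (auto simp: abs_le_iff algebra_simps)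
    moreover have "s - D \<le> Inf B" using D[OF s] ne by (intro cInf_greatest) (auto simp: abs_le_iff algebra_simps)
    ultimately show "s \<in> {Sup B - D .. Inf B + D}" by auto
  qed
  then have 1: "emeasure lborel A \<le> emeasure lborel {Sup B - D .. Inf B + D}" "Sup B - D \<le> Inf B + D"
    using st by (auto intro: emeasure_mono)
  have "B \<subseteq> {Inf B .. Sup B}"
    using bdd by (auto intro: cInf_lower cSup_upper)
  then have 2: "emeasure lborel B \<le> emeasure lborel {Inf B .. Sup B}" "Inf B \<le> Sup B"
    using st by (auto intro: emeasure_mono)
  have "emeasure lborel A + emeasure lborel B \<le> ennreal (Inf B + D - (Sup B - D)) + ennreal (Sup B - Inf B)"
    using 1 2 by (intro add_mono) auto
  also have "\<dots> = ennreal (2 * D)"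
    using 1 2 by (subst ennreal_plus[symmetric]) auto
  finally show ?thesis .
qed

text \<open>If two sections lie on lines at distance \<open>h\<close>, their parameters differ by at
  most sqrt (d^2 - h^2). The lengths of the sections then add up to at most twice this bound, and
  \<bar>x \<bullet> b\<bar> + \<bar>y \<bullet> b\<bar> is at most half of their sum.\<close>

lemma dist_steiner_le:
  assumes b: "norm b = 1" and [measurable]: "A \<in> sets borel"
    and d: "d \<ge> 0" "\<And>x y. x \<in> A \<Longrightarrow> y \<in> A \<Longrightarrow> dist x y \<le> d"
    and xy: "x \<in> steiner b A" "y \<in> steiner b A"
  shows "dist x y \<le> d"
proof -
  define S where "S x = {s. perp b x + s *\<^sub>R b \<in> A}" for x
  have [measurable]: "S x \<in> sets borel" for x
    unfolding S_def by measurable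
  have S: "(\<integral>\<^sup>+s. indicator A (perp b x + s *\<^sub>R b) \<partial>lborel) = emeasure lborel (S x)" for x
  proof -
    have "(\<integral>\<^sup>+s. indicator A (perp b x + s *\<^sub>R b) \<partial>lborel) = (\<integral>\<^sup>+s. indicator (S x) s \<partial>lborel)"
      by (intro nn_integral_cong) (auto simp: S_def indicator_def)
    then show ?thesis by simp
  qed
  have ms: "ennreal (2 * \<bar>x \<bullet> b\<bar>) < emeasure lborel (S x)" "ennreal (2 * \<bar>y \<bullet> b\<bar>) < emeasure lborel (S y)"
    using xy by (auto simp: steiner_def S)
  then have ne: "S x \<noteq> {}" "S y \<noteq> {}" by auto
  have le: "(s - t)\<^sup>2 \<le> d\<^sup>2 - (norm (perp b (x - y)))\<^sup>2" if "s \<in> S x" "t \<in> S y" for s t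
  proof -
    have "norm ((perp b x + s *\<^sub>R b) - (perp b y + t *\<^sub>R b)) \<le> d"
      using d(2) that by (auto simp: S_def dist_norm)
    then have "(norm (perp b (x - y) + (s - t) *\<^sub>R b))\<^sup>2 \<le> d\<^sup>2"
      by (intro power_mono) (auto simp: perp_diff algebra_simps)
    then show ?thesis
      by (simp add: norm_perp_decomp[OF b, of "perp b (x - y) + (s - t) *\<^sub>R b"] b inner_add_left inner_unit_self)
  qed
  define D where "D = sqrt (d\<^sup>2 - (norm (perp b (x - y)))\<^sup>2)"
  obtain s0 t0 where "s0 \<in> S x" "t0 \<in> S y" using ne by auto
  then have nn: "0 \<le> d\<^sup>2 - (norm (perp b (x - y)))\<^sup>2"
    using le by (meson order_trans zero_le_power2)
  have "emeasure lborel (S x) + emeasure lborel (S y) \<le> ennreal (2 * D)"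
    using ne le by (intro sum_emeasure_le_of_dist_le) (auto simp: D_def intro!: real_le_rsqrt)
  moreover have "ennreal (2 * \<bar>x \<bullet> b\<bar>) + ennreal (2 * \<bar>y \<bullet> b\<bar>) \<le> emeasure lborel (S x) + emeasure lborel (S y)"
    using ms by (intro add_mono less_imp_le)
  ultimately have "ennreal (2 * \<bar>x \<bullet> b\<bar> + 2 * \<bar>y \<bullet> b\<bar>) \<le> ennreal (2 * D)"
    by (simp add: order_trans)
  moreover have "D \<ge> 0" using nn by (simp add: D_def)
  ultimately have "2 * \<bar>x \<bullet> b\<bar> + 2 * \<bar>y \<bullet> b\<bar> \<le> 2 * D"
    by (subst (asm) ennreal_le_iff) auto
  then have "\<bar>(x - y) \<bullet> b\<bar> \<le> D"
    by (simp add: inner_diff_left)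
  then have "((x - y) \<bullet> b)\<^sup>2 \<le> D\<^sup>2"
    by (simp add: power2_le_iff_abs_le \<open>D \<ge> 0\<close>)
  then have "(norm (x - y))\<^sup>2 \<le> d\<^sup>2"
    using nn by (simp add: norm_perp_decomp[OF b, of "x - y"] D_def)
  then show ?thesis
    using d(1) by (auto simp: dist_norm intro: power2_le_imp_le)
qed

definition reflection :: "'a::euclidean_space \<Rightarrow> 'a \<Rightarrow> 'a" where
  "reflection c x = x - (2 * (x \<bullet> c)) *\<^sub>R c"

lemma reflection_steiner_same:
  assumes b: "norm b = 1"
  shows "reflection b x \<in> steiner b A \<longleftrightarrow> x \<in> steiner b A"
proof -
  have "perp b (reflection b x) = perp b x" "reflection b x \<bullet> b = - (x \<bullet> b)"
    by (simp_all add: reflection_def perp_diff perp_scaleR perp_self b inner_diff_left inner_unit_self)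
  then show ?thesis by (simp add: steiner_def)
qed

text \<open>Symmetrizing in a new coordinate direction keeps the symmetries gained in the earlier
  ones.\<close>

lemma reflection_steiner_orthogonal:
  assumes bc: "b \<bullet> c = 0" and A: "\<And>x. reflection c x \<in> A \<longleftrightarrow> x \<in> A"
  shows "reflection c x \<in> steiner b A \<longleftrightarrow> x \<in> steiner b A"
proof -
  have cb: "c \<bullet> b = 0" using bc by (simp add: inner_commute)
  have "perp b (reflection c x) + s *\<^sub>R b = reflection c (perp b x + s *\<^sub>R b)" for s
    by (simp add: reflection_def perp_def bc cb inner_diff_left inner_add_left algebra_simps)
  then have "indicator A (perp b (reflection c x) + s *\<^sub>R b) = (indicator A (perp b x + s *\<^sub>R b) :: ennreal)" for s
    using A by (simp add: indicator_def)
  moreover have "reflection c x \<bullet> b = x \<bullet> b"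
    by (simp add: reflection_def inner_diff_left cb)
  ultimately show ?thesis by (simp add: steiner_def)
qed

text \<open>Symmetrization in all coordinate directions preserves the measure and the diameter bound
  and makes the set invariant under x \<mapsto> - x; then dist x (- x) \<le> d forces it into the
  ball of radius d / 2.\<close>

theorem isodiametric_inequality:
  fixes A :: "'a::euclidean_space set"
  assumes A: "A \<in> sets borel" and d: "d \<ge> 0" "\<And>x y. x \<in> A \<Longrightarrow> y \<in> A \<Longrightarrow> dist x y \<le> d"
  shows "emeasure lborel A \<le> ennreal (unit_ball_vol (real DIM('a)) * (d / 2) ^ DIM('a))"
proof -
  have "\<exists>B. B \<in> sets borel \<and> emeasure lborel B = emeasure lborel A \<and>
      (\<forall>x\<in>B. \<forall>y\<in>B. dist x y \<le> d) \<and> (\<forall>c\<in>T. \<forall>x. reflection c x \<in> B \<longleftrightarrow> x \<in> B)"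
    if "T \<subseteq> Basis" for T :: "'a set"
    using finite_subset[OF that finite_Basis] that
  proof (induction T rule: finite_induct)
    case empty
    show ?case
      by (rule exI[of _ A]) (use A d(2) in simp)
  next
    case (insert b T)
    have "T \<subseteq> Basis" using insert.prems by simp
    from insert.IH[OF this] obtain B where B': "B \<in> sets borel" "emeasure lborel B = emeasure lborel A"
      "\<forall>x\<in>B. \<forall>y\<in>B. dist x y \<le> d" "\<forall>c\<in>T. \<forall>x. reflection c x \<in> B \<longleftrightarrow> x \<in> B"
      by (elim exE conjE) (rule that)
    note B = B'(1,2) B'(3)[rule_format] B'(4)[rule_format]
    have b: "norm b = 1" using insert.prems by simp
    show ?case
    proof (intro exI[of _ "steiner b B"] conjI ballI allI)
      show "dist x y \<le> d" if "x \<in> steiner b B" "y \<in> steiner b B" for x y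
        using dist_steiner_le[OF b B(1) d(1) B(3)] that by blast
      show "reflection c x \<in> steiner b B \<longleftrightarrow> x \<in> steiner b B" if "c \<in> insert b T" for c x
      proof (cases "c = b")
        case False
        then have c: "c \<in> T" using that by simp
        then have "c \<in> Basis" "b \<in> Basis" using insert.prems by auto
        then have bc: "b \<bullet> c = 0" using False by (simp add: inner_Basis)
        show ?thesis
          by (rule reflection_steiner_orthogonal[OF bc B(4)[OF c]])
      qed (simp add: reflection_steiner_same b)
    qed (use B'(1,2) b in \<open>simp_all add: emeasure_steiner sets_steiner\<close>)
  qed
  from this[OF subset_refl] obtain B :: "'a set" where B': "B \<in> sets borel" "emeasure lborel B = emeasure lborel A"
    "\<forall>x\<in>B. \<forall>y\<in>B. dist x y \<le> d" "\<forall>c\<in>Basis. \<forall>x. reflection c x \<in> B \<longleftrightarrow> x \<in> B"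
    by (elim exE conjE) (rule that)
  note B = B'(1,2) B'(3)[rule_format] B'(4)[rule_format]
  \<comment> \<open>Successive coordinate reflections over \<open>T\<close>; for T =
    \<open>Basis\<close> their product is x \<mapsto> - x.\<close>
  have "x - 2 *\<^sub>R (\<Sum>c\<in>T. (x \<bullet> c) *\<^sub>R c) \<in> B" if "x \<in> B" "T \<subseteq> Basis" for x T
    using finite_subset[OF that(2) finite_Basis] that(2)
  proof (induction T rule: finite_induct)
    case (insert b T)
    let ?y = "x - 2 *\<^sub>R (\<Sum>c\<in>T. (x \<bullet> c) *\<^sub>R c)"
    have "(\<Sum>c\<in>T. (x \<bullet> c) * (c \<bullet> b)) = 0"
    proof (rule sum.neutral, rule ballI)
      fix c assume "c \<in> T"
      then have "c \<noteq> b" "c \<in> Basis" "b \<in> Basis" using insert.hyps insert.prems by auto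
      then show "(x \<bullet> c) * (c \<bullet> b) = 0" by (simp add: inner_Basis)
    qed
    then have "?y \<bullet> b = x \<bullet> b"
      by (simp add: inner_diff_left inner_sum_left)
    then have "reflection b ?y = x - 2 *\<^sub>R (\<Sum>c\<in>insert b T. (x \<bullet> c) *\<^sub>R c)"
      using insert.hyps by (simp add: reflection_def algebra_simps)
    moreover have "reflection b ?y \<in> B"
    proof -
      have "?y \<in> B" using insert.IH insert.prems by simp
      moreover have "b \<in> Basis" using insert.prems by simp
      ultimately show ?thesis using B(4)[of b ?y] by simp
    qed
    ultimately show ?case by simp
  qed (use that in simp)
  from this[OF _ subset_refl] have minus: "- x \<in> B" if "x \<in> B" for x
    using that by (simp add: euclidean_representation scaleR_2)
  have "B \<subseteq> cball 0 (d / 2)"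
  proof
    fix x assume "x \<in> B"
    then have "dist x (- x) \<le> d" by (intro B(3) minus)
    then have "norm (2 *\<^sub>R x) \<le> d" by (simp add: dist_norm scaleR_2)
    then show "x \<in> cball 0 (d / 2)" by simp
  qed
  then have "emeasure lborel B \<le> emeasure lborel (cball (0::'a) (d / 2))"
    by (intro emeasure_mono) auto
  then show ?thesis
    using B(2) d(1) by (simp add: emeasure_cball)
qed

section \<open>Hausdorff measure and Lebesgue measure\<close>

lemma diameter_le_of_dist_le:
  fixes S :: "'a::metric_space set"
  assumes "d \<ge> 0" "\<And>x y. x \<in> S \<Longrightarrow> y \<in> S \<Longrightarrow> dist x y \<le> d"
  shows "diameter S \<le> d"
  using assms by (auto simp: diameter_def intro: cSUP_least)

lemma hausdorff_weight_mono:
  fixes S T :: "'a::metric_space set"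
  assumes "S \<subseteq> T" "bounded T"
  shows "hausdorff_weight k S \<le> hausdorff_weight k T"
proof -
  have "diameter S \<le> diameter T" "diameter S \<ge> 0"
    using assms by (auto intro: diameter_subset diameter_ge_0 bounded_subset)
  then show ?thesis
    using assms(1) by (auto simp: hausdorff_weight_def intro!: ennreal_leI mult_left_mono power_mono)
qed

lemma hausdorff_mono: "A \<subseteq> B \<Longrightarrow> hausdorff k A \<le> hausdorff k B"
  unfolding hausdorff_def by (intro SUP_mono) (blast intro: hausdorff_content_mono)

lemma hausdorff_empty [simp]: "hausdorff k {} = 0"
  by (simp add: hausdorff_def hausdorff_content_empty)

lemma hausdorff_content_le_hausdorff: "\<delta> > 0 \<Longrightarrow> hausdorff_content k \<delta> A \<le> hausdorff k A"
  unfolding hausdorff_def by (rule SUP_upper) simp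

lemma hausdorff_content_antimono:
  assumes "\<delta> \<le> \<delta>'" shows "hausdorff_content k \<delta>' A \<le> hausdorff_content k \<delta> A"
  unfolding hausdorff_content_def
proof (rule INF_superset_mono)
  show "hausdorff_covers \<delta> A \<subseteq> hausdorff_covers \<delta>' A"
    using assms unfolding hausdorff_covers_def by (blast intro: order_trans)
qed simp

lemma hausdorff_content_le_suminf:
  assumes "A \<subseteq> (\<Union>i. S i)" "\<And>i. bounded (S i)" "\<And>i. diameter (S i) \<le> \<delta>"
  shows "hausdorff_content k \<delta> A \<le> (\<Sum>i. hausdorff_weight k (S i))"
  unfolding hausdorff_content_def using assms by (intro INF_lower) (simp add: hausdorff_covers_def)

lemma hausdorff_UN_le: "hausdorff k (\<Union>i::nat. A i) \<le> (\<Sum>i. hausdorff k (A i))"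
proof -
  have "hausdorff k (\<Union>i. A i) = hausdorff k (\<Union>i. disjointed A i)"
    by (simp add: UN_disjointed_eq)
  also have "\<dots> \<le> (\<Sum>i. hausdorff k (disjointed A i))"
    using outer_measure_space_hausdorff[of k] disjoint_family_disjointed[of A]
    unfolding outer_measure_space_def countably_subadditive_def by auto
  also have "\<dots> \<le> (\<Sum>i. hausdorff k (A i))"
    by (intro suminf_le hausdorff_mono disjointed_subset summableI)
  finally show ?thesis .
qed

lemma hausdorff_Un_le: "hausdorff k (A \<union> B) \<le> hausdorff k A + hausdorff k B"
  using hausdorff_UN_le[of k "binaryset A B"]
  by (simp add: UN_binaryset_eq suminf_binaryset_eq)

lemma hausdorff_content_Un_le:
  "\<delta> > 0 \<Longrightarrow> hausdorff_content k \<delta> (A \<union> B) \<le> hausdorff_content k \<delta> A + hausdorff_content k \<delta> B"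
  using hausdorff_content_subadditive[of k \<delta> "binaryset A B"]
  by (simp add: UN_binaryset_eq suminf_binaryset_eq hausdorff_content_empty)

section \<open>Metric outer measure and Borel sets\<close>

lemma hausdorff_content_LIMSEQ: "(\<lambda>i. hausdorff_content k (inverse (real (Suc i))) A) \<longlonglongrightarrow> hausdorff k A"
proof -
  let ?X = "\<lambda>i. hausdorff_content k (inverse (real (Suc i))) A"
  have "incseq ?X"
    by (intro monoI hausdorff_content_antimono) simp
  moreover have "(SUP i. ?X i) = hausdorff k A"
    unfolding hausdorff_def
  proof (rule antisym)
    show "(SUP i. ?X i) \<le> (SUP \<delta>\<in>{0<..}. hausdorff_content k \<delta> A)"
      by (rule SUP_mono) (auto intro!: exI[of _ "inverse (real (Suc i))" for i])
    show "(SUP \<delta>\<in>{0<..}. hausdorff_content k \<delta> A) \<le> (SUP i. ?X i)"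
    proof (rule SUP_mono)
      fix \<delta> :: real assume "\<delta> \<in> {0<..}"
      then obtain i where "inverse (real (Suc i)) < \<delta>" using reals_Archimedean by auto
      then show "\<exists>i\<in>UNIV. hausdorff_content k \<delta> A \<le> ?X i"
        by (auto intro!: exI[of _ i] hausdorff_content_antimono)
    qed
  qed
  ultimately show ?thesis using LIMSEQ_SUP[of ?X] by simp
qed

text \<open>A covering set of diameter at most \<delta> < e cannot meet both \<open>A\<close> and
  \<open>B\<close>, so a cover of the union splits into covers of the two.\<close>

lemma hausdorff_content_separated:
  fixes A B :: "'a::metric_space set"
  assumes e: "\<delta> < e" and AB: "\<And>a b. a \<in> A \<Longrightarrow> b \<in> B \<Longrightarrow> e \<le> dist a b"
  shows "hausdorff_content k \<delta> A + hausdorff_content k \<delta> B \<le> hausdorff_content k \<delta> (A \<union> B)"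
  unfolding hausdorff_content_def[of k \<delta> "A \<union> B"]
proof (rule INF_greatest)
  fix S assume "S \<in> hausdorff_covers \<delta> (A \<union> B)"
  then have S: "A \<union> B \<subseteq> (\<Union>i. S i)" "\<And>i. bounded (S i)" "\<And>i. diameter (S i) \<le> \<delta>"
    by (auto simp: hausdorff_covers_def)
  have cont: "hausdorff_content k \<delta> Y \<le> (\<Sum>i. hausdorff_weight k (S i \<inter> Y))" if "Y \<subseteq> A \<union> B" for Y
  proof (rule hausdorff_content_le_suminf)
    show "diameter (S i \<inter> Y) \<le> \<delta>" for i
      using diameter_subset[of "S i \<inter> Y" "S i"] S(2,3)[of i] by force
  qed (use S that in \<open>auto intro: bounded_Int\<close>)
  have "hausdorff_content k \<delta> A + hausdorff_content k \<delta> B \<le>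
      (\<Sum>i. hausdorff_weight k (S i \<inter> A)) + (\<Sum>i. hausdorff_weight k (S i \<inter> B))"
    by (intro add_mono cont) auto
  also have "\<dots> = (\<Sum>i. hausdorff_weight k (S i \<inter> A) + hausdorff_weight k (S i \<inter> B))"
    by (rule suminf_add) auto
  also have "\<dots> \<le> (\<Sum>i. hausdorff_weight k (S i))"
  proof (intro suminf_le summableI)
    fix i
    have "S i \<inter> A = {} \<or> S i \<inter> B = {}"
    proof (rule ccontr)
      assume "\<not> ?thesis"
      then obtain a b where ab: "a \<in> S i \<inter> A" "b \<in> S i \<inter> B" by blast
      then have "dist a b \<le> \<delta>" using diameter_bounded_bound[of "S i" a b] S by (meson IntD1 order_trans)
      with AB[of a b] ab e show False by auto
    qed
    then show "hausdorff_weight k (S i \<inter> A) + hausdorff_weight k (S i \<inter> B) \<le> hausdorff_weight k (S i)"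
      using hausdorff_weight_mono[of "S i \<inter> A" "S i" k] hausdorff_weight_mono[of "S i \<inter> B" "S i" k] S(2)
      by (auto simp: hausdorff_weight_def[of k "{}"])
  qed
  finally show "hausdorff_content k \<delta> A + hausdorff_content k \<delta> B \<le> (\<Sum>i. hausdorff_weight k (S i))" .
qed

lemma hausdorff_separated:
  fixes A B :: "'a::metric_space set"
  assumes e: "e > 0" and AB: "\<And>a b. a \<in> A \<Longrightarrow> b \<in> B \<Longrightarrow> e \<le> dist a b"
  shows "hausdorff k A + hausdorff k B \<le> hausdorff k (A \<union> B)"
proof (rule LIMSEQ_le)
  let ?X = "\<lambda>A i. hausdorff_content k (inverse (real (Suc i))) A"
  show "(\<lambda>i. ?X A i + ?X B i) \<longlonglongrightarrow> hausdorff k A + hausdorff k B"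
    by (intro tendsto_add hausdorff_content_LIMSEQ)
  show "?X (A \<union> B) \<longlonglongrightarrow> hausdorff k (A \<union> B)"
    by (rule hausdorff_content_LIMSEQ)
  obtain n where n: "inverse (real (Suc n)) < e" using e reals_Archimedean by auto
  show "\<exists>N. \<forall>i\<ge>N. ?X A i + ?X B i \<le> ?X (A \<union> B) i"
  proof (intro exI allI impI)
    fix i assume "n \<le> i"
    then have "inverse (real (Suc i)) \<le> inverse (real (Suc n))" by simp
    with n have "inverse (real (Suc i)) < e" by linarith
    then show "?X A i + ?X B i \<le> ?X (A \<union> B) i"
      by (intro hausdorff_content_separated[of _ e] AB)
  qed
qed

text \<open>Meant for the shells of one parity around a closed set: each new shell lies strictly
  closer to it than all earlier ones, and the 1-Lipschitz function \<open>d\<close> turns the gap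
  between values into a gap between points.\<close>

lemma hausdorff_sum_separated:
  fixes B :: "nat \<Rightarrow> 'a::metric_space set" and d :: "'a \<Rightarrow> real"
  assumes lip: "\<And>x y. \<bar>d x - d y\<bar> \<le> dist x y"
    and lo: "\<And>m x. x \<in> B m \<Longrightarrow> lo m \<le> d x" and hi: "\<And>m x. x \<in> B m \<Longrightarrow> d x < hi m"
    and sep: "\<And>m. hi (Suc m) < lo m" and mono: "\<And>m. lo (Suc m) \<le> lo m"
  shows "(\<Sum>m<N. hausdorff k (B m)) \<le> hausdorff k (\<Union>m<N. B m)"
proof (induction N)
  case (Suc N)
  have loN: "lo N \<le> d x" if "x \<in> (\<Union>m<Suc N. B m)" for x
  proof -
    from that obtain m where "m < Suc N" "x \<in> B m" by blast
    then show ?thesis using lo[of x m] lift_Suc_antimono_le[of lo m N, OF mono] by auto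
  qed
  have "hausdorff k (\<Union>m<N. B m) + hausdorff k (B N) \<le> hausdorff k ((\<Union>m<N. B m) \<union> B N)"
  proof (cases N)
    case (Suc M)
    show ?thesis
    proof (rule hausdorff_separated)
      show "lo M - hi N > 0" using sep[of M] Suc by simp
      fix a b assume a: "a \<in> (\<Union>m<N. B m)" and b: "b \<in> B N"
      from a obtain m where "m < Suc M" "a \<in> B m" using Suc by blast
      then have "lo M \<le> d a" using lo[of a m] lift_Suc_antimono_le[of lo m M, OF mono] by auto
      then show "lo M - hi N \<le> dist a b" using hi[OF b] lip[of a b] by linarith
    qed
  qed simp
  moreover have "(\<Union>m<Suc N. B m) = (\<Union>m<N. B m) \<union> B N"
    by (auto simp: less_Suc_eq)
  moreover have "(\<Sum>m<Suc N. hausdorff k (B m)) \<le> hausdorff k (\<Union>m<N. B m) + hausdorff k (B N)"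
    using Suc.IH by (simp add: add_right_mono)
  ultimately show ?case
    by (metis order_trans)
qed simp

lemma ennreal_suminf_tail_le:
  fixes f :: "nat \<Rightarrow> ennreal"
  assumes fin: "(\<Sum>i. f i) < top" and e: "e > 0"
  obtains n where "(\<Sum>i. f (i + n)) \<le> ennreal e"
proof -
  have top: "f i \<noteq> top" for i using ennreal_suminf_lessD[OF fin] by (simp add: less_top)
  define g where "g i = enn2real (f i)" for i
  have fg: "f = (\<lambda>i. ennreal (g i))" using top by (simp add: g_def fun_eq_iff less_top)
  have g0: "g i \<ge> 0" for i by (simp add: g_def)
  have sg: "summable g"
    using fin g0 unfolding fg by (intro summable_suminf_not_top) auto
  from suminf_exist_split[OF e this] obtain n where "norm (\<Sum>i. g (i + n)) < e" by blast
  then have "(\<Sum>i. g (i + n)) \<le> e" by simp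
  moreover have "(\<Sum>i. f (i + n)) = ennreal (\<Sum>i. g (i + n))"
    unfolding fg by (intro suminf_ennreal2 g0) (use sg in \<open>simp add: summable_iff_shift\<close>)
  ultimately show ?thesis using that[of n] by (simp add: ennreal_leI)
qed

text \<open>Caratheodory's criterion: the shells \<open>{1/(i+2) \<le> d < 1/(i+1)}\<close> around a closed set with both even
  and odd indices are separated families, so that their measures are summable.\<close>

lemma closed_hausdorff_measurable:
  fixes C :: "'a::metric_space set"
  assumes C: "closed C"
  shows "C \<in> lambda_system UNIV UNIV (hausdorff k)"
proof (cases "C = {}")
  case True
  then show ?thesis by (simp add: lambda_system_def)
next
  case ne: False
  define d where "d x = infdist x C" for x
  have lip: "\<bar>d x - d y\<bar> \<le> dist x y" for x y
    unfolding d_def by (rule infdist_triangle_abs)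
  have d0: "d x = 0 \<longleftrightarrow> x \<in> C" for x
    unfolding d_def using C ne by (simp add: in_closed_iff_infdist_zero)
  have dnn: "d x \<ge> 0" for x by (simp add: d_def infdist_nonneg)
  define a where "a i = inverse (real (Suc i))" for i
  have a_anti: "a j \<le> a i" if "i \<le> j" for i j using that by (simp add: a_def)
  have a_less: "a j < a i" if "i < j" for i j using that by (simp add: a_def)
  have "hausdorff k (C \<inter> A) + hausdorff k (A - C) \<le> hausdorff k A" for A
  proof (cases "hausdorff k A = top")
    case fin: False
    define R where "R i = {x\<in>A. a (Suc i) \<le> d x \<and> d x < a i}" for i
    define E where "E n = {x\<in>A. a n \<le> d x}" for n
    have part: "(\<Sum>m<N. hausdorff k (R (2 * m + j))) \<le> hausdorff k A" for N j
    proof -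
      have "(\<Sum>m<N. hausdorff k (R (2 * m + j))) \<le> hausdorff k (\<Union>m<N. R (2 * m + j))"
        by (rule hausdorff_sum_separated[where d = d and lo = "\<lambda>m. a (Suc (2 * m + j))" and hi = "\<lambda>m. a (2 * m + j)"])
           (auto simp: lip R_def intro: a_anti a_less)
      also have "\<dots> \<le> hausdorff k A" by (rule hausdorff_mono) (auto simp: R_def)
      finally show ?thesis .
    qed
    have "(\<Sum>i<N. hausdorff k (R i)) \<le> hausdorff k A + hausdorff k A" for N
    proof -
      have "(\<Sum>i<N. hausdorff k (R i)) \<le> (\<Sum>i<2 * N. hausdorff k (R i))"
        by (rule sum_mono2) auto
      also have "\<dots> = (\<Sum>m<N. hausdorff k (R (2 * m + 0))) + (\<Sum>m<N. hausdorff k (R (2 * m + 1)))"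
        by (induction N) (simp_all add: add_ac)
      also have "\<dots> \<le> hausdorff k A + hausdorff k A" by (intro add_mono part)
      finally show ?thesis .
    qed
    then have "(\<Sum>i. hausdorff k (R i)) \<le> hausdorff k A + hausdorff k A"
      by (intro suminf_le_const summableI) auto
    also have "\<dots> < top" using fin by (simp add: less_top)
    finally have Rfin: "(\<Sum>i. hausdorff k (R i)) < top" .
    show ?thesis
    proof (rule ennreal_le_epsilon)
      fix e :: real assume e: "e > 0"
      obtain n where n: "(\<Sum>i. hausdorff k (R (i + n))) \<le> ennreal e"
        using ennreal_suminf_tail_le[OF Rfin e] by blast
      have "A - C \<subseteq> E n \<union> (\<Union>i. R (i + n))"
      proof
        fix x assume x: "x \<in> A - C"
        then have "d x > 0" using d0[of x] dnn[of x] by auto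
        then obtain m0 where "a m0 < d x" unfolding a_def using reals_Archimedean by auto
        then have m0: "\<exists>m. a m \<le> d x" by (auto intro: less_imp_le)
        \<comment> \<open>If m \<le> n, the point is in \<open>E n\<close>. Otherwise minimality of
          \<open>m\<close> puts it in the shell with index m - 1, which is at least
          \<open>n\<close>.\<close>
        define m where "m = (LEAST m. a m \<le> d x)"
        have m: "a m \<le> d x" unfolding m_def by (rule LeastI_ex[OF m0])
        show "x \<in> E n \<union> (\<Union>i. R (i + n))"
        proof (cases "m \<le> n")
          case True
          then show ?thesis using m a_anti[of m n] x by (auto simp: E_def)
        next
          case False
          then have "m - 1 < m" by simp
          then have "\<not> a (m - 1) \<le> d x" unfolding m_def by (rule not_less_Least)
          then have "x \<in> R (m - 1)" using m x False by (auto simp: R_def)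
          then have "x \<in> R ((m - 1 - n) + n)" using False by simp
          then show ?thesis by blast
        qed
      qed
      then have "hausdorff k (A - C) \<le> hausdorff k (E n) + hausdorff k (\<Union>i. R (i + n))"
        using hausdorff_mono hausdorff_Un_le order_trans by blast
      also have "\<dots> \<le> hausdorff k (E n) + ennreal e"
        using hausdorff_UN_le[of k "\<lambda>i. R (i + n)"] n by (intro add_left_mono) auto
      finally have "hausdorff k (C \<inter> A) + hausdorff k (A - C) \<le> (hausdorff k (C \<inter> A) + hausdorff k (E n)) + ennreal e"
        by (simp add: add_left_mono add.assoc)
      also have "hausdorff k (C \<inter> A) + hausdorff k (E n) \<le> hausdorff k ((C \<inter> A) \<union> E n)"
      proof (rule hausdorff_separated)
        show "a n > 0" by (simp add: a_def)
        fix x y assume "x \<in> C \<inter> A" "y \<in> E n"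
        then show "a n \<le> dist x y" using d0[of x] lip[of x y] by (auto simp: E_def)
      qed
      also have "\<dots> \<le> hausdorff k A" by (rule hausdorff_mono) (auto simp: E_def)
      finally show "hausdorff k (C \<inter> A) + hausdorff k (A - C) \<le> hausdorff k A + ennreal e"
        by (simp add: add_right_mono)
    qed
  qed simp
  moreover have "hausdorff k A \<le> hausdorff k (C \<inter> A) + hausdorff k (A - C)" for A
    using hausdorff_Un_le[of k "C \<inter> A" "A - C"] by (simp add: Int_commute Int_Diff_Un)
  moreover have "(UNIV - C) \<inter> A = A - C" for A by auto
  ultimately show ?thesis
    by (auto simp: lambda_system_def intro!: antisym)
qed

lemma sets_borel_le_hausdorff_measure: "sets borel \<subseteq> sets (hausdorff_measure k :: 'a::metric_space measure)"
proof -
  have "sets (borel :: 'a measure) = sigma_sets UNIV (Collect closed)"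
    by (simp add: borel_eq_closed)
  moreover have 1: "Collect closed \<subseteq> sets (hausdorff_measure k :: 'a measure)"
    by (auto simp: sets_hausdorff_measure closed_hausdorff_measurable)
  have "sigma_sets UNIV (Collect closed) \<subseteq> sets (hausdorff_measure k :: 'a measure)"
    using sets.sigma_sets_subset[OF 1] by simp
  ultimately show ?thesis by simp
qed

lemma emeasure_hausdorff_borel: "A \<in> sets borel \<Longrightarrow> emeasure (hausdorff_measure k) A = hausdorff k A"
  using sets_borel_le_hausdorff_measure emeasure_hausdorff_measure by blast

section \<open>Lipschitz images and agreement with Lebesgue measure\<close>

lemma hausdorff_lipschitz_image:
  fixes f :: "'a::metric_space \<Rightarrow> 'b::metric_space"
  assumes L: "L > 0" and lip: "\<And>x y. x \<in> A \<Longrightarrow> y \<in> A \<Longrightarrow> dist (f x) (f y) \<le> L * dist x y"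
  shows "hausdorff k (f ` A) \<le> ennreal (L ^ k) * hausdorff k A"
proof -
  have c: "hausdorff_content k \<delta> (f ` A) \<le> ennreal (L ^ k) * hausdorff_content k (\<delta> / L) A" if \<delta>: "\<delta> > 0" for \<delta>
  proof -
    have "ennreal (inverse (L ^ k)) * hausdorff_content k \<delta> (f ` A) \<le> hausdorff_content k (\<delta> / L) A"
      unfolding hausdorff_content_def[of k "\<delta> / L"]
    proof (rule INF_greatest)
      fix S assume "S \<in> hausdorff_covers (\<delta> / L) A"
      then have S: "A \<subseteq> (\<Union>i. S i)" "\<And>i. bounded (S i)" "\<And>i. diameter (S i) \<le> \<delta> / L"
        by (auto simp: hausdorff_covers_def)
      define T where "T i = f ` (S i \<inter> A)" for i
      have dT: "dist x y \<le> L * diameter (S i)" if "x \<in> T i" "y \<in> T i" for x y i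
      proof -
        from that obtain u v where uv: "x = f u" "y = f v" "u \<in> S i" "v \<in> S i" "u \<in> A" "v \<in> A"
          by (auto simp: T_def)
        then have "dist x y \<le> L * dist u v" using lip by simp
        also have "\<dots> \<le> L * diameter (S i)"
          using L uv S(2)[of i] by (intro mult_left_mono diameter_bounded_bound) auto
        finally show ?thesis .
      qed
      have bT: "bounded (T i)" for i
        unfolding bounded_two_points using dT by blast
      have diT: "diameter (T i) \<le> L * diameter (S i)" for i
        using dT[of _ i] L diameter_ge_0[OF S(2)[of i]] by (intro diameter_le_of_dist_le) auto
      have w: "hausdorff_weight k (T i) \<le> ennreal (L ^ k) * hausdorff_weight k (S i)" for i
      proof (cases "T i = {}")
        case False
        then have ne: "S i \<noteq> {}" by (auto simp: T_def)
        have "unit_ball_vol (real k) * (diameter (T i) / 2) ^ k \<le> unit_ball_vol (real k) * (L * diameter (S i) / 2) ^ k"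
          using diT[of i] diameter_ge_0[OF bT[of i]] by (intro mult_left_mono power_mono) auto
        also have "\<dots> = L ^ k * (unit_ball_vol (real k) * (diameter (S i) / 2) ^ k)"
          by (simp add: power_mult_distrib power_divide)
        finally show ?thesis
          using False ne L diameter_ge_0[OF S(2)[of i]]
          by (simp add: hausdorff_weight_def ennreal_mult[symmetric] ennreal_leI)
      qed (simp add: hausdorff_weight_def)
      have "hausdorff_content k \<delta> (f ` A) \<le> (\<Sum>i. hausdorff_weight k (T i))"
      proof (rule hausdorff_content_le_suminf)
        show "f ` A \<subseteq> (\<Union>i. T i)" using S(1) unfolding T_def by blast
        show "diameter (T i) \<le> \<delta>" for i
          using diT[of i] S(3)[of i] L by (simp add: pos_le_divide_eq mult.commute)
      qed (rule bT)
      also have "\<dots> \<le> (\<Sum>i. ennreal (L ^ k) * hausdorff_weight k (S i))"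
        by (intro suminf_le w summableI)
      also have "\<dots> = ennreal (L ^ k) * (\<Sum>i. hausdorff_weight k (S i))"
        by simp
      finally have "ennreal (inverse (L ^ k)) * hausdorff_content k \<delta> (f ` A) \<le>
          ennreal (inverse (L ^ k)) * (ennreal (L ^ k) * (\<Sum>i. hausdorff_weight k (S i)))"
        by (rule mult_left_mono) simp
      also have "\<dots> = (\<Sum>i. hausdorff_weight k (S i))"
        using L by (simp add: mult.assoc[symmetric] ennreal_mult[symmetric])
      finally show "ennreal (inverse (L ^ k)) * hausdorff_content k \<delta> (f ` A) \<le> (\<Sum>i. hausdorff_weight k (S i))" .
    qed
    then have "ennreal (L ^ k) * (ennreal (inverse (L ^ k)) * hausdorff_content k \<delta> (f ` A)) \<le> ennreal (L ^ k) * hausdorff_content k (\<delta> / L) A"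
      by (rule mult_left_mono) simp
    then show ?thesis
      using L by (simp add: mult.assoc[symmetric] ennreal_mult[symmetric])
  qed
  show ?thesis
    unfolding hausdorff_def[of k "f ` A"]
  proof (rule SUP_least)
    fix \<delta> :: real assume "\<delta> \<in> {0<..}"
    then have "hausdorff_content k \<delta> (f ` A) \<le> ennreal (L ^ k) * hausdorff_content k (\<delta> / L) A" by (intro c) simp
    also have "\<dots> \<le> ennreal (L ^ k) * hausdorff k A"
      using L \<open>\<delta> \<in> {0<..}\<close> by (intro mult_left_mono hausdorff_content_le_hausdorff) auto
    finally show "hausdorff_content k \<delta> (f ` A) \<le> ennreal (L ^ k) * hausdorff k A" .
  qed
qed

text \<open>By the isodiametric inequality the volume of a covering set is at most its weight.
  Passing to closures makes the sets measurable and keeps the diameters.\<close>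

lemma emeasure_le_hausdorff:
  fixes A :: "'a::euclidean_space set"
  assumes A: "A \<in> sets borel"
  shows "emeasure lborel A \<le> hausdorff DIM('a) A"
proof -
  have "emeasure lborel A \<le> hausdorff_content DIM('a) 1 A"
    unfolding hausdorff_content_def
  proof (rule INF_greatest)
    fix S assume "S \<in> hausdorff_covers 1 A"
    then have S: "A \<subseteq> (\<Union>i. S i)" "\<And>i. bounded (S i)"
      by (auto simp: hausdorff_covers_def)
    have "A \<subseteq> (\<Union>i. closure (S i))"
      using S(1) closure_subset by blast
    then have "emeasure lborel A \<le> emeasure lborel (\<Union>i. closure (S i))"
      by (rule emeasure_mono) auto
    also have "\<dots> \<le> (\<Sum>i. emeasure lborel (closure (S i)))"
      by (rule emeasure_subadditive_countably) auto
    also have "\<dots> \<le> (\<Sum>i. hausdorff_weight DIM('a) (S i))"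
    proof (intro suminf_le summableI)
      fix i
      show "emeasure lborel (closure (S i)) \<le> hausdorff_weight DIM('a) (S i)"
      proof (cases "S i = {}")
        case False
        have "emeasure lborel (closure (S i)) \<le> ennreal (unit_ball_vol (real DIM('a)) * (diameter (closure (S i)) / 2) ^ DIM('a))"
          using S(2)[of i] by (intro isodiametric_inequality) (auto intro!: diameter_ge_0 diameter_bounded_bound)
        then show ?thesis
          using False S(2)[of i] by (simp add: hausdorff_weight_def diameter_closure)
      qed simp
    qed
    finally show "emeasure lborel A \<le> (\<Sum>i. hausdorff_weight DIM('a) (S i))" .
  qed
  also have "\<dots> \<le> hausdorff DIM('a) A" by (rule hausdorff_content_le_hausdorff) simp
  finally show ?thesis .
qed

text \<open>For balls the Hausdorff weight is the volume, so disjoint balls inside \<open>U\<close>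
  have total weight at most the measure of \<open>U\<close>. The factor \<open>c\<close> serves the
  fivefold balls of the Vitali covering lemma (c = 5) and the Vitali covering theorem (c =
  1).\<close>

lemma hausdorff_content_UN_cball_le:
  fixes a :: "'i \<Rightarrow> 'a::euclidean_space"
  assumes K: "countable K" and disj: "pairwise (\<lambda>i j. disjnt (cball (a i) (r i)) (cball (a j) (r j))) K"
    and r: "\<And>i. i \<in> K \<Longrightarrow> 0 < r i \<and> 2 * c * r i \<le> \<delta>" and c: "c > 0" and \<delta>: "\<delta> > 0"
    and U: "\<And>i. i \<in> K \<Longrightarrow> cball (a i) (r i) \<subseteq> U" "U \<in> sets borel"
  shows "hausdorff_content DIM('a) \<delta> (\<Union>i\<in>K. cball (a i) (c * r i)) \<le> ennreal (c ^ DIM('a)) * emeasure lborel U"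
proof -
  define I where "I = to_nat_on K ` K"
  define g where "g = from_nat_into K"
  have gK: "g j \<in> K" if "j \<in> I" for j using that K by (auto simp: I_def g_def)
  have g_inj: "i = j" if "i \<in> I" "j \<in> I" "g i = g j" for i j
    using that K by (auto simp: I_def g_def)
  have K_g: "K = g ` I" using K by (force simp: I_def g_def)
  define S where "S j = (if j \<in> I then cball (a (g j)) (c * r (g j)) else {})" for j
  define D where "D j = (if j \<in> I then cball (a (g j)) (r (g j)) else {})" for j
  have "hausdorff_content DIM('a) \<delta> (\<Union>i\<in>K. cball (a i) (c * r i)) \<le> (\<Sum>j. hausdorff_weight DIM('a) (S j))"
  proof (rule hausdorff_content_le_suminf)
    show "diameter (S j) \<le> \<delta>" for j
      using r[OF gK[of j]] c \<delta> by (auto simp: S_def)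
  qed (auto simp: S_def K_g)
  also have "\<dots> = (\<Sum>j. ennreal (c ^ DIM('a)) * emeasure lborel (D j))"
  proof (rule suminf_cong)
    fix j
    show "hausdorff_weight DIM('a) (S j) = ennreal (c ^ DIM('a)) * emeasure lborel (D j)"
      using r[OF gK[of j]] c
      by (auto simp: S_def D_def hausdorff_weight_def emeasure_cball ennreal_mult[symmetric] power_mult_distrib mult_ac not_le not_less mult_less_0_iff)
  qed
  also have "\<dots> = ennreal (c ^ DIM('a)) * (\<Sum>j. emeasure lborel (D j))" by simp
  also have "(\<Sum>j. emeasure lborel (D j)) = emeasure lborel (\<Union>j. D j)"
  proof (rule suminf_emeasure)
    have "D i \<inter> D j = {}" if "i \<noteq> j" for i j
    proof (cases "i \<in> I \<and> j \<in> I")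
      case True
      then have "g i \<noteq> g j" using that g_inj by blast
      then show ?thesis
        using True disj gK by (auto simp: D_def pairwise_def disjnt_def)
    qed (auto simp: D_def)
    then show "disjoint_family D" by (auto simp: disjoint_family_on_def)
  qed (auto simp: D_def)
  also have "\<dots> \<le> emeasure lborel U"
    using U gK by (intro emeasure_mono) (auto simp: D_def split: if_splits)
  finally show ?thesis by (simp add: mult_left_mono)
qed

text \<open>Inside an open neighbourhood of small measure the Vitali covering lemma gives disjoint
  balls whose fivefold enlargements cover \<open>N\<close>; the constant 5^n is absorbed by the
  choice of the neighbourhood.\<close>

lemma hausdorff_negligible:
  fixes N :: "'a::euclidean_space set"
  assumes N: "negligible N"
  shows "hausdorff DIM('a) N = 0"
proof -
  have "hausdorff_content DIM('a) \<delta> N = 0" if \<delta>: "\<delta> > 0" for \<delta>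
  proof -
    have "hausdorff_content DIM('a) \<delta> N \<le> 0 + ennreal e" if e: "e > 0" for e
    proof -
      have N': "N \<in> null_sets lebesgue" using N by (simp add: negligible_iff_null_sets)
      have N'': "N \<in> sets lebesgue" by (rule null_setsD2[OF N'])
      have e5: "e / 5 ^ DIM('a) > 0" using e by simp
      obtain U where U: "open U" "N \<subseteq> U" "emeasure lebesgue (U - N) < ennreal (e / 5 ^ DIM('a))"
        by (rule sets_lebesgue_outer_open[OF N'' e5]) (rule that)
      have eU: "emeasure lborel U < ennreal (e / 5 ^ DIM('a))"
      proof -
        have "U \<in> sets lborel" using U(1) by simp
        then have "emeasure lebesgue (U - N) = emeasure lborel U"
          by (subst emeasure_Diff_null_set[OF N']) (auto intro: sets_completionI_sets)
        then show ?thesis using U(3) by simp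
      qed
      \<comment> \<open>Radius at most \<delta> / 10, so that the fivefold ball has diameter at most
        \<delta>.\<close>
      define K where "K = {(x, \<rho>). x \<in> N \<and> 0 < \<rho> \<and> \<rho> \<le> \<delta> / 10 \<and> cball x \<rho> \<subseteq> U}"
      have cov: "N \<subseteq> (\<Union>i\<in>K. cball (fst i) (snd i))"
      proof
        fix x assume x: "x \<in> N"
        then obtain \<rho> where \<rho>: "\<rho> > 0" "cball x \<rho> \<subseteq> U" using U open_contains_cball by blast
        have "(x, min \<rho> (\<delta> / 10)) \<in> K" using \<rho> x \<delta> by (auto simp: K_def)
        then show "x \<in> (\<Union>i\<in>K. cball (fst i) (snd i))"
          using \<rho>(1) \<delta> by (intro UN_I) auto
      qed
      have rK: "0 < snd i \<and> snd i \<le> \<delta> / 10" if "i \<in> K" for i using that by (auto simp: K_def)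
      obtain C where C: "countable C" "C \<subseteq> K"
         "pairwise (\<lambda>i j. disjnt (cball (fst i) (snd i)) (cball (fst j) (snd j))) C"
         "N \<subseteq> (\<Union>i\<in>C. cball (fst i) (5 * snd i))"
        by (rule Vitali_covering_lemma_cballs[OF cov rK]) (assumption | rule that)+
      have "hausdorff_content DIM('a) \<delta> N \<le> hausdorff_content DIM('a) \<delta> (\<Union>i\<in>C. cball (fst i) (5 * snd i))"
        by (rule hausdorff_content_mono[OF C(4)])
      also have "\<dots> \<le> ennreal (5 ^ DIM('a)) * emeasure lborel U"
      proof (rule hausdorff_content_UN_cball_le)
        show "0 < snd i \<and> 2 * 5 * snd i \<le> \<delta>" if "i \<in> C" for i
          using rK[of i] C(2) that by auto
        show "cball (fst i) (snd i) \<subseteq> U" if "i \<in> C" for i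
          using subsetD[OF C(2) that] by (cases i) (simp add: K_def)
      qed (use C \<delta> U(1) in simp_all)
      also have "\<dots> \<le> ennreal (5 ^ DIM('a)) * ennreal (e / 5 ^ DIM('a))"
        using eU by (intro mult_left_mono) auto
      also have "\<dots> = ennreal e"
        using e by (simp add: ennreal_mult[symmetric])
      finally show ?thesis by simp
    qed
    then have "hausdorff_content DIM('a) \<delta> N \<le> 0" by (rule ennreal_le_epsilon)
    then show ?thesis by simp
  qed
  then show ?thesis by (simp add: hausdorff_def)
qed

text \<open>A fine Vitali cover of \<open>A\<close> by balls in an open set of nearly the same
  measure has a disjoint subfamily that exhausts \<open>A\<close> up to a negligible set, which is a
  Hausdorff null set as well. No ball is enlarged, so the constant is exactly 1.\<close>

lemma hausdorff_le_emeasure: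
  fixes A :: "'a::euclidean_space set"
  assumes A: "A \<in> sets borel"
  shows "hausdorff DIM('a) A \<le> emeasure lborel A"
  unfolding hausdorff_def
proof (rule SUP_least, rule ennreal_le_epsilon)
  fix \<delta> e :: real assume "\<delta> \<in> {0<..}" and e: "e > 0"
  then have \<delta>: "\<delta> > 0" by simp
  have A': "A \<in> sets lebesgue" using A by (metis sets_completionI_sets sets_lborel)
  obtain U where U: "open U" "A \<subseteq> U" "emeasure lebesgue (U - A) < ennreal e"
    by (rule sets_lebesgue_outer_open[OF A' e]) (rule that)
  define K where "K = {(x, \<rho>). x \<in> A \<and> 0 < \<rho> \<and> \<rho> \<le> \<delta> / 2 \<and> cball x \<rho> \<subseteq> U}"
  have cov: "\<exists>i. i \<in> K \<and> x \<in> cball (fst i) (snd i) \<and> snd i < d" if x: "x \<in> A" and d: "0 < d" for x d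
  proof -
    obtain \<rho> where \<rho>: "\<rho> > 0" "cball x \<rho> \<subseteq> U" using U x open_contains_cball by blast
    have "(x, min \<rho> (min (\<delta> / 2) (d / 2))) \<in> K" using \<rho> x \<delta> d by (auto simp: K_def)
    then show ?thesis
      using \<rho>(1) \<delta> d by (intro exI[of _ "(x, min \<rho> (min (\<delta> / 2) (d / 2)))"]) auto
  qed
  have "0 < snd i" if "i \<in> K" for i using that by (auto simp: K_def)
  note Vitali = Vitali_covering_theorem_cballs[of K snd A fst, OF this cov]
  obtain C where C: "countable C" "C \<subseteq> K"
     "pairwise (\<lambda>i j. disjnt (cball (fst i) (snd i)) (cball (fst j) (snd j))) C"
     "negligible (A - (\<Union>i\<in>C. cball (fst i) (snd i)))"
    by (rule Vitali) (assumption | rule that)+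
  let ?V = "\<Union>i\<in>C. cball (fst i) (1 * snd i)"
  have "hausdorff_content DIM('a) \<delta> ?V \<le> ennreal (1 ^ DIM('a)) * emeasure lborel U"
  proof (rule hausdorff_content_UN_cball_le)
    show "0 < snd i \<and> 2 * 1 * snd i \<le> \<delta>" if "i \<in> C" for i
      using subsetD[OF C(2) that] by (cases i) (simp add: K_def)
    show "cball (fst i) (snd i) \<subseteq> U" if "i \<in> C" for i
      using subsetD[OF C(2) that] by (cases i) (simp add: K_def)
  qed (use C \<delta> U(1) in simp_all)
  moreover have "hausdorff_content DIM('a) \<delta> (A - ?V) \<le> 0"
    using hausdorff_content_le_hausdorff[OF \<delta>, of "DIM('a)" "A - ?V"] hausdorff_negligible[OF C(4)] by simp
  moreover have "hausdorff_content DIM('a) \<delta> A \<le> hausdorff_content DIM('a) \<delta> ?V + hausdorff_content DIM('a) \<delta> (A - ?V)"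
  proof -
    have "hausdorff_content DIM('a) \<delta> A \<le> hausdorff_content DIM('a) \<delta> (?V \<union> (A - ?V))"
      by (rule hausdorff_content_mono) blast
    then show ?thesis
      using hausdorff_content_Un_le[OF \<delta>] order_trans by blast
  qed
  ultimately have "hausdorff_content DIM('a) \<delta> A \<le> emeasure lborel U"
    by simp
  also have "U = A \<union> (U - A)" using U(2) by blast
  also have "emeasure lborel (A \<union> (U - A)) \<le> emeasure lborel A + emeasure lborel (U - A)"
    using U(1) A by (intro emeasure_subadditive) auto
  also have "emeasure lborel (U - A) = emeasure lebesgue (U - A)"
  proof -
    have "U - A \<in> sets lborel" using U(1) A by auto
    then show ?thesis by simp
  qed
  also have "emeasure lborel A + emeasure lebesgue (U - A) \<le> emeasure lborel A + ennreal e"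
    using U(3) by (intro add_left_mono less_imp_le)
  finally show "hausdorff_content DIM('a) \<delta> A \<le> emeasure lborel A + ennreal e" .
qed

theorem hausdorff_eq_lborel:
  fixes A :: "'a::euclidean_space set"
  shows "A \<in> sets borel \<Longrightarrow> hausdorff DIM('a) A = emeasure lborel A"
  by (intro antisym hausdorff_le_emeasure emeasure_le_hausdorff)

lemma hausdorff_0_singleton: "hausdorff 0 {z :: 'a::metric_space} = 1"
proof -
  have "hausdorff_content 0 \<delta> {z} = 1" if \<delta>: "\<delta> > 0" for \<delta>
  proof (rule antisym)
    have "hausdorff_content 0 \<delta> {z} \<le> (\<Sum>i::nat. hausdorff_weight 0 (if i = 0 then {z} else {}))"
      using \<delta> by (intro hausdorff_content_le_suminf) auto
    also have "\<dots> = (\<Sum>i\<in>{0::nat}. hausdorff_weight 0 (if i = 0 then {z} else {}))"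
      by (rule suminf_finite) (auto simp: hausdorff_weight_def)
    finally show "hausdorff_content 0 \<delta> {z} \<le> 1"
      by (simp add: hausdorff_weight_def)
    show "1 \<le> hausdorff_content 0 \<delta> {z}"
      unfolding hausdorff_content_def
    proof (rule INF_greatest)
      fix S assume "S \<in> hausdorff_covers \<delta> {z}"
      then obtain i where "z \<in> S i" by (auto simp: hausdorff_covers_def)
      then have "1 = hausdorff_weight 0 (S i)" by (auto simp: hausdorff_weight_def)
      also have "\<dots> \<le> (\<Sum>i. hausdorff_weight 0 (S i))"
        using sum_le_suminf[of "\<lambda>i. hausdorff_weight 0 (S i)" "{i}"] by simp
      finally show "1 \<le> (\<Sum>i. hausdorff_weight 0 (S i))" .
    qed
  qed
  then show ?thesis by (simp add: hausdorff_def)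
qed

lemma hausdorff_weight_1: "bounded S \<Longrightarrow> hausdorff_weight 1 S = ennreal (diameter S)"
  by (simp add: hausdorff_weight_def)

section \<open>Hausdorff measure on the space of discs\<close>

lemma ennreal_le_of_mult_gt_one:
  fixes X Y :: ennreal
  assumes "\<And>c. c > 1 \<Longrightarrow> X \<le> ennreal c * Y"
  shows "X \<le> Y"
proof (cases Y)
  case (real y)
  have "X \<le> ennreal 2 * Y" by (rule assms) simp
  also have "\<dots> < top" using real by (simp add: ennreal_mult_less_top)
  finally obtain x where x: "X = ennreal x" "x \<ge> 0" by (cases X) auto
  have le: "x \<le> c * y" if "c > 1" for c
    using assms[OF that] real x that by (simp add: ennreal_mult[symmetric])
  have "x \<le> y"
  proof (rule ccontr)
    assume "\<not> x \<le> y"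
    then have xy: "y < x" by simp
    show False
    proof (cases "y = 0")
      case True
      then show False using le[of 2] xy by simp
    next
      case False
      then have y: "y > 0" using real by simp
      \<comment> \<open>The factor is chosen to make the bound the midpoint of \<open>y\<close> and
        \<open>x\<close>.\<close>
      have "x \<le> (1 + (x - y) / (2 * y)) * y" using xy y by (intro le) simp
      also have "\<dots> = (x + y) / 2" using y by (simp add: field_simps)
      finally show False using xy by simp
    qed
  qed
  then show ?thesis using real x by simp
qed simp

text \<open>A comparison with factor \<open>c\<close> on each member of a countable cover adds up to
  one on \<open>E\<close> with the same factor, once the cover is made disjoint; then
  \<open>c\<close> tends to 1.\<close>

lemma emeasure_le_of_local:
  fixes M1 M2 :: "'b measure"
  assumes sets: "sets M1 = sets M2" and E: "E \<in> sets M2"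
    and loc: "\<And>c. c > 1 \<Longrightarrow> \<exists>U :: nat \<Rightarrow> 'b set. range U \<subseteq> sets M2 \<and> E \<subseteq> (\<Union>i. U i) \<and>
      (\<forall>i. \<forall>F\<in>sets M2. F \<subseteq> E \<inter> U i \<longrightarrow> emeasure M1 F \<le> ennreal c * emeasure M2 F)"
  shows "emeasure M1 E \<le> emeasure M2 E"
proof (rule ennreal_le_of_mult_gt_one)
  fix c :: real assume "c > 1"
  from loc[OF this] obtain U :: "nat \<Rightarrow> 'b set" where U: "range U \<subseteq> sets M2" "E \<subseteq> (\<Union>i. U i)"
      "\<forall>i. \<forall>F\<in>sets M2. F \<subseteq> E \<inter> U i \<longrightarrow> emeasure M1 F \<le> ennreal c * emeasure M2 F"
    by (elim exE conjE) (rule that)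
  define V where "V i = E \<inter> disjointed U i" for i
  have V2: "range V \<subseteq> sets M2" using sets.range_disjointed_sets[OF U(1)] E by (auto simp: V_def)
  have disj: "disjoint_family V"
    using disjoint_family_disjointed[of U] by (auto simp: V_def disjoint_family_on_def)
  have UN: "(\<Union>i. V i) = E" using U(2) UN_disjointed_eq[of U] by (auto simp: V_def)
  have "emeasure M1 E = (\<Sum>i. emeasure M1 (V i))"
    using suminf_emeasure[of V M1] V2 disj sets UN by simp
  also have "\<dots> \<le> (\<Sum>i. ennreal c * emeasure M2 (V i))"
  proof (intro suminf_le summableI)
    show "emeasure M1 (V i) \<le> ennreal c * emeasure M2 (V i)" for i
    proof -
      have V: "V i \<in> sets M2" "V i \<subseteq> E \<inter> U i"
        using V2 disjointed_subset[of U i] by (auto simp: V_def)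
      show ?thesis by (rule U(3)[rule_format, OF V])
    qed
  qed
  also have "\<dots> = ennreal c * emeasure M2 E"
    using suminf_emeasure[of V M2] V2 disj UN by simp
  finally show "emeasure M1 E \<le> ennreal c * emeasure M2 E" .
qed

section \<open>Integrands that depend only on the direction\<close>

lemma nn_integral_direction_scale:
  fixes \<phi> :: "'a::euclidean_space \<Rightarrow> ennreal"
  assumes [measurable]: "\<phi> \<in> borel_measurable borel" and s: "s > 0"
  shows "(\<integral>\<^sup>+x. \<phi> (x /\<^sub>R norm x) * indicator (cball 0 s) x \<partial>lborel) =
    ennreal (s ^ DIM('a)) * (\<integral>\<^sup>+x. \<phi> (x /\<^sub>R norm x) * indicator (cball 0 1) x \<partial>lborel)"
proof -
  have [measurable]: "cball (0::'a) s \<in> sets borel" by simp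
  have dir: "(s *\<^sub>R x) /\<^sub>R norm (s *\<^sub>R x) = x /\<^sub>R norm x" for x :: 'a
    using s by simp
  have "(\<integral>\<^sup>+x. \<phi> (x /\<^sub>R norm x) * indicator (cball 0 s) x \<partial>lborel) =
      ennreal (s ^ DIM('a)) * (\<integral>\<^sup>+x. \<phi> ((s *\<^sub>R x) /\<^sub>R norm (s *\<^sub>R x)) * indicator (cball 0 s) (s *\<^sub>R x) \<partial>lborel)"
    by (rule nn_integral_lborel_scale[OF _ s]) measurable
  also have "(\<integral>\<^sup>+x. \<phi> ((s *\<^sub>R x) /\<^sub>R norm (s *\<^sub>R x)) * indicator (cball 0 s) (s *\<^sub>R x) \<partial>lborel) =
      (\<integral>\<^sup>+x. \<phi> (x /\<^sub>R norm x) * indicator (cball 0 1) x \<partial>lborel)"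
    using s by (intro nn_integral_cong) (simp only: dir, simp add: indicator_def mult_le_cancel_left1)
  finally show ?thesis .
qed

text \<open>The shell is the unit ball without the ball of radius \<open>s\<close>, whose share is
  s^n by homogeneity. The bound \<phi> \<le> 1 makes the integrals finite, so that they can be
  subtracted.\<close>

lemma nn_integral_direction_shell:
  fixes \<phi> :: "'a::euclidean_space \<Rightarrow> ennreal"
  assumes [measurable]: "\<phi> \<in> borel_measurable borel" and le1: "\<And>x. \<phi> x \<le> 1" and s: "0 < s" "s < 1"
  shows "(\<integral>\<^sup>+x. \<phi> (x /\<^sub>R norm x) * indicator {x. s < norm x \<and> norm x \<le> 1} x \<partial>lborel) =
    ennreal (1 - s ^ DIM('a)) * (\<integral>\<^sup>+x. \<phi> (x /\<^sub>R norm x) * indicator (cball 0 1) x \<partial>lborel)"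
proof -
  define G where "G = (\<integral>\<^sup>+x. \<phi> (x /\<^sub>R norm x) * indicator (cball 0 1) x \<partial>lborel)"
  have "G \<le> (\<integral>\<^sup>+x. 1 * indicator (cball (0::'a) 1) x \<partial>lborel)"
    unfolding G_def using le1 by (intro nn_integral_mono mult_right_mono) auto
  also have "\<dots> < top" by (simp add: emeasure_cball)
  finally obtain g where g: "G = ennreal g" "g \<ge> 0" by (cases G) auto
  have [measurable]: "cball (0::'a) r \<in> sets borel" for r by simp
  have sn: "s ^ DIM('a) \<le> 1" using s by (simp add: power_le_one)
  let ?S = "\<integral>\<^sup>+x. \<phi> (x /\<^sub>R norm x) * indicator {x. s < norm x \<and> norm x \<le> 1} x \<partial>lborel"
  have "?S + (\<integral>\<^sup>+x. \<phi> (x /\<^sub>R norm x) * indicator (cball 0 s) x \<partial>lborel) =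
    (\<integral>\<^sup>+x. \<phi> (x /\<^sub>R norm x) * indicator {x. s < norm x \<and> norm x \<le> 1} x + \<phi> (x /\<^sub>R norm x) * indicator (cball 0 s) x \<partial>lborel)"
    by (rule nn_integral_add[symmetric]) measurable
  also have "\<dots> = G"
    unfolding G_def using s by (intro nn_integral_cong) (auto simp: indicator_def)
  finally have *: "?S + ennreal (s ^ DIM('a)) * G = G"
    using nn_integral_direction_scale[OF assms(1) s(1), folded G_def] by simp
  have "?S \<le> ?S + ennreal (s ^ DIM('a)) * G" by simp
  then have "?S \<le> G" by (simp only: *)
  then have "?S < top" using g(1) by (simp add: order_le_less_trans)
  then obtain y where y: "?S = ennreal y" "y \<ge> 0" by (cases ?S) auto
  have "ennreal (y + s ^ DIM('a) * g) = ennreal g"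
    using * s g(2) y(2) unfolding y(1) g(1) by (simp add: ennreal_mult)
  then have "y + s ^ DIM('a) * g = g"
    using y g s by (subst (asm) ennreal_inj) auto
  then have "y = (1 - s ^ DIM('a)) * g" by (simp add: algebra_simps)
  then show ?thesis
    unfolding G_def[symmetric] y(1) g(1) using sn g by (simp add: ennreal_mult)
qed

text \<open>Law of cosines in polar form: the radial and the angular displacement separate, which
  allows the shell over a cap to be compared with a product.\<close>

lemma norm_scaled_diff_sq:
  fixes u v :: "'a::real_inner"
  assumes "norm u = 1" "norm v = 1"
  shows "(norm (\<rho> *\<^sub>R u - \<tau> *\<^sub>R v))\<^sup>2 = (\<rho> - \<tau>)\<^sup>2 + \<rho> * \<tau> * (norm (u - v))\<^sup>2"
proof -
  have uv: "u \<bullet> u = 1" "v \<bullet> v = 1" using assms by (simp_all add: norm_eq_1)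
  show ?thesis
    unfolding power2_norm_eq_inner
    by (simp add: inner_diff_left inner_diff_right uv inner_commute power2_eq_square algebra_simps)
qed

text \<open>Since \<open>(u - v) \<bullet> (u + v) = 0\<close> for unit vectors, the \<open>e\<close>-component of \<open>u - v\<close> is small near \<open>e\<close>.\<close>

lemma norm_diff_le_perp:
  fixes u v e :: "'a::euclidean_space"
  assumes "norm e = 1" "norm u = 1" "norm v = 1" "norm (u - e) \<le> \<kappa>" "norm (v - e) \<le> \<kappa>"
  shows "(1 - \<kappa>\<^sup>2) * (norm (u - v))\<^sup>2 \<le> (norm (perp e (u - v)))\<^sup>2"
proof -
  have "(u - v) \<bullet> (u + v) = 0"
    using assms(2,3) by (simp add: inner_diff_left inner_add_right norm_eq_1 inner_commute[of v u])
  then have "\<bar>(u - v) \<bullet> e\<bar> = \<bar>(u - v) \<bullet> ((1/2) *\<^sub>R ((u - e) + (v - e)))\<bar>"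
    by (simp add: inner_diff_right inner_add_right algebra_simps)
  also have "\<dots> \<le> norm (u - v) * norm ((1/2) *\<^sub>R ((u - e) + (v - e)))"
    by (rule Cauchy_Schwarz_ineq2)
  also have "\<dots> \<le> norm (u - v) * \<kappa>"
    using norm_triangle_ineq[of "u - e" "v - e"] assms by (intro mult_left_mono) auto
  finally have "((u - v) \<bullet> e)\<^sup>2 \<le> (norm (u - v) * \<kappa>)\<^sup>2"
    using abs_le_square_iff by fastforce
  then show ?thesis
    using norm_perp_decomp[OF assms(1), of "u - v"] by (simp add: power_mult_distrib algebra_simps)
qed

text \<open>Projection along \<open>e\<close> frees one coordinate of the second component, and the
  radius is stored there. The image thus lies in a Euclidean space of dimension exactly 2 n, where
  Hausdorff and Lebesgue measure agree.\<close>

definition cap_chart :: "'a::euclidean_space \<Rightarrow> 'a \<times> 'a \<times> real \<Rightarrow> 'a \<times> 'a" where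
  "cap_chart e = (\<lambda>(p, u, r). (p, perp e u + r *\<^sub>R e))"

definition direction_map :: "'a::euclidean_space \<times> 'a \<times> real \<Rightarrow> 'a \<times> 'a \<times> real" where
  "direction_map = (\<lambda>(p, x, r). (p, x /\<^sub>R norm x, r))"

lemma measurable_direction_map [measurable]: "direction_map \<in> borel_measurable borel"
  unfolding direction_map_def borel_prod[symmetric] by measurable

definition cap :: "'a::euclidean_space \<Rightarrow> real \<Rightarrow> ('a \<times> 'a \<times> real) set" where
  "cap e \<kappa> = {(p, u, r). norm u = 1 \<and> norm (u - e) < \<kappa>}"

definition shell :: "real \<Rightarrow> ('a::euclidean_space \<times> 'a \<times> real) set \<Rightarrow> ('a \<times> 'a \<times> real) set" where
  "shell s E = {z. direction_map z \<in> E \<and> s < norm (fst (snd z)) \<and> norm (fst (snd z)) \<le> 1}"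

text \<open>The product of Lebesgue measure with the cone measure of the unit sphere in the second component.
  The origin is mapped to \<open>0\<close> by the radial projection, which lies outside the sphere.\<close>

definition direction_measure :: "('a::euclidean_space \<times> 'a \<times> real) measure" where
  "direction_measure = distr (density lborel (\<lambda>z. ennreal (real DIM('a)) * indicator (cball 0 1) (fst (snd z)))) borel direction_map"

lemma measurable_fst_snd_cball [measurable]:
  "(\<lambda>z::'a::euclidean_space \<times> 'a \<times> real. indicator (cball 0 1) (fst (snd z)) :: ennreal) \<in> borel_measurable borel"
proof -
  have [measurable]: "cball (0::'a) 1 \<in> sets borel" by simp
  show ?thesis unfolding borel_prod[symmetric] by measurable
qed

lemma nn_integral_direction_measure:
  fixes f :: "'a::euclidean_space \<times> 'a \<times> real \<Rightarrow> ennreal"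
  assumes [measurable]: "f \<in> borel_measurable borel"
  shows "(\<integral>\<^sup>+z. f z \<partial>direction_measure) =
    ennreal (real DIM('a)) * (\<integral>\<^sup>+z. f (direction_map z) * indicator (cball 0 1) (fst (snd z)) \<partial>lborel)"
proof -
  have "(\<integral>\<^sup>+z. f z \<partial>direction_measure) =
      (\<integral>\<^sup>+z. (ennreal (real DIM('a)) * indicator (cball 0 1) (fst (snd z))) * f (direction_map z) \<partial>lborel)"
    unfolding direction_measure_def
    by (subst nn_integral_distr) (auto simp: nn_integral_density)
  also have "\<dots> = ennreal (real DIM('a)) * (\<integral>\<^sup>+z. f (direction_map z) * indicator (cball 0 1) (fst (snd z)) \<partial>lborel)"
    by (subst nn_integral_cmult[symmetric]) (auto simp: mult_ac)
  finally show ?thesis .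
qed

lemma nn_integral_triple:
  fixes f :: "'a::euclidean_space \<times> 'a \<times> real \<Rightarrow> ennreal"
  assumes f: "f \<in> borel_measurable borel"
  shows "(\<integral>\<^sup>+z. f z \<partial>lborel) = (\<integral>\<^sup>+r. \<integral>\<^sup>+x. \<integral>\<^sup>+p. f (p, x, r) \<partial>lborel \<partial>lborel \<partial>lborel)"
proof -
  have [measurable]: "f \<in> borel_measurable (lborel \<Otimes>\<^sub>M lborel \<Otimes>\<^sub>M lborel)"
    using f unfolding lborel_prod by simp
  have "(\<integral>\<^sup>+z. f z \<partial>lborel) = (\<integral>\<^sup>+w. \<integral>\<^sup>+p. f (p, w) \<partial>lborel \<partial>lborel)"
    using lborel_pair.nn_integral_snd[of f] f unfolding lborel_prod by simp
  also have "\<dots> = (\<integral>\<^sup>+w. \<integral>\<^sup>+p. f (p, w) \<partial>lborel \<partial>(lborel \<Otimes>\<^sub>M lborel))"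
    unfolding lborel_prod ..
  also have "\<dots> = (\<integral>\<^sup>+r. \<integral>\<^sup>+x. \<integral>\<^sup>+p. f (p, x, r) \<partial>lborel \<partial>lborel \<partial>lborel)"
    by (rule lborel_pair.nn_integral_snd[symmetric]) measurable
  finally show ?thesis .
qed

lemma measurable_norm_fst_snd [measurable]:
  "(\<lambda>z::'a::euclidean_space \<times> 'a \<times> real. norm (fst (snd z))) \<in> borel_measurable borel"
  by (intro borel_measurable_continuous_onI continuous_intros)

lemma sets_shell:
  assumes [measurable]: "E \<in> sets borel"
  shows "shell s E \<in> sets borel"
  unfolding shell_def by measurable

text \<open>For fixed \<open>p\<close> and \<open>r\<close> this is
  \<open>nn_integral_direction_shell\<close>; Fubini brings the integral over the direction
  innermost and back again.\<close>

lemma emeasure_shell: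
  fixes E :: "('a::euclidean_space \<times> 'a \<times> real) set"
  assumes E: "E \<in> sets borel" and s: "0 < s" "s < 1"
  shows "ennreal (real DIM('a)) * emeasure lborel (shell s E) = ennreal (1 - s ^ DIM('a)) * emeasure direction_measure E"
proof -
  have [measurable]: "E \<in> sets (borel \<Otimes>\<^sub>M borel \<Otimes>\<^sub>M borel)"
    using E unfolding borel_prod by assumption
  have [measurable]: "E \<in> sets borel" by fact
  have [measurable]: "cball (0::'a) 1 \<in> sets borel" by simp
  have sh [measurable]: "shell s E \<in> sets borel"
    by (rule sets_shell) fact
  have [measurable]: "shell s E \<in> sets (borel \<Otimes>\<^sub>M borel \<Otimes>\<^sub>M borel)"
    using sh unfolding borel_prod by assumption
  have "emeasure lborel (shell s E) = (\<integral>\<^sup>+z. indicator (shell s E) z \<partial>lborel)" by simp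
  also have "\<dots> = (\<integral>\<^sup>+r. \<integral>\<^sup>+x. \<integral>\<^sup>+p. indicator (shell s E) (p, x, r) \<partial>lborel \<partial>lborel \<partial>lborel)"
    by (rule nn_integral_triple) measurable
  also have "\<dots> = (\<integral>\<^sup>+r. \<integral>\<^sup>+p. \<integral>\<^sup>+x. indicator (shell s E) (p, x, r) \<partial>lborel \<partial>lborel \<partial>lborel)"
    by (intro nn_integral_cong lborel_pair.Fubini'[of "\<lambda>p x. indicator (shell s E) (p, x, r)" for r]) measurable
  also have "\<dots> = (\<integral>\<^sup>+r. \<integral>\<^sup>+p. ennreal (1 - s ^ DIM('a)) * (\<integral>\<^sup>+x. indicator E (p, x /\<^sub>R norm x, r) * indicator (cball 0 1) x \<partial>lborel) \<partial>lborel \<partial>lborel)"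
  proof (intro nn_integral_cong)
    fix r p
    have "(\<integral>\<^sup>+x. indicator (shell s E) (p, x, r) \<partial>lborel) =
        (\<integral>\<^sup>+x. (\<lambda>u. indicator E (p, u, r)) (x /\<^sub>R norm x) * indicator {x. s < norm x \<and> norm x \<le> 1} x \<partial>lborel)"
      by (intro nn_integral_cong) (auto simp: indicator_def shell_def direction_map_def)
    also have "\<dots> = ennreal (1 - s ^ DIM('a)) * (\<integral>\<^sup>+x. (\<lambda>u. indicator E (p, u, r)) (x /\<^sub>R norm x) * indicator (cball 0 1) x \<partial>lborel)"
      by (rule nn_integral_direction_shell) (use s in \<open>auto simp: indicator_def\<close>)
    finally show "(\<integral>\<^sup>+x. indicator (shell s E) (p, x, r) \<partial>lborel) =
      ennreal (1 - s ^ DIM('a)) * (\<integral>\<^sup>+x. indicator E (p, x /\<^sub>R norm x, r) * indicator (cball 0 1) x \<partial>lborel)" .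
  qed
  also have "\<dots> = ennreal (1 - s ^ DIM('a)) * (\<integral>\<^sup>+r. \<integral>\<^sup>+p. \<integral>\<^sup>+x. indicator E (p, x /\<^sub>R norm x, r) * indicator (cball 0 1) x \<partial>lborel \<partial>lborel \<partial>lborel)"
    by (subst nn_integral_cmult[symmetric], measurable) (intro nn_integral_cong nn_integral_cmult, measurable)
  also have "(\<integral>\<^sup>+r. \<integral>\<^sup>+p. \<integral>\<^sup>+x. indicator E (p, x /\<^sub>R norm x, r) * indicator (cball 0 1) x \<partial>lborel \<partial>lborel \<partial>lborel) =
      (\<integral>\<^sup>+r. \<integral>\<^sup>+x. \<integral>\<^sup>+p. indicator E (p, x /\<^sub>R norm x, r) * indicator (cball 0 1) x \<partial>lborel \<partial>lborel \<partial>lborel)"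
    by (intro nn_integral_cong lborel_pair.Fubini'[symmetric, of "\<lambda>p x. indicator E (p, x /\<^sub>R norm x, r) * indicator (cball 0 1) x" for r]) measurable
  also have "\<dots> = (\<integral>\<^sup>+z. indicator E (direction_map z) * indicator (cball 0 1) (fst (snd z)) \<partial>lborel)"
    by (subst nn_integral_triple) (auto simp: direction_map_def[symmetric], simp add: direction_map_def)
  finally have "ennreal (real DIM('a)) * emeasure lborel (shell s E) = ennreal (1 - s ^ DIM('a)) *
      (ennreal (real DIM('a)) * (\<integral>\<^sup>+z. indicator E (direction_map z) * indicator (cball 0 1) (fst (snd z)) \<partial>lborel))"
    by (simp add: mult_ac)
  also have "ennreal (real DIM('a)) * (\<integral>\<^sup>+z. indicator E (direction_map z) * indicator (cball 0 1) (fst (snd z)) \<partial>lborel) =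
      (\<integral>\<^sup>+z. indicator E z \<partial>direction_measure)"
    by (rule nn_integral_direction_measure[symmetric]) measurable
  also have "\<dots> = emeasure direction_measure E"
    by (rule nn_integral_indicator) (simp add: direction_measure_def)
  finally show ?thesis .
qed

section \<open>Distortion of the charts on a cap\<close>

lemma hausdorff_expanding_image:
  fixes f :: "'a::metric_space \<Rightarrow> 'b::metric_space"
  assumes L: "L > 0" and exp: "\<And>x y. x \<in> A \<Longrightarrow> y \<in> A \<Longrightarrow> dist x y \<le> L * dist (f x) (f y)"
  shows "hausdorff k A \<le> ennreal (L ^ k) * hausdorff k (f ` A)"
proof -
  have inj: "inj_on f A"
    using exp by (intro inj_onI) (metis dist_eq_0_iff dist_le_zero_iff mult_zero_right)
  define g where "g = inv_into A f"
  have "hausdorff k (g ` f ` A) \<le> ennreal (L ^ k) * hausdorff k (f ` A)"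
    using L exp by (intro hausdorff_lipschitz_image) (auto simp: g_def inv_into_f_f[OF inj])
  also have "g ` f ` A = A"
    unfolding g_def using inj by (simp add: image_inv_into_cancel inv_into_image_cancel)
  finally show ?thesis .
qed

lemma dist_triple_sq:
  fixes p q u v :: "'a::euclidean_space"
  shows "(dist (p, u, r) (q, v, s::real))\<^sup>2 = (norm (p - q))\<^sup>2 + (norm (u - v))\<^sup>2 + (r - s)\<^sup>2"
  unfolding dist_Pair_Pair by (simp add: dist_norm)

lemma dist_cap_chart_sq:
  fixes p q u v :: "'a::euclidean_space"
  assumes "norm e = 1"
  shows "(dist (cap_chart e (p, u, r)) (cap_chart e (q, v, s)))\<^sup>2 =
    (norm (p - q))\<^sup>2 + (norm (perp e (u - v)))\<^sup>2 + (r - s)\<^sup>2"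
proof -
  have "perp e u + r *\<^sub>R e - (perp e v + s *\<^sub>R e) = perp e (u - v) + (r - s) *\<^sub>R e"
    by (simp add: perp_diff algebra_simps)
  moreover have "(norm (perp e (u - v) + (r - s) *\<^sub>R e))\<^sup>2 = (norm (perp e (u - v)))\<^sup>2 + (r - s)\<^sup>2"
    using assms by (subst norm_perp_decomp[OF assms]) (simp add: inner_add_left inner_unit_self)
  ultimately show ?thesis
    unfolding cap_chart_def prod.case dist_Pair_Pair by (simp add: dist_norm)
qed

text \<open>The image is the preimage of \<open>E\<close> under the continuous right inverse
  \<open>W\<close> of the chart, which recovers the lost coordinate as u \<bullet> e = sqrt (1 -
  norm (perp e u)^2). The sign is right because the cap lies in the half-space u \<bullet> e >
  0.\<close>

lemma sets_cap_chart_image: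
  fixes E :: "('a::euclidean_space \<times> 'a \<times> real) set"
  assumes e: "norm e = 1" and E: "E \<in> sets borel" and cap: "E \<subseteq> cap e \<kappa>" and \<kappa>: "\<kappa> \<le> 1"
  shows "cap_chart e ` E \<in> sets borel"
proof -
  define W :: "'a \<times> 'a \<Rightarrow> 'a \<times> 'a \<times> real" where "W = (\<lambda>(p, y). (p, perp e y + sqrt (1 - (norm (perp e y))\<^sup>2) *\<^sub>R e, y \<bullet> e))"
  have W1: "W (cap_chart e z) = z" if "z \<in> E" for z
  proof -
    obtain p u r where z: "z = (p, u, r)" by (cases z)
    have u: "norm u = 1" "norm (u - e) < 1" using that cap \<kappa> by (auto simp: cap_def z)
    have "(norm (u - e))\<^sup>2 = 2 - 2 * (u \<bullet> e)"
      using u e by (simp add: power2_norm_eq_inner inner_diff_left inner_diff_right inner_commute norm_eq_1)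
    moreover have "(norm (u - e))\<^sup>2 < 1" using u(2) by (simp add: power_less_one_iff abs_square_less_1)
    ultimately have "u \<bullet> e > 0" by simp
    moreover have "1 = (norm (perp e u))\<^sup>2 + (u \<bullet> e)\<^sup>2"
      using norm_perp_decomp[OF e, of u] u by simp
    ultimately have "sqrt (1 - (norm (perp e u))\<^sup>2) = u \<bullet> e"
      by (intro real_sqrt_unique) auto
    then show ?thesis
      using e by (simp add: z W_def cap_chart_def inner_add_left inner_unit_self) (simp add: perp_def)
  qed
  have W2: "cap_chart e (W w) = w" for w
    using e by (cases w) (simp add: W_def cap_chart_def, simp add: perp_def)
  have "cap_chart e ` E = W -` E \<inter> space borel"
  proof (intro equalityI subsetI)
    fix w assume "w \<in> W -` E \<inter> space borel"
    then have "cap_chart e (W w) \<in> cap_chart e ` E" by blast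
    then show "w \<in> cap_chart e ` E" by (simp only: W2)
  next
    fix w assume "w \<in> cap_chart e ` E"
    then obtain z where "z \<in> E" "w = cap_chart e z" by blast
    then show "w \<in> W -` E \<inter> space borel" using W1[of z] by simp
  qed
  moreover have "W \<in> borel_measurable borel"
    unfolding W_def case_prod_beta' by (intro borel_measurable_continuous_onI continuous_intros)
  ultimately show ?thesis
    using E by (simp only: measurable_sets)
qed

text \<open>The shell \<open>{s < norm x \<le> 1}\<close> over the cap is compared with the cylinder of height \<open>1 - s\<close> over the chart
  domain; letting \<open>s\<close> tend to \<open>1\<close> removes the distortion of the radial direction.\<close>

lemma cap_estimates:
  fixes E :: "('a::euclidean_space \<times> 'a \<times> real) set"
  assumes e: "norm e = 1" and E: "E \<in> sets borel" and cap: "E \<subseteq> cap e \<kappa>" and \<kappa>: "0 < \<kappa>" "\<kappa> \<le> 1"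
    and L: "1 \<le> L" "L\<^sup>2 * (1 - \<kappa>\<^sup>2) = 1"
  defines "N \<equiv> 2 * DIM('a)"
  shows "hausdorff N E \<le> ennreal (L ^ N) * emeasure direction_measure E"
    and "emeasure direction_measure E \<le> ennreal (L ^ Suc N) * hausdorff N E"
proof -
  define A where "A = cap_chart e ` E"
  define n where "n = DIM('a)"
  have n: "n > 0" by (simp add: n_def)
  have A [measurable]: "A \<in> sets borel"
    unfolding A_def by (rule sets_cap_chart_image[OF e E cap \<kappa>(2)])
  have NA: "hausdorff N A = emeasure lborel A"
    using hausdorff_eq_lborel[OF A] by (simp add: N_def mult_2)
  have perp_le: "(norm (perp e (u - v)))\<^sup>2 \<le> (norm (u - v))\<^sup>2" for u v
    using norm_perp_le[OF e, of "u - v"] by (intro power_mono) auto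
  have le_perp: "(norm (u - v))\<^sup>2 \<le> L\<^sup>2 * (norm (perp e (u - v)))\<^sup>2"
    if "(p, u, r) \<in> E" "(q, v, s) \<in> E" for p q u v r s
  proof -
    have "(1 - \<kappa>\<^sup>2) * (norm (u - v))\<^sup>2 \<le> (norm (perp e (u - v)))\<^sup>2"
      using that cap e by (intro norm_diff_le_perp) (auto simp: cap_def)
    then have "L\<^sup>2 * ((1 - \<kappa>\<^sup>2) * (norm (u - v))\<^sup>2) \<le> L\<^sup>2 * (norm (perp e (u - v)))\<^sup>2"
      by (intro mult_left_mono) auto
    also have "L\<^sup>2 * ((1 - \<kappa>\<^sup>2) * (norm (u - v))\<^sup>2) = (L\<^sup>2 * (1 - \<kappa>\<^sup>2)) * (norm (u - v))\<^sup>2"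
      by (simp only: mult.assoc)
    finally show ?thesis using L by simp
  qed
  have L2: "1 \<le> L\<^sup>2" using L(1) by simp
  have mult_L2: "x \<le> L\<^sup>2 * x" if "x \<ge> 0" for x
    using mult_right_mono[OF L2 that] by simp
  have dist1: "dist (cap_chart e z) (cap_chart e w) \<le> 1 * dist z w" for z w
  proof -
    obtain p u r q v s where zw: "z = (p, u, r)" "w = (q, v, s)" by (cases z, cases w)
    have "(dist (cap_chart e z) (cap_chart e w))\<^sup>2 \<le> (dist z w)\<^sup>2"
      using perp_le[of u v] unfolding zw dist_cap_chart_sq[OF e] dist_triple_sq by simp
    then show ?thesis using power2_le_imp_le[of "dist (cap_chart e z) (cap_chart e w)" "dist z w"] by simp
  qed
  have dist2: "dist z w \<le> L * dist (cap_chart e z) (cap_chart e w)" if zw: "z \<in> E" "w \<in> E" for z w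
  proof -
    obtain p u r q v s where *: "z = (p, u, r)" "w = (q, v, s)" by (cases z, cases w)
    have "(dist z w)\<^sup>2 \<le> L\<^sup>2 * (dist (cap_chart e z) (cap_chart e w))\<^sup>2"
      using le_perp[of p u r q v s] zw mult_L2[of "(norm (p - q))\<^sup>2"] mult_L2[of "(r - s)\<^sup>2"]
      unfolding * dist_cap_chart_sq[OF e] dist_triple_sq by (simp add: distrib_left)
    then have "(dist z w)\<^sup>2 \<le> (L * dist (cap_chart e z) (cap_chart e w))\<^sup>2"
      by (simp add: power_mult_distrib)
    then show ?thesis by (rule power2_le_imp_le) (use L(1) in simp)
  qed
  have AE: "emeasure lborel A \<le> hausdorff N E"
    using hausdorff_lipschitz_image[of 1 E "cap_chart e" N] dist1 NA by (simp add: A_def)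
  have EA: "hausdorff N E \<le> ennreal (L ^ N) * emeasure lborel A"
    using hausdorff_expanding_image[of L E "cap_chart e" N] dist2 NA L(1) by (simp add: A_def)
  \<comment> \<open>\<open>\<Psi>\<close> straightens the shell over \<open>E\<close> to the product
    of \<open>A\<close> and (s, 1], with the norm as extra coordinate. It is (1/s)-Lipschitz and its
    inverse is \<open>L\<close>-Lipschitz.\<close>
  define \<Psi> where "\<Psi> = (\<lambda>z. (cap_chart e (direction_map z), norm (fst (snd z))))"
  have shell_sets: "shell s E \<in> sets borel" for s by (rule sets_shell[OF E])
  have img: "\<Psi> ` shell s E = A \<times> {s<..1}" if s: "0 < s" for s
  proof (intro equalityI subsetI)
    fix y assume "y \<in> A \<times> {s<..1}"
    then obtain p u r \<rho> where y: "y = (cap_chart e (p, u, r), \<rho>)" "(p, u, r) \<in> E" "s < \<rho>" "\<rho> \<le> 1"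
      by (auto simp: A_def)
    have u: "norm u = 1" using y cap by (auto simp: cap_def)
    then have "(\<rho> *\<^sub>R u) /\<^sub>R norm (\<rho> *\<^sub>R u) = u" using s y by simp
    then have "direction_map (p, \<rho> *\<^sub>R u, r) = (p, u, r)" by (simp only: direction_map_def prod.case)
    then have "\<Psi> (p, \<rho> *\<^sub>R u, r) = y" "(p, \<rho> *\<^sub>R u, r) \<in> shell s E"
      using y u s by (simp_all add: \<Psi>_def shell_def)
    then show "y \<in> \<Psi> ` shell s E" by (metis imageI)
  qed (auto simp: \<Psi>_def A_def shell_def)
  \<comment> \<open>\<open>X\<close>, \<open>R\<close>, \<open>T\<close> are the squared differences
    of centres, radii and norms, \<open>U\<close> is the squared distance of the directions,
    \<open>P\<close> that of their projections, and \<rho>, \<tau> are the two norms.\<close>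
  have sq: "\<exists>X P U R T \<rho> \<tau>. (dist z w)\<^sup>2 = X + R + T + \<rho> * \<tau> * U \<and> (dist (\<Psi> z) (\<Psi> w))\<^sup>2 = X + R + T + P \<and>
      0 \<le> X \<and> 0 \<le> R \<and> 0 \<le> T \<and> 0 \<le> P \<and> 0 \<le> U \<and> P \<le> U \<and> U \<le> L\<^sup>2 * P \<and> s < \<rho> \<and> \<rho> \<le> 1 \<and> s < \<tau> \<and> \<tau> \<le> 1"
    if s: "0 < s" and zw: "z \<in> shell s E" "w \<in> shell s E" for s z w
  proof -
    obtain p x r q y s' where *: "z = (p, x, r)" "w = (q, y, s')" by (cases z, cases w)
    define u v where "u = x /\<^sub>R norm x" and "v = y /\<^sub>R norm y"
    have uv: "(p, u, r) \<in> E" "(q, v, s') \<in> E"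
      using zw by (auto simp: * shell_def direction_map_def u_def v_def)
    then have n1: "norm u = 1" "norm v = 1" using cap by (auto simp: cap_def)
    have xy: "s < norm x" "norm x \<le> 1" "s < norm y" "norm y \<le> 1" using zw by (auto simp: * shell_def)
    have "norm x \<noteq> 0" "norm y \<noteq> 0" using xy s by linarith+
    then have "x = norm x *\<^sub>R u" "y = norm y *\<^sub>R v" by (simp_all add: u_def v_def)
    then have "(norm (x - y))\<^sup>2 = (norm x - norm y)\<^sup>2 + norm x * norm y * (norm (u - v))\<^sup>2"
      using norm_scaled_diff_sq[OF n1, of "norm x" "norm y"] by simp
    then have 1: "(dist z w)\<^sup>2 = (norm (p - q))\<^sup>2 + (r - s')\<^sup>2 + (norm x - norm y)\<^sup>2 + norm x * norm y * (norm (u - v))\<^sup>2"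
      by (simp add: * dist_triple_sq)
    have "\<Psi> z = (cap_chart e (p, u, r), norm x)" "\<Psi> w = (cap_chart e (q, v, s'), norm y)"
      by (simp_all add: \<Psi>_def * direction_map_def u_def v_def)
    then have "(dist (\<Psi> z) (\<Psi> w))\<^sup>2 = (dist (cap_chart e (p, u, r)) (cap_chart e (q, v, s')))\<^sup>2 + (norm x - norm y)\<^sup>2"
      by (simp add: dist_Pair_Pair dist_real_def)
    then have 2: "(dist (\<Psi> z) (\<Psi> w))\<^sup>2 = (norm (p - q))\<^sup>2 + (r - s')\<^sup>2 + (norm x - norm y)\<^sup>2 + (norm (perp e (u - v)))\<^sup>2"
      by (simp add: dist_cap_chart_sq[OF e])
    show ?thesis
      by (intro exI conjI, rule 1, rule 2)
         (rule zero_le_power2 perp_le[of u v] le_perp[OF uv] xy)+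
  qed
  have dist3: "dist z w \<le> L * dist (\<Psi> z) (\<Psi> w)" if "0 < s" "z \<in> shell s E" "w \<in> shell s E" for s z w
  proof -
    from sq[OF that] obtain X P U R T \<rho> \<tau> where *: "(dist z w)\<^sup>2 = X + R + T + \<rho> * \<tau> * U"
      "(dist (\<Psi> z) (\<Psi> w))\<^sup>2 = X + R + T + P" "0 \<le> X" "0 \<le> R" "0 \<le> T" "0 \<le> P" "0 \<le> U" "P \<le> U" "U \<le> L\<^sup>2 * P"
      "s < \<rho>" "\<rho> \<le> 1" "s < \<tau>" "\<tau> \<le> 1"
      by (elim exE conjE) (rule that)
    have "\<rho> * \<tau> \<le> 1 * 1" using * \<open>0 < s\<close> by (intro mult_mono) auto
    then have "\<rho> * \<tau> * U \<le> 1 * U" using * by (intro mult_right_mono) auto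
    then have "\<rho> * \<tau> * U \<le> L\<^sup>2 * P" using * by simp
    then have "(dist z w)\<^sup>2 \<le> L\<^sup>2 * (dist (\<Psi> z) (\<Psi> w))\<^sup>2"
      unfolding *(1,2) using mult_L2[OF *(3)] mult_L2[OF *(4)] mult_L2[OF *(5)] by (simp add: distrib_left)
    then have "(dist z w)\<^sup>2 \<le> (L * dist (\<Psi> z) (\<Psi> w))\<^sup>2"
      by (simp add: power_mult_distrib)
    then show ?thesis by (rule power2_le_imp_le) (use L(1) in simp)
  qed
  have dist4: "dist (\<Psi> z) (\<Psi> w) \<le> inverse s * dist z w" if "0 < s" "s < 1" "z \<in> shell s E" "w \<in> shell s E" for s z w
  proof -
    from sq[OF that(1,3,4)] obtain X P U R T \<rho> \<tau> where *: "(dist z w)\<^sup>2 = X + R + T + \<rho> * \<tau> * U"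
      "(dist (\<Psi> z) (\<Psi> w))\<^sup>2 = X + R + T + P" "0 \<le> X" "0 \<le> R" "0 \<le> T" "0 \<le> P" "0 \<le> U" "P \<le> U" "U \<le> L\<^sup>2 * P"
      "s < \<rho>" "\<rho> \<le> 1" "s < \<tau>" "\<tau> \<le> 1"
      by (elim exE conjE) (rule that)
    have s1: "s * s \<le> 1" using that mult_mono[of s 1 s 1] by simp
    have "s * s \<le> \<rho> * \<tau>" using * that by (intro mult_mono) auto
    then have "s * s * U \<le> \<rho> * \<tau> * U" using * by (intro mult_right_mono) auto
    moreover have "s * s * P \<le> s * s * U" using * that by (intro mult_left_mono) auto
    moreover have "s * s * x \<le> x" if "0 \<le> x" for x using mult_right_mono[OF s1 that] by simp
    note this[OF *(3)] this[OF *(4)] this[OF *(5)]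
    ultimately have "s * s * (dist (\<Psi> z) (\<Psi> w))\<^sup>2 \<le> (dist z w)\<^sup>2"
      unfolding *(1,2) distrib_left by linarith
    then have "(s * dist (\<Psi> z) (\<Psi> w))\<^sup>2 \<le> (dist z w)\<^sup>2"
      by (simp add: power_mult_distrib power2_eq_square[of s])
    then have "s * dist (\<Psi> z) (\<Psi> w) \<le> dist z w" by (rule power2_le_imp_le) simp
    then show ?thesis using that(1) by (simp add: field_simps)
  qed
  have prod: "hausdorff (Suc N) (A \<times> {s<..1}) = ennreal (1 - s) * emeasure lborel A" if "s < 1" for s
  proof -
    have "A \<times> {s<..1} \<in> sets borel"
      using pair_measureI[OF A, of "{s<..1}" borel] unfolding borel_prod by simp
    then have "hausdorff (Suc N) (A \<times> {s<..1}) = emeasure lborel (A \<times> {s<..1})"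
      using hausdorff_eq_lborel[of "A \<times> {s<..1}"] by (simp add: N_def mult_2)
    also have "\<dots> = emeasure (lborel \<Otimes>\<^sub>M lborel) (A \<times> {s<..1})"
      unfolding lborel_prod ..
    also have "\<dots> = emeasure lborel A * emeasure lborel {s<..1}"
      by (rule lborel.emeasure_pair_measure_Times) auto
    finally show ?thesis using that by (simp add: mult.commute)
  qed
  have shell_haus: "hausdorff (Suc N) (shell s E) = emeasure lborel (shell s E)" for s
    using hausdorff_eq_lborel[OF shell_sets[of s]] by (simp add: N_def mult_2)
  have sh: "ennreal (real n) * emeasure lborel (shell s E) = ennreal (1 - s ^ n) * emeasure direction_measure E" if "0 < s" "s < 1" for s
    unfolding n_def by (rule emeasure_shell[OF E that])
  have "emeasure lborel A \<le> emeasure direction_measure E"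
  proof (rule ennreal_le_of_mult_gt_one)
    fix c :: real assume c: "c > 1"
    \<comment> \<open>Chosen so that the Lipschitz factor (1/s)^(N+1) equals \<open>c\<close>;
      Bernoulli's inequality 1 - s^n \<le> n (1 - s) then matches shell and product.\<close>
    define s where "s = root (Suc N) (inverse c)"
    have s: "0 < s" "s < 1" "s ^ Suc N = inverse c"
      using c real_root_pow_pos2[of "Suc N" "inverse c"]
      by (auto simp: s_def real_root_gt_0_iff inverse_less_1_iff simp del: power_Suc)
    have "ennreal (1 - s) * emeasure lborel A \<le> ennreal (inverse s ^ Suc N) * emeasure lborel (shell s E)"
      using hausdorff_lipschitz_image[of "inverse s" "shell s E" \<Psi> "Suc N"] dist4[OF s(1,2)] s
      by (simp only: img[OF s(1)] prod[OF s(2)] shell_haus) simp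
    also have "inverse s ^ Suc N = c" using s(3) by (metis inverse_inverse_eq power_inverse)
    finally have "ennreal (real n) * (ennreal (1 - s) * emeasure lborel A) \<le>
        ennreal (real n) * (ennreal c * emeasure lborel (shell s E))"
      by (rule mult_left_mono) simp
    also have "\<dots> = ennreal c * (ennreal (1 - s ^ n) * emeasure direction_measure E)"
      using sh[OF s(1,2)] by (simp add: mult_ac)
    also have "\<dots> \<le> ennreal c * (ennreal (real n * (1 - s)) * emeasure direction_measure E)"
    proof (intro mult_left_mono mult_right_mono ennreal_leI)
      show "1 - s ^ n \<le> real n * (1 - s)"
        using Bernoulli_inequality[of "s - 1" n] s by (simp add: algebra_simps)
    qed auto
    also have "\<dots> = ennreal (real n * (1 - s)) * (ennreal c * emeasure direction_measure E)"
      by (simp add: mult_ac)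
    finally have "ennreal (real n * (1 - s)) * emeasure lborel A \<le> ennreal (real n * (1 - s)) * (ennreal c * emeasure direction_measure E)"
      using s by (simp add: ennreal_mult mult.assoc)
    then show "emeasure lborel A \<le> ennreal c * emeasure direction_measure E"
      using s n by (subst (asm) ennreal_mult_le_mult_iff) auto
  qed
  with EA show "hausdorff N E \<le> ennreal (L ^ N) * emeasure direction_measure E"
    by (meson mult_left_mono order_trans zero_le)
  have "emeasure direction_measure E \<le> ennreal (L ^ Suc N) * emeasure lborel A"
  proof (rule ennreal_le_of_mult_gt_one)
    fix c :: real assume c: "c > 1"
    \<comment> \<open>Here s^n = 1/c, because the reverse estimate n (1 - s) s^n \<le> 1 - s^n loses
      just the factor s^n.\<close>
    define s where "s = root n (inverse c)"
    have s: "0 < s" "s < 1" "s ^ n = inverse c"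
      using c n by (auto simp: s_def real_root_gt_0_iff inverse_less_1_iff)
    have "emeasure lborel (shell s E) \<le> ennreal (L ^ Suc N) * (ennreal (1 - s) * emeasure lborel A)"
      using hausdorff_expanding_image[of L "shell s E" \<Psi> "Suc N"] dist3[OF s(1)] L(1)
      by (simp only: img[OF s(1)] prod[OF s(2)] shell_haus)
    then have "ennreal (real n) * emeasure lborel (shell s E) \<le> ennreal (real n) * (ennreal (L ^ Suc N) * (ennreal (1 - s) * emeasure lborel A))"
      by (rule mult_left_mono) simp
    also have "ennreal (real n) * emeasure lborel (shell s E) = ennreal (1 - s ^ n) * emeasure direction_measure E"
      by (rule sh[OF s(1,2)])
    finally have 1: "ennreal (1 - s ^ n) * emeasure direction_measure E \<le>
        ennreal (real n * (1 - s)) * (ennreal (L ^ Suc N) * emeasure lborel A)"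
      using s by (simp add: ennreal_mult mult_ac)
    have "1 + real n * (inverse s - 1) \<le> inverse s ^ n"
      using Bernoulli_inequality[of "inverse s - 1" n] s by simp
    then have "s ^ n * (1 + real n * (inverse s - 1)) \<le> s ^ n * inverse s ^ n"
      using s c by (intro mult_left_mono) auto
    also have "s ^ n * inverse s ^ n = 1" using s(1) by (simp add: power_mult_distrib[symmetric] del: power_inverse)
    finally have B: "s ^ n * (real n * (inverse s - 1)) \<le> 1 - s ^ n" by (simp add: distrib_left)
    have "1 - s \<le> inverse s * (1 - s)" using s mult_right_mono[of 1 "inverse s" "1 - s"] by (simp add: one_le_inverse_iff)
    also have "\<dots> = inverse s - 1" using s by (simp add: right_diff_distrib)
    finally have "s ^ n * (real n * (1 - s)) \<le> s ^ n * (real n * (inverse s - 1))"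
      using s c by (intro mult_left_mono) auto
    with B have "s ^ n * (real n * (1 - s)) \<le> 1 - s ^ n" by simp
    then have "real n * (1 - s) * s ^ n \<le> 1 - s ^ n" by (simp add: mult_ac)
    then have "ennreal (real n * (1 - s) * s ^ n) * emeasure direction_measure E \<le> ennreal (1 - s ^ n) * emeasure direction_measure E"
      by (intro mult_right_mono ennreal_leI) auto
    from order_trans[OF this 1]
    have "ennreal (real n * (1 - s) * s ^ n) * emeasure direction_measure E \<le>
        ennreal (real n * (1 - s)) * (ennreal (L ^ Suc N) * emeasure lborel A)" .
    moreover have "ennreal (real n * (1 - s) * s ^ n) = ennreal (real n * (1 - s)) * ennreal (s ^ n)"
      using s(1,2) by (intro ennreal_mult) auto
    ultimately have "ennreal (real n * (1 - s)) * (ennreal (s ^ n) * emeasure direction_measure E) \<le>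
        ennreal (real n * (1 - s)) * (ennreal (L ^ Suc N) * emeasure lborel A)"
      by (simp only: mult.assoc)
    then have "ennreal (s ^ n) * emeasure direction_measure E \<le> ennreal (L ^ Suc N) * emeasure lborel A"
      using s n by (subst (asm) ennreal_mult_le_mult_iff) auto
    then have "ennreal c * (ennreal (s ^ n) * emeasure direction_measure E) \<le> ennreal c * (ennreal (L ^ Suc N) * emeasure lborel A)"
      by (rule mult_left_mono) simp
    moreover have "ennreal c * (ennreal (s ^ n) * emeasure direction_measure E) = emeasure direction_measure E"
      unfolding s(3) using c by (simp add: mult.assoc[symmetric] ennreal_mult[symmetric])
    ultimately show "emeasure direction_measure E \<le> ennreal c * (ennreal (L ^ Suc N) * emeasure lborel A)" by simp
  qed
  with AE show "emeasure direction_measure E \<le> ennreal (L ^ Suc N) * hausdorff N E"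
    by (meson mult_left_mono order_trans zero_le)
qed

lemma sets_discs [measurable]: "(discs :: ('a::euclidean_space \<times> 'a \<times> real) set) \<in> sets borel"
proof -
  have eq: "(discs :: ('a \<times> 'a \<times> real) set) = {z. norm (fst (snd z)) = 1} \<inter> {z. 0 < snd (snd z)}"
    by (auto simp: discs_def)
  show ?thesis
    unfolding eq
    by (intro sets.Int borel_closed borel_open closed_Collect_eq open_Collect_less continuous_intros)
qed

text \<open>Hausdorff measure cut down to the Borel sets by pushing it forward along the identity,
  so that it has the same sigma-algebra as \<open>direction_measure\<close> and the two can be
  compared as measures.\<close>

definition hausdorff_borel :: "nat \<Rightarrow> 'a::metric_space measure" where
  "hausdorff_borel k = distr (hausdorff_measure k) borel (\<lambda>x. x)"

lemma sets_hausdorff_borel [simp, measurable_cong]: "sets (hausdorff_borel k) = sets borel"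
  by (simp add: hausdorff_borel_def)

lemma measurable_id_hausdorff: "(\<lambda>x. x) \<in> measurable (hausdorff_measure k) borel"
  using sets_borel_le_hausdorff_measure[of k] by (intro measurableI) auto

lemma emeasure_hausdorff_borel_eq: "A \<in> sets borel \<Longrightarrow> emeasure (hausdorff_borel k) A = hausdorff k A"
  unfolding hausdorff_borel_def
  by (simp add: emeasure_distr measurable_id_hausdorff emeasure_hausdorff_borel)

lemma nn_integral_hausdorff_borel:
  assumes "f \<in> borel_measurable borel"
  shows "(\<integral>\<^sup>+x. f x \<partial>hausdorff_measure k) = (\<integral>\<^sup>+x. f x \<partial>hausdorff_borel k)"
  unfolding hausdorff_borel_def using assms by (subst nn_integral_distr) (auto intro: measurable_id_hausdorff)

lemma hausdorff_eq_direction_measure: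
  fixes E :: "('a::euclidean_space \<times> 'a \<times> real) set"
  assumes E: "E \<in> sets borel" and D: "E \<subseteq> discs"
  shows "hausdorff (2 * DIM('a)) E = emeasure direction_measure E"
proof -
  let ?N = "2 * DIM('a)"
  have sets: "sets (hausdorff_borel ?N) = sets (direction_measure :: ('a \<times> 'a \<times> real) measure)"
    by (simp add: direction_measure_def)
  have loc: "\<exists>U :: nat \<Rightarrow> ('a \<times> 'a \<times> real) set. range U \<subseteq> sets borel \<and> E \<subseteq> (\<Union>i. U i) \<and>
    (\<forall>i. \<forall>F\<in>sets borel. F \<subseteq> E \<inter> U i \<longrightarrow>
      hausdorff ?N F \<le> ennreal c * emeasure direction_measure F \<and> emeasure direction_measure F \<le> ennreal c * hausdorff ?N F)"
    if c: "c > 1" for c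
  proof -
    \<comment> \<open>The root makes both distortion factors L^N and L^(N+1) at most
      \<open>c\<close>; \<open>\<kappa>\<close> is then the size of a cap on which the chart is
      distorted by at most \<open>L\<close>.\<close>
    define L where "L = root (Suc ?N) c"
    have L: "L > 1" "L ^ Suc ?N = c"
      using c real_root_pow_pos2[of "Suc ?N" c] by (auto simp: L_def simp del: power_Suc)
    have L2: "L\<^sup>2 > 1" using L(1) by simp
    define \<kappa> where "\<kappa> = sqrt (1 - inverse (L\<^sup>2))"
    have inv: "0 < inverse (L\<^sup>2)" "inverse (L\<^sup>2) < 1" using L2 by (auto simp: inverse_less_1_iff)
    then have \<kappa>: "0 < \<kappa>" "\<kappa> \<le> 1" "L\<^sup>2 * (1 - \<kappa>\<^sup>2) = 1" using L(1) by (auto simp: \<kappa>_def)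
    have "sphere (0::'a) 1 \<subseteq> (\<Union>e\<in>sphere 0 1. ball e \<kappa>)" using \<kappa>(1) by auto
    then obtain T where T: "T \<subseteq> sphere (0::'a) 1" "finite T" "sphere (0::'a) 1 \<subseteq> (\<Union>e\<in>T. ball e \<kappa>)"
      by (rule compactE_image[OF compact_sphere open_ball])
    have "sphere (0::'a) 1 \<noteq> {}" by simp
    then have Tne: "T \<noteq> {}" using T(3) by blast
    have T1: "norm (from_nat_into T i) = 1" for i
      using from_nat_into[OF Tne, of i] T(1) by auto
    define U where "U i = {z :: 'a \<times> 'a \<times> real. norm (fst (snd z) - from_nat_into T i) < \<kappa>}" for i
    show ?thesis
    proof (intro exI[of _ U] conjI allI ballI impI)
      have "U i \<in> sets borel" for i
        unfolding U_def by (intro borel_open open_Collect_less continuous_intros)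
      then show "range U \<subseteq> sets borel" by auto
      show "E \<subseteq> (\<Union>i. U i)"
      proof
        fix z assume "z \<in> E"
        then have "fst (snd z) \<in> sphere 0 1" using D by (auto simp: discs_def)
        then obtain e where e: "e \<in> T" "fst (snd z) \<in> ball e \<kappa>" using T(3) by blast
        have "range (from_nat_into T) = T" using range_from_nat_into[OF Tne] T(2) by (simp add: countable_finite)
        then obtain i where "from_nat_into T i = e" using e(1) by (metis imageE)
        then have "z \<in> U i" using e(2) by (simp add: U_def dist_norm norm_minus_commute)
        then show "z \<in> (\<Union>i. U i)" by blast
      qed
      fix i and F :: "('a \<times> 'a \<times> real) set"
      assume F: "F \<in> sets borel" "F \<subseteq> E \<inter> U i"
      then have cap: "F \<subseteq> cap (from_nat_into T i) \<kappa>"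
        using D by (auto simp: cap_def U_def discs_def)
      note est = cap_estimates[OF T1 F(1) cap \<kappa>(1,2) less_imp_le[OF L(1)] \<kappa>(3)]
      have "L ^ ?N \<le> c" using L power_increasing[of ?N "Suc ?N" L] by simp
      then have "ennreal (L ^ ?N) * emeasure direction_measure F \<le> ennreal c * emeasure direction_measure F"
        by (intro mult_right_mono ennreal_leI) auto
      with est(1) show "hausdorff ?N F \<le> ennreal c * emeasure direction_measure F" by (rule order_trans)
      show "emeasure direction_measure F \<le> ennreal c * hausdorff ?N F"
        using est(2) unfolding L(2) .
    qed
  qed
  have sets': "sets (direction_measure :: ('a \<times> 'a \<times> real) measure) = sets borel"
    by (simp add: direction_measure_def)
  have "emeasure (hausdorff_borel ?N) E \<le> emeasure direction_measure E"
  proof (rule emeasure_le_of_local)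
    fix c :: real assume "c > 1"
    from loc[OF this] obtain U :: "nat \<Rightarrow> ('a \<times> 'a \<times> real) set" where U: "range U \<subseteq> sets borel" "E \<subseteq> (\<Union>i. U i)"
      "\<forall>i. \<forall>F\<in>sets borel. F \<subseteq> E \<inter> U i \<longrightarrow>
      hausdorff ?N F \<le> ennreal c * emeasure direction_measure F \<and> emeasure direction_measure F \<le> ennreal c * hausdorff ?N F"
      by (elim exE conjE) (rule that)
    show "\<exists>U. range U \<subseteq> sets direction_measure \<and> E \<subseteq> (\<Union>i::nat. U i) \<and> (\<forall>i. \<forall>F\<in>sets direction_measure.
      F \<subseteq> E \<inter> U i \<longrightarrow> emeasure (hausdorff_borel ?N) F \<le> ennreal c * emeasure direction_measure F)"
      unfolding sets'
      by (rule exI[of _ U], intro conjI U(1,2) allI ballI impI)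
         (subst emeasure_hausdorff_borel_eq, assumption, rule U(3)[rule_format, THEN conjunct1])
  qed (use E sets sets' in auto)
  moreover have "emeasure direction_measure E \<le> emeasure (hausdorff_borel ?N) E"
  proof (rule emeasure_le_of_local)
    fix c :: real assume "c > 1"
    from loc[OF this] obtain U :: "nat \<Rightarrow> ('a \<times> 'a \<times> real) set" where U: "range U \<subseteq> sets borel" "E \<subseteq> (\<Union>i. U i)"
      "\<forall>i. \<forall>F\<in>sets borel. F \<subseteq> E \<inter> U i \<longrightarrow>
      hausdorff ?N F \<le> ennreal c * emeasure direction_measure F \<and> emeasure direction_measure F \<le> ennreal c * hausdorff ?N F"
      by (elim exE conjE) (rule that)
    show "\<exists>U. range U \<subseteq> sets (hausdorff_borel ?N) \<and> E \<subseteq> (\<Union>i::nat. U i) \<and> (\<forall>i. \<forall>F\<in>sets (hausdorff_borel ?N).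
      F \<subseteq> E \<inter> U i \<longrightarrow> emeasure direction_measure F \<le> ennreal c * emeasure (hausdorff_borel ?N) F)"
      unfolding sets_hausdorff_borel
      by (rule exI[of _ U], intro conjI U(1,2) allI ballI impI)
         (subst emeasure_hausdorff_borel_eq, assumption, rule U(3)[rule_format, THEN conjunct2])
  qed (use E sets sets' in auto)
  ultimately show ?thesis
    using emeasure_hausdorff_borel_eq[OF E, of ?N] by simp
qed

theorem nn_integral_hausdorff_discs:
  fixes f :: "'a::euclidean_space \<times> 'a \<times> real \<Rightarrow> ennreal"
  assumes f [measurable]: "f \<in> borel_measurable borel" and f0: "\<And>z. z \<notin> discs \<Longrightarrow> f z = 0"
  shows "(\<integral>\<^sup>+z. f z \<partial>hausdorff_measure (2 * DIM('a))) =
    ennreal (real DIM('a)) *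
      (\<integral>\<^sup>+r. \<integral>\<^sup>+x. \<integral>\<^sup>+p. f (p, x /\<^sub>R norm x, r) * indicator (cball 0 1) x \<partial>lborel \<partial>lborel \<partial>lborel)"
proof -
  let ?N = "2 * DIM('a)"
  have f_eq: "f z = indicator discs z * f z" for z using f0[of z] by (simp add: indicator_def)
  have sets': "sets (direction_measure :: ('a \<times> 'a \<times> real) measure) = sets borel"
    by (simp add: direction_measure_def)
  \<comment> \<open>The two measures are known to agree only inside \<open>discs\<close>; weighting
    both with its indicator gives an identity of measures.\<close>
  have eq: "density (hausdorff_borel ?N) (indicator discs) = density (direction_measure :: ('a \<times> 'a \<times> real) measure) (indicator discs)"
  proof (rule measure_eqI)
    fix A :: "('a \<times> 'a \<times> real) set" assume "A \<in> sets (density (hausdorff_borel ?N) (indicator discs))"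
    then have A: "A \<in> sets borel" by simp
    then have AD: "discs \<inter> A \<in> sets borel" by auto
    have "emeasure (density (hausdorff_borel ?N) (indicator discs)) A = emeasure (hausdorff_borel ?N) (discs \<inter> A)"
      using A by (subst emeasure_restricted) auto
    also have "\<dots> = emeasure direction_measure (discs \<inter> A)"
      using AD by (simp add: emeasure_hausdorff_borel_eq hausdorff_eq_direction_measure)
    also have "\<dots> = emeasure (density direction_measure (indicator discs)) A"
      using A sets' by (subst emeasure_restricted) auto
    finally show "emeasure (density (hausdorff_borel ?N) (indicator discs)) A = emeasure (density direction_measure (indicator discs)) A" .
  qed (simp add: sets')
  have m: "f \<in> borel_measurable (hausdorff_borel ?N)" "f \<in> borel_measurable direction_measure"
    "indicator discs \<in> borel_measurable (hausdorff_borel ?N :: ('a \<times> 'a \<times> real) measure)"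
    "indicator discs \<in> borel_measurable (direction_measure :: ('a \<times> 'a \<times> real) measure)"
    using f sets' by (auto simp: measurable_def)
  have "(\<integral>\<^sup>+z. f z \<partial>hausdorff_measure ?N) = (\<integral>\<^sup>+z. indicator discs z * f z \<partial>hausdorff_borel ?N)"
    unfolding f_eq[symmetric] by (rule nn_integral_hausdorff_borel[OF f])
  also have "\<dots> = (\<integral>\<^sup>+z. f z \<partial>density (hausdorff_borel ?N) (indicator discs))"
    by (rule nn_integral_density[OF m(3,1), symmetric])
  also have "\<dots> = (\<integral>\<^sup>+z. f z \<partial>density direction_measure (indicator discs))"
    unfolding eq ..
  also have "\<dots> = (\<integral>\<^sup>+z. indicator discs z * f z \<partial>direction_measure)"
    by (rule nn_integral_density[OF m(4,2)])
  also have "\<dots> = (\<integral>\<^sup>+z. f z \<partial>direction_measure)"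
    unfolding f_eq[symmetric] ..
  also have "\<dots> = ennreal (real DIM('a)) * (\<integral>\<^sup>+z. f (direction_map z) * indicator (cball 0 1) (fst (snd z)) \<partial>lborel)"
    by (rule nn_integral_direction_measure[OF f])
  also have "(\<integral>\<^sup>+z. f (direction_map z) * indicator (cball 0 1) (fst (snd z)) \<partial>lborel) =
    (\<integral>\<^sup>+r. \<integral>\<^sup>+x. \<integral>\<^sup>+p. f (direction_map (p, x, r)) * indicator (cball 0 1) (fst (snd (p, x, r))) \<partial>lborel \<partial>lborel \<partial>lborel)"
    by (rule nn_integral_triple) measurable
  finally show ?thesis by (simp only: direction_map_def prod.case fst_conv snd_conv)
qed

section \<open>Curves: tangent approximation and partition into small connected pieces\<close>

text \<open>Continuity of the inverse chart: a point of \<open>M\<close> close to \<open>z\<close>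
  has a small parameter, so no other strand of \<open>M\<close> comes near \<open>z\<close>.\<close>

lemma C1_chart_local:
  assumes chart: "C1_chart I \<gamma> M z" and I: "I = {-\<eta><..<\<eta>} \<or> I = {0..<\<eta>}" and \<eta>: "\<eta> > 0" and \<rho>: "\<rho> > 0"
  obtains W where "open W" "z \<in> W" "\<And>w. w \<in> M \<inter> W \<Longrightarrow> \<exists>a\<in>I. \<bar>a\<bar> < \<rho> \<and> \<gamma> a = w"
proof -
  have 0: "0 \<in> I" using I \<eta> by auto
  from chart obtain U g where U: "open U" "z \<in> U" and hom: "homeomorphism I (M \<inter> U) \<gamma> g" and z: "\<gamma> 0 = z"
    unfolding C1_chart_def by blast
  have g: "continuous_on (M \<inter> U) g" "\<And>a. a \<in> I \<Longrightarrow> g (\<gamma> a) = a" "\<And>w. w \<in> M \<inter> U \<Longrightarrow> \<gamma> (g w) = w"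
    "g ` (M \<inter> U) = I" "\<gamma> ` I = M \<inter> U"
    using hom by (auto simp: homeomorphism_def)
  have zM: "z \<in> M \<inter> U" using g(5) 0 z by blast
  have gz: "g z = 0" using g(2)[OF 0] z by simp
  from g(1)[unfolded continuous_on_iff, rule_format, OF zM \<rho>]
  obtain d where d: "d > 0" "\<And>w. w \<in> M \<inter> U \<Longrightarrow> dist w z < d \<Longrightarrow> dist (g w) (g z) < \<rho>"
    by blast
  show ?thesis
  proof (rule that)
    show "open (U \<inter> ball z d)" "z \<in> U \<inter> ball z d" using U d(1) by auto
    fix w assume w: "w \<in> M \<inter> (U \<inter> ball z d)"
    then have "\<bar>g w\<bar> < \<rho>" using d(2)[of w] gz by (auto simp: dist_commute dist_real_def)
    moreover have "g w \<in> I" using g(4) w by blast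
    ultimately show "\<exists>a\<in>I. \<bar>a\<bar> < \<rho> \<and> \<gamma> a = w" using g(3)[of w] w by auto
  qed
qed

text \<open>Up to sign and a relative error \<epsilon>, the chord from \<open>z\<close> to
  \<open>w\<close> has the components of a multiple of \<open>t y\<close>. Absolute values are used
  because the velocity of a chart may point along \<open>t\<close> or against it.\<close>

definition tangent_approx :: "real \<Rightarrow> ('a::euclidean_space \<Rightarrow> 'a) \<Rightarrow> 'a \<Rightarrow> 'a \<Rightarrow> 'a \<Rightarrow> bool" where
  "tangent_approx \<epsilon> t y z w \<longleftrightarrow>
    (\<forall>u. norm u = 1 \<longrightarrow> \<bar>\<bar>(w - z) \<bullet> u\<bar> - norm (w - z) * \<bar>t y \<bullet> u\<bar>\<bar> \<le> \<epsilon> * norm (w - z))"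

text \<open>Replacing \<open>v\<close> by s D0 changes \<bar>v \<bullet> u\<bar> and norm v by at
  most \<epsilon>' \<bar>s\<bar> each. Since \<epsilon>' \<le> norm D0 / 2, also norm v \<ge>
  \<bar>s\<bar> norm D0 / 2, which makes the error relative to norm v.\<close>

lemma tangent_approx_of_linearization:
  fixes v D0 u :: "'a::euclidean_space"
  assumes v: "norm (v - s *\<^sub>R D0) \<le> \<epsilon>' * \<bar>s\<bar>" and u: "norm u = 1" and D0: "norm D0 > 0"
    and \<epsilon>': "\<epsilon>' \<le> norm D0 / 2" "\<epsilon>' \<le> \<epsilon> * norm D0 / 4" and \<tau>: "\<tau> = \<bar>D0 \<bullet> u\<bar> / norm D0" and "0 \<le> \<epsilon>"
  shows "\<bar>\<bar>v \<bullet> u\<bar> - norm v * \<tau>\<bar> \<le> \<epsilon> * norm v"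
proof -
  have \<tau>1: "0 \<le> \<tau>" "\<tau> \<le> 1" using Cauchy_Schwarz_ineq2[of D0 u] u D0 by (auto simp: \<tau>)
  have "\<bar>(v - s *\<^sub>R D0) \<bullet> u\<bar> \<le> norm (v - s *\<^sub>R D0) * norm u" by (rule Cauchy_Schwarz_ineq2)
  then have "\<bar>(v - s *\<^sub>R D0) \<bullet> u\<bar> \<le> \<epsilon>' * \<bar>s\<bar>" using v u by simp
  then have "\<bar>\<bar>v \<bullet> u\<bar> - \<bar>s * (D0 \<bullet> u)\<bar>\<bar> \<le> \<epsilon>' * \<bar>s\<bar>" by (simp add: inner_diff_left)
  then have 1: "\<bar>\<bar>v \<bullet> u\<bar> - \<bar>s\<bar> * norm D0 * \<tau>\<bar> \<le> \<epsilon>' * \<bar>s\<bar>" using D0 by (simp add: abs_mult \<tau>)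
  have 2: "\<bar>norm v - \<bar>s\<bar> * norm D0\<bar> \<le> \<epsilon>' * \<bar>s\<bar>"
    using v norm_triangle_ineq3[of v "s *\<^sub>R D0"] by simp
  then have "\<bar>norm v - \<bar>s\<bar> * norm D0\<bar> * \<tau> \<le> \<epsilon>' * \<bar>s\<bar> * 1" using \<tau>1 by (intro mult_mono) auto
  moreover have "\<bar>norm v - \<bar>s\<bar> * norm D0\<bar> * \<tau> = \<bar>norm v * \<tau> - \<bar>s\<bar> * norm D0 * \<tau>\<bar>"
    using \<tau>1 by (simp add: abs_mult left_diff_distrib[symmetric])
  ultimately have "\<bar>\<bar>v \<bullet> u\<bar> - norm v * \<tau>\<bar> \<le> 2 * \<epsilon>' * \<bar>s\<bar>" using 1 by linarith
  also have "\<dots> \<le> 2 * (\<epsilon> * norm D0 / 4) * \<bar>s\<bar>" using \<epsilon>' by (intro mult_right_mono mult_left_mono) auto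
  also have "\<dots> = \<epsilon> * (\<bar>s\<bar> * norm D0 / 2)" by simp
  also have "\<dots> \<le> \<epsilon> * norm v"
  proof (rule mult_left_mono)
    have "\<epsilon>' * \<bar>s\<bar> \<le> norm D0 / 2 * \<bar>s\<bar>" using \<epsilon>' by (intro mult_right_mono) auto
    with 2 show "\<bar>s\<bar> * norm D0 / 2 \<le> norm v" by (simp add: mult.commute)
    show "0 \<le> \<epsilon>" by fact
  qed
  finally show ?thesis .
qed

lemma tangent_approx_local:
  fixes M :: "'a::euclidean_space set"
  assumes cont: "continuous_on M t" and z0: "z0 \<in> M" "norm (t z0) = 1" "t z0 \<in> tangent_line M z0" and \<epsilon>: "\<epsilon> > 0"
  obtains W where "open W" "z0 \<in> W" "\<And>y z w. y \<in> M \<inter> W \<Longrightarrow> z \<in> M \<inter> W \<Longrightarrow> w \<in> M \<inter> W \<Longrightarrow> tangent_approx \<epsilon> t y z w"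
proof -
  from z0(3) obtain c \<gamma> where t0: "t z0 = c *\<^sub>R vector_derivative \<gamma> (at 0)"
      "interior_chart \<gamma> M z0 \<or> boundary_chart \<gamma> M z0"
    unfolding tangent_line_def by blast
  then obtain \<eta> I where \<eta>: "\<eta> > 0" and I: "I = {-\<eta><..<\<eta>} \<or> I = {0..<\<eta>}" and chart: "C1_chart I \<gamma> M z0"
    unfolding interior_chart_def boundary_chart_def by blast
  have 0: "0 \<in> I" using I \<eta> by auto
  from chart obtain D where D: "\<And>s. s \<in> I \<Longrightarrow> (\<gamma> has_vector_derivative D s) (at s)" "continuous_on I D"
    unfolding C1_chart_def C1_differentiable_on_def by blast
  have D0: "vector_derivative \<gamma> (at 0) = D 0" using D(1)[OF 0] by (rule vector_derivative_at)
  moreover have "vector_derivative \<gamma> (at 0) \<noteq> 0" using chart 0 unfolding C1_chart_def by blast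
  ultimately have nD: "norm (D 0) > 0" by simp
  have "\<bar>c\<bar> * norm (D 0) = 1" using z0(2) t0(1) D0 by simp
  then have c: "\<bar>c\<bar> = 1 / norm (D 0)" using nD by (simp add: field_simps)
  \<comment> \<open>The first bound keeps the chord long enough, the second leaves an error
    \<epsilon> / 2; the other half is spent on the variation of \<open>t\<close> between
    \<open>z0\<close> and \<open>y\<close>.\<close>
  define \<epsilon>' where "\<epsilon>' = min (norm (D 0) / 2) (\<epsilon> / 2 * norm (D 0) / 4)"
  have \<epsilon>': "\<epsilon>' > 0" using nD \<epsilon> by (simp add: \<epsilon>'_def)
  from D(2)[unfolded continuous_on_iff, rule_format, OF 0 \<epsilon>']
  obtain \<rho> where \<rho>: "\<rho> > 0" "\<And>s. s \<in> I \<Longrightarrow> dist s 0 < \<rho> \<Longrightarrow> dist (D s) (D 0) < \<epsilon>'" by blast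
  obtain W where W: "open W" "z0 \<in> W" "\<And>w. w \<in> M \<inter> W \<Longrightarrow> \<exists>a\<in>I. \<bar>a\<bar> < \<rho> \<and> \<gamma> a = w"
    by (rule C1_chart_local[OF chart I \<eta> \<rho>(1)]) (rule that)
  from cont[unfolded continuous_on_iff, rule_format, OF z0(1), of "\<epsilon> / 2"] \<epsilon>
  obtain d where d: "d > 0" "\<And>z. z \<in> M \<Longrightarrow> dist z z0 < d \<Longrightarrow> dist (t z) (t z0) < \<epsilon> / 2" by auto
  show ?thesis
  proof (rule that)
    show "open (W \<inter> ball z0 d)" "z0 \<in> W \<inter> ball z0 d" using W(1,2) d(1) by auto
    fix y z w assume y: "y \<in> M \<inter> (W \<inter> ball z0 d)" and zw: "z \<in> M \<inter> (W \<inter> ball z0 d)" "w \<in> M \<inter> (W \<inter> ball z0 d)"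
    then have zW: "z \<in> M \<inter> W" and wW: "w \<in> M \<inter> W" by simp_all
    obtain a where a: "a \<in> I" "\<bar>a\<bar> < \<rho>" "\<gamma> a = z" using W(3)[OF zW] by (elim bexE conjE) (rule that)
    obtain b where b: "b \<in> I" "\<bar>b\<bar> < \<rho>" "\<gamma> b = w" using W(3)[OF wW] by (elim bexE conjE) (rule that)
    let ?S = "I \<inter> {-\<rho><..<\<rho>}"
    have lin: "norm (\<gamma> b - \<gamma> a - (b - a) *\<^sub>R D 0) \<le> norm (b - a) * \<epsilon>'"
    proof (rule vector_differentiable_bound_linearization[where S = ?S and f = \<gamma> and f' = D and ?x0.0 = 0 and a = a and b = b])
      show "(\<gamma> has_vector_derivative D x) (at x within ?S)" if "x \<in> ?S" for x
        by (rule has_vector_derivative_at_within[OF D(1)]) (use that in simp)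
      have "convex ?S" using I by (auto intro: convex_Int)
      then show "closed_segment a b \<subseteq> ?S" using a b by (intro closed_segment_subset) auto
      show "norm (D x - D 0) \<le> \<epsilon>'" if "x \<in> ?S" for x
        using \<rho>(2)[of x] that by (auto simp: dist_norm abs_less_iff)
      show "0 \<in> ?S" using 0 \<rho>(1) by simp
    qed
    show "tangent_approx \<epsilon> t y z w"
      unfolding tangent_approx_def
    proof (intro allI impI)
      fix u :: 'a assume u: "norm u = 1"
      let ?v = "w - z"
      have "\<bar>t z0 \<bullet> u\<bar> = \<bar>D 0 \<bullet> u\<bar> / norm (D 0)"
        by (simp add: t0(1) D0 abs_mult c)
      then have 1: "\<bar>\<bar>?v \<bullet> u\<bar> - norm ?v * \<bar>t z0 \<bullet> u\<bar>\<bar> \<le> \<epsilon> / 2 * norm ?v"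
        using lin a b nD u \<epsilon>
        by (intro tangent_approx_of_linearization[where s = "b - a" and ?D0.0 = "D 0" and \<epsilon>' = \<epsilon>'])
           (auto simp: \<epsilon>'_def mult.commute)
      have "\<bar>(t y - t z0) \<bullet> u\<bar> \<le> norm (t y - t z0) * norm u" by (rule Cauchy_Schwarz_ineq2)
      also have "\<dots> \<le> \<epsilon> / 2" using d(2)[of y] y u by (auto simp: dist_norm dist_commute norm_minus_commute)
      finally have "\<bar>t y \<bullet> u - t z0 \<bullet> u\<bar> \<le> \<epsilon> / 2" by (simp only: inner_diff_left)
      then have "\<bar>\<bar>t z0 \<bullet> u\<bar> - \<bar>t y \<bullet> u\<bar>\<bar> \<le> \<epsilon> / 2" by linarith
      then have "norm ?v * \<bar>\<bar>t z0 \<bullet> u\<bar> - \<bar>t y \<bullet> u\<bar>\<bar> \<le> norm ?v * (\<epsilon> / 2)" by (intro mult_left_mono) auto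
      moreover have "norm ?v * \<bar>\<bar>t z0 \<bullet> u\<bar> - \<bar>t y \<bullet> u\<bar>\<bar> = \<bar>norm ?v * \<bar>t z0 \<bullet> u\<bar> - norm ?v * \<bar>t y \<bullet> u\<bar>\<bar>"
        by (simp add: abs_mult right_diff_distrib[symmetric])
      ultimately have 2: "\<bar>norm ?v * \<bar>t z0 \<bullet> u\<bar> - norm ?v * \<bar>t y \<bullet> u\<bar>\<bar> \<le> \<epsilon> / 2 * norm ?v"
        by (simp only: mult.commute)
      have tri: "\<bar>A - Y\<bar> \<le> \<bar>A - X\<bar> + \<bar>X - Y\<bar>" for A X Y :: real by arith
      have "\<bar>\<bar>?v \<bullet> u\<bar> - norm ?v * \<bar>t y \<bullet> u\<bar>\<bar> \<le> \<epsilon> / 2 * norm ?v + \<epsilon> / 2 * norm ?v"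
        by (rule order_trans[OF tri add_mono[OF 1 2]])
      then show "\<bar>\<bar>?v \<bullet> u\<bar> - norm ?v * \<bar>t y \<bullet> u\<bar>\<bar> \<le> \<epsilon> * norm ?v" by simp
    qed
  qed
qed

text \<open>Lebesgue number of the cover by the neighbourhoods of
  \<open>tangent_approx_local\<close>. The chord estimate thus holds for all points of
  \<open>M\<close> that are close in space, not only along one arc; uniqueness of crossings rests on
  this.\<close>

lemma uniform_tangent_approx:
  fixes M :: "'a::euclidean_space set"
  assumes M: "compact M" and t: "curve_orientation M t" and \<epsilon>: "\<epsilon> > 0"
  obtains \<delta> where "\<delta> > 0" "\<And>y z w. y \<in> M \<Longrightarrow> z \<in> M \<Longrightarrow> w \<in> M \<Longrightarrow> dist y z < \<delta> \<Longrightarrow> dist y w < \<delta> \<Longrightarrow> tangent_approx \<epsilon> t y z w"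
proof -
  define \<G> where "\<G> = {W. open W \<and> (\<forall>y\<in>M \<inter> W. \<forall>z\<in>M \<inter> W. \<forall>w\<in>M \<inter> W. tangent_approx \<epsilon> t y z w)}"
  have "M \<subseteq> \<Union>\<G>"
  proof
    fix z0 assume z0: "z0 \<in> M"
    then have "continuous_on M t" "norm (t z0) = 1" "t z0 \<in> tangent_line M z0"
      using t by (auto simp: curve_orientation_def)
    note TL = tangent_approx_local[OF this(1) z0 this(2,3) \<epsilon>]
    obtain W where
      "open W" "z0 \<in> W" "\<And>y z w. y \<in> M \<inter> W \<Longrightarrow> z \<in> M \<inter> W \<Longrightarrow> w \<in> M \<inter> W \<Longrightarrow> tangent_approx \<epsilon> t y z w"
      by (rule TL) (rule that)
    then show "z0 \<in> \<Union>\<G>" by (auto simp: \<G>_def)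
  qed
  moreover have "\<And>G. G \<in> \<G> \<Longrightarrow> open G" by (simp add: \<G>_def)
  note HB = Heine_Borel_lemma[OF M calculation this]
  obtain \<delta> where \<delta>: "\<delta> > 0" "\<And>z. z \<in> M \<Longrightarrow> \<exists>G\<in>\<G>. ball z \<delta> \<subseteq> G"
    by (rule HB) (assumption | rule that)+
  show ?thesis
  proof (rule that[OF \<delta>(1)])
    fix y z w assume zw: "y \<in> M" "z \<in> M" "w \<in> M" "dist y z < \<delta>" "dist y w < \<delta>"
    obtain G where G: "G \<in> \<G>" "ball y \<delta> \<subseteq> G" using \<delta>(2)[OF zw(1)] by blast
    have "y \<in> M \<inter> G" "z \<in> M \<inter> G" "w \<in> M \<inter> G" using zw G(2) \<delta>(1) by auto
    then show "tangent_approx \<epsilon> t y z w" using G(1) by (auto simp: \<G>_def)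
  qed
qed

section \<open>Partition of the curve into short connected pieces\<close>

lemma small_arc:
  fixes M :: "'a::euclidean_space set"
  assumes M: "C1_curve_with_boundary M" and z: "z \<in> M" and \<delta>: "\<delta> > 0"
  obtains W \<gamma> a b where "open W" "z \<in> W" "M \<inter> W \<subseteq> \<gamma> ` {a..b::real}" "\<gamma> ` {a..b} \<subseteq> M"
    "continuous_on {a..b} \<gamma>" "inj_on \<gamma> {a..b}" "\<And>s s'. s \<in> {a..b} \<Longrightarrow> s' \<in> {a..b} \<Longrightarrow> dist (\<gamma> s) (\<gamma> s') \<le> \<delta>"
proof -
  from M z obtain \<gamma> where "interior_chart \<gamma> M z \<or> boundary_chart \<gamma> M z"
    unfolding C1_curve_with_boundary_def by blast
  then obtain \<eta> I where \<eta>: "\<eta> > 0" and I: "I = {-\<eta><..<\<eta>} \<or> I = {0..<\<eta>}" and chart: "C1_chart I \<gamma> M z"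
    unfolding interior_chart_def boundary_chart_def by blast
  have 0: "0 \<in> I" using I \<eta> by auto
  from chart obtain U g where hom: "homeomorphism I (M \<inter> U) \<gamma> g" and z0: "\<gamma> 0 = z"
    unfolding C1_chart_def by blast
  then have cont: "continuous_on I \<gamma>" and img: "\<gamma> ` I = M \<inter> U" and inj: "inj_on \<gamma> I"
    by (auto simp: homeomorphism_def intro: inj_on_inverseI)
  have "\<delta> / 2 > 0" using \<delta> by simp
  from cont[unfolded continuous_on_iff, rule_format, OF 0 this]
  obtain \<rho>' where \<rho>': "\<rho>' > 0" "\<And>s. s \<in> I \<Longrightarrow> dist s 0 < \<rho>' \<Longrightarrow> dist (\<gamma> s) (\<gamma> 0) < \<delta> / 2" by blast
  define \<rho> where "\<rho> = min (\<rho>' / 2) (\<eta> / 2)"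
  have \<rho>: "\<rho> > 0" "\<rho> < \<rho>'" "\<rho> < \<eta>" using \<rho>' \<eta> by (auto simp: \<rho>_def)
  obtain W where W: "open W" "z \<in> W" "\<And>w. w \<in> M \<inter> W \<Longrightarrow> \<exists>a\<in>I. \<bar>a\<bar> < \<rho> \<and> \<gamma> a = w"
    by (rule C1_chart_local[OF chart I \<eta> \<rho>(1)]) (rule that)
  \<comment> \<open>The left end is - \<rho> in an interior chart and 0 in a boundary chart; a
    closed interval is wanted, so that the arc is compact.\<close>
  have "\<exists>a. {a..\<rho>} \<subseteq> I \<and> (\<forall>s\<in>{a..\<rho>}. \<bar>s\<bar> \<le> \<rho>) \<and> (\<forall>s\<in>I. \<bar>s\<bar> < \<rho> \<longrightarrow> s \<in> {a..\<rho>})"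
    using I
  proof
    assume "I = {-\<eta><..<\<eta>}"
    then show ?thesis using \<rho> by (intro exI[of _ "-\<rho>"]) auto
  next
    assume "I = {0..<\<eta>}"
    then show ?thesis using \<rho> by (intro exI[of _ 0]) auto
  qed
  then obtain a where sub: "{a..\<rho>} \<subseteq> I" "\<forall>s\<in>{a..\<rho>}. \<bar>s\<bar> \<le> \<rho>" and sup: "\<forall>s\<in>I. \<bar>s\<bar> < \<rho> \<longrightarrow> s \<in> {a..\<rho>}"
    by (elim exE conjE) (rule that)
  show ?thesis
  proof (rule that[OF W(1,2)])
    show "M \<inter> W \<subseteq> \<gamma> ` {a..\<rho>}"
    proof
      fix w assume "w \<in> M \<inter> W"
      from W(3)[OF this] obtain s where "s \<in> I" "\<bar>s\<bar> < \<rho>" "\<gamma> s = w" by (elim bexE conjE) (rule that)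
      then show "w \<in> \<gamma> ` {a..\<rho>}" using sup by blast
    qed
    show "\<gamma> ` {a..\<rho>} \<subseteq> M" using img sub(1) by blast
    show "continuous_on {a..\<rho>} \<gamma>" using cont sub(1) by (rule continuous_on_subset)
    show "inj_on \<gamma> {a..\<rho>}" using inj sub(1) by (rule inj_on_subset)
    have half: "dist (\<gamma> s) z \<le> \<delta> / 2" if "s \<in> {a..\<rho>}" for s
    proof -
      have "dist s 0 < \<rho>'" using sub(2)[rule_format, OF that] \<rho>(2) by (simp add: dist_real_def)
      then show ?thesis using \<rho>'(2)[of s] sub(1) that z0 by auto
    qed
    show "dist (\<gamma> s) (\<gamma> s') \<le> \<delta>" if "s \<in> {a..\<rho>}" "s' \<in> {a..\<rho>}" for s s'
      using half[OF that(1)] half[OF that(2)] dist_triangle2[of "\<gamma> s" "\<gamma> s'" z] by simp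
  qed
qed

text \<open>The parameters mapped outside \<open>Q\<close>, together with the complement of [a, b],
  form an open set of reals. Its components are countably many intervals, which remain intervals
  when cut down to [a, b].\<close>

lemma arc_minus_closed_pieces:
  fixes \<gamma> :: "real \<Rightarrow> 'a::euclidean_space"
  assumes cont: "continuous_on {a..b} \<gamma>" and inj: "inj_on \<gamma> {a..b}" and Q: "closed Q"
  obtains \<P> where "countable \<P>" "\<Union>\<P> = \<gamma> ` {a..b} - Q" "pairwise disjnt \<P>" "\<And>P. P \<in> \<P> \<Longrightarrow> connected P"
proof -
  have "closed ({a..b} \<inter> \<gamma> -` Q)" using cont Q by (intro continuous_closed_preimage) auto
  define V where "V = - ({a..b} \<inter> \<gamma> -` Q)"
  have "open V" unfolding V_def using \<open>closed ({a..b} \<inter> \<gamma> -` Q)\<close> by (rule open_Compl)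
  have disj: "pairwise disjnt (components V)" using pairwise_disjoint_components[of V] by (simp add: disjnt_def pairwise_def)
  show ?thesis
  proof (rule that[of "(\<lambda>c. \<gamma> ` (c \<inter> {a..b})) ` components V"])
    have "countable (components V)"
      by (rule countable_disjoint_open_subsets) (use \<open>open V\<close> disj in \<open>auto intro: open_components\<close>)
    then show "countable ((\<lambda>c. \<gamma> ` (c \<inter> {a..b})) ` components V)" by simp
    have "\<Union>((\<lambda>c. \<gamma> ` (c \<inter> {a..b})) ` components V) = \<gamma> ` (\<Union>(components V) \<inter> {a..b})" by blast
    also have "\<dots> = \<gamma> ` {a..b} - Q" unfolding Union_components by (auto simp: V_def)
    finally show "\<Union>((\<lambda>c. \<gamma> ` (c \<inter> {a..b})) ` components V) = \<gamma> ` {a..b} - Q" .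
    show "pairwise disjnt ((\<lambda>c. \<gamma> ` (c \<inter> {a..b})) ` components V)"
    proof (rule pairwiseI)
      fix P P' assume P: "P \<in> (\<lambda>c. \<gamma> ` (c \<inter> {a..b})) ` components V" "P' \<in> (\<lambda>c. \<gamma> ` (c \<inter> {a..b})) ` components V" "P \<noteq> P'"
      then obtain c c' where c: "c \<in> components V" "c' \<in> components V" "P = \<gamma> ` (c \<inter> {a..b})" "P' = \<gamma> ` (c' \<inter> {a..b})" by blast
      then have "c \<noteq> c'" using P(3) by blast
      then have "c \<inter> c' = {}" using disj c(1,2) by (auto simp: pairwise_def disjnt_def)
      moreover have "\<gamma> ` (c \<inter> {a..b}) \<inter> \<gamma> ` (c' \<inter> {a..b}) = \<gamma> ` ((c \<inter> {a..b}) \<inter> (c' \<inter> {a..b}))"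
        by (rule inj_on_image_Int[OF inj, symmetric]) auto
      ultimately have "\<gamma> ` (c \<inter> {a..b}) \<inter> \<gamma> ` (c' \<inter> {a..b}) = {}" by (metis image_empty inf_assoc inf_left_commute inf_bot_left)
      then show "disjnt P P'" using c by (simp add: disjnt_def)
    qed
    fix P assume "P \<in> (\<lambda>c. \<gamma> ` (c \<inter> {a..b})) ` components V"
    then obtain c where c: "c \<in> components V" "P = \<gamma> ` (c \<inter> {a..b})" by blast
    have "is_interval c" using c(1) by (simp add: in_components_connected is_interval_connected_1)
    then have "connected (c \<inter> {a..b})"
      by (simp add: is_interval_Int is_interval_cc is_interval_connected)
    then show "connected P" unfolding c(2) using cont by (intro connected_continuous_image) (auto intro: continuous_on_subset)
  qed
qed

lemma countable_disjoint_enumeration: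
  assumes "countable \<P>" "pairwise disjnt \<P>"
  obtains B :: "nat \<Rightarrow> 'b set" where "disjoint_family B" "(\<Union>i. B i) = \<Union>\<P>" "\<And>i. B i = {} \<or> B i \<in> \<P>"
proof -
  define B where "B i = (if i \<in> to_nat_on \<P> ` \<P> then from_nat_into \<P> i else {})" for i
  show ?thesis
  proof (rule that)
    show "\<And>i. B i = {} \<or> B i \<in> \<P>" using assms(1) by (auto simp: B_def)
    show "(\<Union>i. B i) = \<Union>\<P>"
    proof (intro equalityI subsetI)
      fix x assume "x \<in> \<Union>\<P>"
      then obtain P where P: "P \<in> \<P>" "x \<in> P" by blast
      then have "x \<in> B (to_nat_on \<P> P)" using assms(1) by (simp add: B_def)
      then show "x \<in> (\<Union>i. B i)" by blast
    qed (use assms(1) in \<open>auto simp: B_def split: if_splits\<close>)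
    show "disjoint_family B"
      unfolding disjoint_family_on_def
    proof (intro ballI impI)
      fix i j :: nat assume "i \<noteq> j"
      show "B i \<inter> B j = {}"
      proof (cases "i \<in> to_nat_on \<P> ` \<P> \<and> j \<in> to_nat_on \<P> ` \<P>")
        case True
        then obtain P P' where P: "P \<in> \<P>" "P' \<in> \<P>" "i = to_nat_on \<P> P" "j = to_nat_on \<P> P'" by blast
        then have "P \<noteq> P'" using \<open>i \<noteq> j\<close> by blast
        then have "P \<inter> P' = {}" using assms(2) P(1,2) by (auto simp: pairwise_def disjnt_def)
        then show ?thesis using P assms(1) by (simp add: B_def)
      qed (auto simp: B_def)
    qed
  qed
qed

text \<open>Compactness gives finitely many compact arcs, which may overlap. They are added one at a
  time, and from each the closed union of the earlier ones and of \<open>F\<close> is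
  removed.\<close>

lemma curve_partition:
  fixes M :: "'a::euclidean_space set"
  assumes M: "compact M" "C1_curve_with_boundary M" and F: "finite F" and \<delta>: "\<delta> > 0"
  obtains B :: "nat \<Rightarrow> 'a set" where "disjoint_family B" "(\<Union>i. B i) = M - F" "\<And>i. connected (B i)"
    "\<And>i x y. x \<in> B i \<Longrightarrow> y \<in> B i \<Longrightarrow> dist x y \<le> \<delta>"
proof -
  have "\<exists>W \<gamma> a b. open W \<and> z \<in> W \<and> M \<inter> W \<subseteq> \<gamma> ` {a..b::real} \<and> \<gamma> ` {a..b} \<subseteq> M \<and>
    continuous_on {a..b} \<gamma> \<and> inj_on \<gamma> {a..b} \<and> (\<forall>s\<in>{a..b}. \<forall>s'\<in>{a..b}. dist (\<gamma> s) (\<gamma> s') \<le> \<delta>)" if "z \<in> M" for z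
    by (rule small_arc[OF M(2) that \<delta>]) blast
  then obtain W \<gamma> a b where arc: "\<And>z. z \<in> M \<Longrightarrow> open (W z) \<and> z \<in> W z \<and> M \<inter> W z \<subseteq> \<gamma> z ` {a z..b z::real} \<and> \<gamma> z ` {a z..b z} \<subseteq> M \<and>
    continuous_on {a z..b z} (\<gamma> z) \<and> inj_on (\<gamma> z) {a z..b z} \<and> (\<forall>s\<in>{a z..b z}. \<forall>s'\<in>{a z..b z}. dist (\<gamma> z s) (\<gamma> z s') \<le> \<delta>)"
    by metis
  define K where "K z = \<gamma> z ` {a z..b z}" for z
  obtain T where T: "T \<subseteq> M" "finite T" "M \<subseteq> (\<Union>z\<in>T. W z)"
  proof (rule compactE_image[OF M(1), of M W])
    show "open (W z)" if "z \<in> M" for z using arc[OF that] by blast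
    show "M \<subseteq> (\<Union>z\<in>M. W z)" using arc by blast
  qed (rule that)
  have K: "M = (\<Union>z\<in>T. K z)"
  proof (intro equalityI subsetI)
    fix x assume x: "x \<in> M"
    then obtain z where z: "z \<in> T" "x \<in> W z" using T(3) by blast
    then have "M \<inter> W z \<subseteq> K z" using arc[of z] T(1) unfolding K_def by blast
    then show "x \<in> (\<Union>z\<in>T. K z)" using x z by blast
  next
    fix x assume "x \<in> (\<Union>z\<in>T. K z)"
    then obtain z where z: "z \<in> T" "x \<in> K z" by blast
    then have "K z \<subseteq> M" using arc[of z] T(1) unfolding K_def by blast
    then show "x \<in> M" using z by blast
  qed
  obtain zs where zs: "set zs = T" using T(2) finite_list by blast
  have Kcl: "closed (K z)" if "z \<in> T" for z
  proof -
    have "continuous_on {a z..b z} (\<gamma> z)" using arc[of z] T(1) that by blast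
    then show ?thesis unfolding K_def by (intro compact_imp_closed compact_continuous_image compact_Icc)
  qed
  have "\<exists>\<P>. countable \<P> \<and> \<Union>\<P> = (\<Union>z\<in>set ys. K z) - F \<and> pairwise disjnt \<P> \<and>
      (\<forall>P\<in>\<P>. connected P \<and> (\<forall>x\<in>P. \<forall>y\<in>P. dist x y \<le> \<delta>))" if "set ys \<subseteq> T" for ys
    using that
  proof (induction ys)
    case Nil
    show ?case by (rule exI[of _ "{}"]) simp
  next
    case (Cons z ys)
    then have zT: "z \<in> T" "set ys \<subseteq> T" by auto
    from Cons.IH[OF zT(2)] obtain \<P> where \<P>: "countable \<P>" "\<Union>\<P> = (\<Union>z\<in>set ys. K z) - F" "pairwise disjnt \<P>"
        "\<forall>P\<in>\<P>. connected P \<and> (\<forall>x\<in>P. \<forall>y\<in>P. dist x y \<le> \<delta>)" by (elim exE conjE) (rule that)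
    have zM: "z \<in> M" using zT T(1) by blast
    define Q where "Q = (\<Union>z\<in>set ys. K z) \<union> F"
    have "closed Q" unfolding Q_def using zT Kcl F by (intro closed_Un closed_UN finite_imp_closed) auto
    have c: "continuous_on {a z..b z} (\<gamma> z)" "inj_on (\<gamma> z) {a z..b z}" using arc[OF zM] by simp_all
    obtain \<P>' where \<P>': "countable \<P>'" "\<Union>\<P>' = \<gamma> z ` {a z..b z} - Q" "pairwise disjnt \<P>'" "\<And>P. P \<in> \<P>' \<Longrightarrow> connected P"
      by (rule arc_minus_closed_pieces[OF c \<open>closed Q\<close>]) (rule that)
    note \<P>' = \<P>'(1) \<P>'(2)[folded K_def] \<P>'(3,4)
    show ?case
    proof (intro exI[of _ "\<P> \<union> \<P>'"] conjI)
      show "countable (\<P> \<union> \<P>')" using \<P>(1) \<P>'(1) by simp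
      show "\<Union>(\<P> \<union> \<P>') = (\<Union>z\<in>set (z # ys). K z) - F"
        using \<P>(2) \<P>'(2) by (auto simp: Q_def)
      show "pairwise disjnt (\<P> \<union> \<P>')"
      proof (rule pairwiseI)
        have cross: "disjnt P P'" if "P \<in> \<P>" "P' \<in> \<P>'" for P P'
        proof -
          have "P \<subseteq> (\<Union>z\<in>set ys. K z)" "P' \<subseteq> K z - Q" using that \<P>(2) \<P>'(2) by blast+
          then show ?thesis unfolding disjnt_def Q_def by blast
        qed
        fix P P' assume "P \<in> \<P> \<union> \<P>'" "P' \<in> \<P> \<union> \<P>'" "P \<noteq> P'"
        then show "disjnt P P'"
          using cross[of P P'] cross[of P' P] \<P>(3) \<P>'(3) by (auto simp: pairwise_def disjnt_sym)
      qed
      show "\<forall>P\<in>\<P> \<union> \<P>'. connected P \<and> (\<forall>x\<in>P. \<forall>y\<in>P. dist x y \<le> \<delta>)"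
      proof
        fix P assume "P \<in> \<P> \<union> \<P>'"
        then show "connected P \<and> (\<forall>x\<in>P. \<forall>y\<in>P. dist x y \<le> \<delta>)"
        proof
          assume P: "P \<in> \<P>'"
          then have sub: "P \<subseteq> K z" using \<P>'(2) by blast
          have "dist x y \<le> \<delta>" if "x \<in> P" "y \<in> P" for x y
          proof -
            from that sub obtain s s' where "s \<in> {a z..b z}" "s' \<in> {a z..b z}" "x = \<gamma> z s" "y = \<gamma> z s'"
              unfolding K_def by blast
            then show ?thesis using arc[OF zM] by blast
          qed
          then show ?thesis using \<P>'(4)[OF P] by blast
        qed (use \<P>(4) in blast)
      qed
    qed
  qed
  note pieces = this[of zs]
  have zsT: "set zs \<subseteq> T" using zs by simp
  from pieces[OF zsT] obtain \<P> where \<P>: "countable \<P>" "\<Union>\<P> = (\<Union>z\<in>set zs. K z) - F" "pairwise disjnt \<P>"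
     "\<forall>P\<in>\<P>. connected P \<and> (\<forall>x\<in>P. \<forall>y\<in>P. dist x y \<le> \<delta>)"
    by (elim exE conjE) (rule that)
  obtain B :: "nat \<Rightarrow> 'a set" where B: "disjoint_family B" "(\<Union>i. B i) = \<Union>\<P>" "\<And>i. B i = {} \<or> B i \<in> \<P>"
    by (rule countable_disjoint_enumeration[OF \<P>(1,3)]) (rule that)
  show ?thesis
  proof (rule that[OF B(1)])
    show "(\<Union>i. B i) = M - F" using B(2) \<P>(2) K zs by simp
    show "connected (B i)" for i using B(3)[of i] \<P>(4) by auto
    show "dist x y \<le> \<delta>" if "x \<in> B i" "y \<in> B i" for i x y using B(3)[of i] \<P>(4) that by auto
  qed
qed

section \<open>Discs meeting a curve\<close>

lemma unit_perp_nonempty: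
  fixes u :: "'a::euclidean_space"
  assumes "DIM('a) \<ge> 2"
  obtains v where "v \<in> unit_perp u"
proof -
  obtain x where x: "x \<noteq> 0" "orthogonal u x"
    by (rule orthogonal_to_vector_exists[OF assms])
  have "x /\<^sub>R norm x \<in> unit_perp u"
    using x by (auto simp: unit_perp_def orthogonal_comp_def orthogonal_def inner_commute)
  then show ?thesis by (rule that)
qed

lemma unit_perp_iff: "v \<in> unit_perp u \<longleftrightarrow> norm v = 1 \<and> v \<bullet> u = 0"
  by (auto simp: unit_perp_def orthogonal_comp_def orthogonal_def inner_commute)

lemma disc_boundary_iff:
  assumes "r > 0"
  shows "x \<in> disc_boundary p u r \<longleftrightarrow> (x - p) \<bullet> u = 0 \<and> norm (x - p) = r"
proof
  assume "x \<in> disc_boundary p u r"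
  then obtain v where "v \<in> unit_perp u" "x = p + r *\<^sub>R v" by (auto simp: disc_boundary_def)
  then show "(x - p) \<bullet> u = 0 \<and> norm (x - p) = r" using assms by (auto simp: unit_perp_iff)
next
  assume x: "(x - p) \<bullet> u = 0 \<and> norm (x - p) = r"
  then have "(x - p) /\<^sub>R r \<in> unit_perp u" "x = p + r *\<^sub>R ((x - p) /\<^sub>R r)"
    using assms by (auto simp: unit_perp_iff)
  then show "x \<in> disc_boundary p u r" unfolding disc_boundary_def by blast
qed

lemma disc_iff:
  fixes u :: "'a::euclidean_space"
  assumes "r > 0" and n: "DIM('a) \<ge> 2"
  shows "x \<in> disc p u r \<longleftrightarrow> (x - p) \<bullet> u = 0 \<and> norm (x - p) < r"
proof
  assume "x \<in> disc p u r"
  then obtain v \<xi> where "v \<in> unit_perp u" "x = p + \<xi> *\<^sub>R v" "0 \<le> \<xi>" "\<xi> < r" by (auto simp: disc_def)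
  then show "(x - p) \<bullet> u = 0 \<and> norm (x - p) < r" using assms by (auto simp: unit_perp_iff)
next
  assume x: "(x - p) \<bullet> u = 0 \<and> norm (x - p) < r"
  \<comment> \<open>The centre belongs to the disc only as p + 0 v0, which requires a unit vector
    orthogonal to \<open>u\<close>.\<close>
  obtain v0 where v0: "v0 \<in> unit_perp u" by (rule unit_perp_nonempty[OF n])
  show "x \<in> disc p u r"
  proof (cases "x = p")
    case True
    then have "x = p + 0 *\<^sub>R v0" "0 \<in> {0..<r}" using assms by auto
    with v0 show ?thesis unfolding disc_def by blast
  next
    case False
    then have "(x - p) /\<^sub>R norm (x - p) \<in> unit_perp u" "x = p + norm (x - p) *\<^sub>R ((x - p) /\<^sub>R norm (x - p))" "norm (x - p) \<in> {0..<r}"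
      using x by (auto simp: unit_perp_iff)
    then show ?thesis unfolding disc_def by blast
  qed
qed

lemma closed_disc_iff:
  fixes u :: "'a::euclidean_space"
  assumes "r > 0" "DIM('a) \<ge> 2"
  shows "x \<in> closed_disc p u r \<longleftrightarrow> (x - p) \<bullet> u = 0 \<and> norm (x - p) \<le> r"
  using assms by (auto simp: closed_disc_def disc_iff disc_boundary_iff)

text \<open>Quantifying over the points of a curve is an uncountable union; compactness nevertheless
  makes the resulting set of discs closed, hence Borel.\<close>

lemma closed_compact_projection:
  fixes \<phi> :: "'a::metric_space \<times> 'b::metric_space \<Rightarrow> real"
  assumes K: "compact K" and \<phi>: "continuous_on (K \<times> UNIV) \<phi>"
  shows "closed {x. \<exists>z\<in>K. \<phi> (z, x) \<le> 0}"
  unfolding closed_sequential_limits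
proof (intro allI impI, elim conjE)
  fix x l assume x: "\<forall>n. x n \<in> {x. \<exists>z\<in>K. \<phi> (z, x) \<le> 0}" and l: "x \<longlonglongrightarrow> l"
  then obtain z where z: "\<And>n. z n \<in> K" "\<And>n. \<phi> (z n, x n) \<le> 0" by (simp, metis)
  obtain z0 s where s: "z0 \<in> K" "strict_mono (s :: nat \<Rightarrow> nat)" "(z \<circ> s) \<longlonglongrightarrow> z0"
    using K z(1) unfolding compact_def by metis
  have "(\<lambda>n. (z (s n), x (s n))) \<longlonglongrightarrow> (z0, l)"
    using s(3) LIMSEQ_subseq_LIMSEQ[OF l s(2)] by (intro tendsto_Pair) (auto simp: comp_def)
  then have "(\<lambda>n. \<phi> (z (s n), x (s n))) \<longlonglongrightarrow> \<phi> (z0, l)"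
    using \<phi> s(1) z(1) unfolding continuous_on_sequentially by (simp add: comp_def)
  then have "\<phi> (z0, l) \<le> 0"
    using z(2) by (intro LIMSEQ_le_const2) auto
  then show "l \<in> {x. \<exists>z\<in>K. \<phi> (z, x) \<le> 0}" using s(1) by blast
qed

section \<open>Upper bound for the discs that meet the curve\<close>

lemma nn_integral_weighted_discs:
  fixes S :: "('a::euclidean_space \<times> 'a \<times> real) set" and w :: "real \<Rightarrow> real"
  assumes S: "S \<in> sets borel" "S \<subseteq> discs" and [measurable]: "w \<in> borel_measurable borel"
  shows "(\<integral>\<^sup>+z. ennreal (w (snd (snd z))) * indicator S z \<partial>hausdorff_measure (2 * DIM('a))) =
    (\<integral>\<^sup>+r. ennreal (w r) * (ennreal (real DIM('a)) *
      (\<integral>\<^sup>+x. emeasure lborel {p. (p, x /\<^sub>R norm x, r) \<in> S} * indicator (cball 0 1) x \<partial>lborel)) \<partial>lborel)"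
proof -
  have [measurable]: "S \<in> sets (borel \<Otimes>\<^sub>M borel \<Otimes>\<^sub>M borel)"
    using S(1) unfolding borel_prod by assumption
  have [measurable]: "cball (0::'a) 1 \<in> sets borel" by simp
  have [measurable]: "(\<lambda>z::'a \<times> 'a \<times> real. w (snd (snd z))) \<in> borel_measurable borel"
    unfolding borel_prod[symmetric] by measurable
  have m: "(\<lambda>z::'a \<times> 'a \<times> real. ennreal (w (snd (snd z))) * indicator S z) \<in> borel_measurable borel"
    using S(1) by measurable
  let ?E = "\<lambda>x r. emeasure lborel {p. (p, x /\<^sub>R norm x, r) \<in> S}"
  have E: "?E x r = (\<integral>\<^sup>+p. indicator S (p, x /\<^sub>R norm x, r) \<partial>lborel)" for x r
  proof -
    have "(\<integral>\<^sup>+p. indicator S (p, x /\<^sub>R norm x, r) \<partial>lborel) = (\<integral>\<^sup>+p. indicator {p. (p, x /\<^sub>R norm x, r) \<in> S} p \<partial>lborel)"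
      by (intro nn_integral_cong) (auto simp: indicator_def)
    then show ?thesis by simp
  qed
  have inner: "(\<integral>\<^sup>+p. ennreal (w r) * indicator S (p, x /\<^sub>R norm x, r) * indicator (cball 0 1) x \<partial>lborel) =
      ennreal (w r) * (?E x r * indicator (cball 0 1) x)" for x r
    unfolding E by (simp add: nn_integral_multc nn_integral_cmult mult.assoc)
  have "(\<integral>\<^sup>+z. ennreal (w (snd (snd z))) * indicator S z \<partial>hausdorff_measure (2 * DIM('a))) =
      ennreal (real DIM('a)) * (\<integral>\<^sup>+r. \<integral>\<^sup>+x. ennreal (w r) * (?E x r * indicator (cball 0 1) x) \<partial>lborel \<partial>lborel)"
  proof (subst nn_integral_hausdorff_discs[OF m])
    show "ennreal (w (snd (snd z))) * indicator S z = 0" if "z \<notin> discs" for z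
      using S(2) that by (auto simp: indicator_def)
  qed (simp only: fst_conv snd_conv inner)
  also have "\<dots> = ennreal (real DIM('a)) * (\<integral>\<^sup>+r. ennreal (w r) * (\<integral>\<^sup>+x. ?E x r * indicator (cball 0 1) x \<partial>lborel) \<partial>lborel)"
    unfolding E by (subst nn_integral_cmult) auto
  also have "\<dots> = (\<integral>\<^sup>+r. ennreal (real DIM('a)) * (ennreal (w r) * (\<integral>\<^sup>+x. ?E x r * indicator (cball 0 1) x \<partial>lborel)) \<partial>lborel)"
    unfolding E by (subst nn_integral_cmult) auto
  finally show ?thesis by (simp only: mult_ac)
qed

text \<open>Borel majorant of \<open>discs_odd\<close> when \<open>M\<close> is the closure of the
  curve. The conditions on \<open>z\<close> describe the closed disc in dimension at least
  2.\<close>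

definition meeting_discs :: "'a::euclidean_space set \<Rightarrow> ('a \<times> 'a \<times> real) set" where
  "meeting_discs M = {(p, u, r). norm u = 1 \<and> r > 0 \<and> (\<exists>z\<in>M. (z - p) \<bullet> u = 0 \<and> norm (z - p) \<le> r)}"

lemma sets_meeting_discs:
  assumes "compact M"
  shows "meeting_discs M \<in> sets borel"
proof -
  let ?\<phi> = "\<lambda>(z, p, u, r). max \<bar>(z - p) \<bullet> u\<bar> (norm (z - p) - r)"
  have "meeting_discs M = discs \<inter> {x. \<exists>z\<in>M. ?\<phi> (z, x) \<le> 0}"
    by (auto simp: meeting_discs_def discs_def)
  moreover have "closed {x. \<exists>z\<in>M. ?\<phi> (z, x) \<le> 0}"
    unfolding case_prod_beta' by (intro closed_compact_projection assms continuous_intros)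
  ultimately show ?thesis by (simp add: borel_closed)
qed

text \<open>A disc of radius \<open>r\<close> through a point \<open>x\<close> of \<open>M\<close>
  in \<open>S i\<close> has p \<bullet> u = x \<bullet> u, which ranges over an interval of length
  diameter (S i) (\<bar>t \<bullet> u\<bar> + \<epsilon>), and its centre projects to within r +
  diameter (S i) \<le> (1 + \<epsilon>) r of \<open>zz i\<close>. So one cylinder per covering set
  contains all centres.\<close>

lemma slice_upper_bound:
  fixes M :: "'a::euclidean_space set" and S :: "nat \<Rightarrow> 'a set"
  assumes u: "norm u = 1" and r: "r > 0" and \<epsilon>: "\<epsilon> > 0"
    and t: "\<And>y z w. y \<in> M \<Longrightarrow> z \<in> M \<Longrightarrow> w \<in> M \<Longrightarrow> dist y z < \<delta> \<Longrightarrow> dist y w < \<delta> \<Longrightarrow> tangent_approx \<epsilon> t y z w"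
    and S: "M \<subseteq> (\<Union>i. S i)" "\<And>i. bounded (S i)" "\<And>i. diameter (S i) < \<delta>" "\<And>i. diameter (S i) \<le> \<epsilon> * r"
    and z: "\<And>i. S i \<inter> M \<noteq> {} \<Longrightarrow> zz i \<in> S i \<inter> M"
  shows "emeasure lborel {p. (p, u, r) \<in> meeting_discs M} \<le>
    (\<Sum>i. ennreal (diameter (S i)) * ennreal (\<bar>t (zz i) \<bullet> u\<bar> + \<epsilon>)) *
      ennreal (unit_ball_vol (real (DIM('a) - 1)) * ((1 + \<epsilon>) * r) ^ (DIM('a) - 1))"
proof -
  let ?d = "\<lambda>i. diameter (S i)" and ?c = "ennreal (unit_ball_vol (real (DIM('a) - 1)) * ((1 + \<epsilon>) * r) ^ (DIM('a) - 1))"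
  let ?w = "\<lambda>i. ?d i * (\<bar>t (zz i) \<bullet> u\<bar> + \<epsilon>)"
  have d0: "?d i \<ge> 0" for i by (rule diameter_ge_0[OF S(2)])
  define m where "m i = Inf ((\<lambda>z. z \<bullet> u) ` (S i \<inter> M))" for i
  define cyl where "cyl i = {p. p \<bullet> u \<in> {m i..m i + ?w i} \<and> norm (perp u (p - zz i)) \<le> (1 + \<epsilon>) * r}" for i
  have in_J: "x \<bullet> u \<in> {m i..m i + ?w i}" if x: "x \<in> S i \<inter> M" for x i
  proof -
    let ?X = "(\<lambda>z. z \<bullet> u) ` (S i \<inter> M)"
    have zi: "zz i \<in> S i \<inter> M" using z x by blast
    have le: "x \<bullet> u - ?w i \<le> y \<bullet> u" if "x \<in> S i \<inter> M" "y \<in> S i \<inter> M" for x y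
    proof -
      have dd: "dist a b \<le> ?d i" if "a \<in> S i" "b \<in> S i" for a b
        using diameter_bounded_bound[OF S(2) that] .
      have "dist (zz i) y < \<delta>" "dist (zz i) x < \<delta>" using dd zi that S(3)[of i] by (meson IntD1 le_less_trans)+
      then have "tangent_approx \<epsilon> t (zz i) y x" using that zi by (intro t) auto
      then have "\<bar>\<bar>(x - y) \<bullet> u\<bar> - norm (x - y) * \<bar>t (zz i) \<bullet> u\<bar>\<bar> \<le> \<epsilon> * norm (x - y)"
        using u unfolding tangent_approx_def by blast
      then have "\<bar>(x - y) \<bullet> u\<bar> \<le> norm (x - y) * (\<bar>t (zz i) \<bullet> u\<bar> + \<epsilon>)" by (simp add: algebra_simps)
      also have "\<dots> \<le> ?w i" using dd[of x y] that \<epsilon> by (intro mult_right_mono) (auto simp: dist_norm)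
      finally show ?thesis by (simp add: inner_diff_left)
    qed
    have "x \<bullet> u - ?w i \<le> m i" unfolding m_def using x by (intro cInf_greatest) (auto intro: le[OF x])
    moreover have "bdd_below ?X" using le[OF x] by (intro bdd_belowI[of _ "x \<bullet> u - ?w i"]) auto
    then have "m i \<le> x \<bullet> u" unfolding m_def using x by (intro cInf_lower) auto
    ultimately show ?thesis by auto
  qed
  have cyl: "emeasure lborel (cyl i) = ennreal (?w i) * ?c" for i
    unfolding cyl_def using emeasure_cylinder[OF u, of "{m i..m i + ?w i}" "(1 + \<epsilon>) * r" "zz i"] r \<epsilon> d0[of i]
    by simp
  have "{p. (p, u, r) \<in> meeting_discs M} \<subseteq> (\<Union>i. cyl i)"
  proof
    fix p assume "p \<in> {p. (p, u, r) \<in> meeting_discs M}"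
    then obtain x where x: "x \<in> M" "(x - p) \<bullet> u = 0" "norm (x - p) \<le> r" by (auto simp: meeting_discs_def)
    then obtain i where i: "x \<in> S i \<inter> M" using S(1) by blast
    then have zi: "zz i \<in> S i \<inter> M" using z by blast
    have "perp u (p - zz i) = - perp u (x - p) + perp u (x - zz i)" by (simp add: perp_diff)
    then have "norm (perp u (p - zz i)) \<le> norm (perp u (x - p)) + norm (perp u (x - zz i))"
      by (metis norm_minus_cancel norm_triangle_ineq)
    also have "\<dots> \<le> norm (x - p) + norm (x - zz i)" by (intro add_mono norm_perp_le[OF u])
    also have "\<dots> \<le> r + \<epsilon> * r"
      using x(3) diameter_bounded_bound[OF S(2), of x i "zz i"] S(4)[of i] i zi by (intro add_mono) (auto simp: dist_norm)
    finally have "norm (perp u (p - zz i)) \<le> (1 + \<epsilon>) * r" by (simp add: algebra_simps)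
    moreover have "p \<bullet> u = x \<bullet> u" using x(2) by (simp add: inner_diff_left)
    ultimately have "p \<in> cyl i" using in_J[OF i] by (simp add: cyl_def)
    then show "p \<in> (\<Union>i. cyl i)" by blast
  qed
  then have "emeasure lborel {p. (p, u, r) \<in> meeting_discs M} \<le> emeasure lborel (\<Union>i. cyl i)"
    unfolding cyl_def by (rule emeasure_mono) measurable
  also have "\<dots> \<le> (\<Sum>i. emeasure lborel (cyl i))"
    unfolding cyl_def by (rule emeasure_subadditive_countably) (auto, measurable)
  also have "\<dots> = (\<Sum>i. (ennreal (?d i) * ennreal (\<bar>t (zz i) \<bullet> u\<bar> + \<epsilon>)) * ?c)"
    unfolding cyl using d0 \<epsilon> by (simp add: ennreal_mult)
  also have "\<dots> = (\<Sum>i. ennreal (?d i) * ennreal (\<bar>t (zz i) \<bullet> u\<bar> + \<epsilon>)) * ?c"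
    by simp
  finally show ?thesis .
qed

text \<open>Area of the unit sphere, which is the total mass of the cone measure of directions. The
  type argument carries the dimension.\<close>

definition direction_mass :: "'a::euclidean_space itself \<Rightarrow> real" where
  "direction_mass _ = real DIM('a) * unit_ball_vol (real DIM('a))"

lemma direction_mass_nonneg: "direction_mass TYPE('a::euclidean_space) \<ge> 0"
  by (simp add: direction_mass_def)

lemma nn_integral_direction_const:
  "ennreal (real DIM('a)) * (\<integral>\<^sup>+x. ennreal c * indicator (cball (0::'a::euclidean_space) 1) x \<partial>lborel) =
    ennreal (c * direction_mass TYPE('a))"
  if "c \<ge> 0"
  using that by (simp add: nn_integral_cmult_indicator emeasure_cball direction_mass_def ennreal_mult[symmetric] mult_ac)

lemma nn_integral_direction_inner_add:
  fixes b :: "'a::euclidean_space"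
  assumes b: "norm b = 1" and c: "c \<ge> 0"
  shows "ennreal (real DIM('a)) * (\<integral>\<^sup>+x. ennreal (\<bar>b \<bullet> (x /\<^sub>R norm x)\<bar> + c) * indicator (cball 0 1) x \<partial>lborel) =
    ennreal (2 * unit_ball_vol (real (DIM('a) - 1)) + c * direction_mass TYPE('a))"
proof -
  have [measurable]: "cball (0::'a) 1 \<in> sets borel" by simp
  have "(\<integral>\<^sup>+x. ennreal (\<bar>b \<bullet> (x /\<^sub>R norm x)\<bar> + c) * indicator (cball 0 1) x \<partial>lborel) =
      (\<integral>\<^sup>+x. ennreal \<bar>(x /\<^sub>R norm x) \<bullet> b\<bar> * indicator (cball 0 1) x + ennreal c * indicator (cball 0 1) x \<partial>lborel)"
    using c by (intro nn_integral_cong) (simp add: inner_commute distrib_right ennreal_plus)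
  also have "\<dots> = (\<integral>\<^sup>+x. ennreal \<bar>(x /\<^sub>R norm x) \<bullet> b\<bar> * indicator (cball 0 1) x \<partial>lborel) + (\<integral>\<^sup>+x. ennreal c * indicator (cball (0::'a) 1) x \<partial>lborel)"
    by (rule nn_integral_add) measurable
  finally show ?thesis
    using nn_integral_abs_inner_direction[OF b] nn_integral_direction_const[OF c, where 'a = 'a] c direction_mass_nonneg[where 'a = 'a]
    by (simp add: distrib_left ennreal_plus)
qed

text \<open>The covers in the definition of \<open>hausdorff 1\<close> are used directly, each set being enclosed in a cylinder;
  multiplicities of intersection do not matter here.\<close>

lemma crofton_upper_bound_eps:
  fixes M :: "'a::euclidean_space set"
  assumes M: "compact M" and t: "curve_orientation M t" and r: "r > 0" and \<epsilon>: "\<epsilon> > 0" and fin: "hausdorff 1 M < top"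
  defines "V \<equiv> unit_ball_vol (real (DIM('a) - 1))"
  shows "ennreal (real DIM('a)) * (\<integral>\<^sup>+x. emeasure lborel {p. (p, x /\<^sub>R norm x, r) \<in> meeting_discs M} * indicator (cball 0 1) x \<partial>lborel)
    \<le> (hausdorff 1 M + ennreal \<epsilon>) *
      ennreal ((2 * V + \<epsilon> * direction_mass TYPE('a)) * (V * ((1 + \<epsilon>) * r) ^ (DIM('a) - 1)))"
proof -
  obtain \<delta> where \<delta>: "\<delta> > 0"
    "\<And>y z w. y \<in> M \<Longrightarrow> z \<in> M \<Longrightarrow> w \<in> M \<Longrightarrow> dist y z < \<delta> \<Longrightarrow> dist y w < \<delta> \<Longrightarrow> tangent_approx \<epsilon> t y z w"
    by (rule uniform_tangent_approx[OF M t \<epsilon>]) (rule that)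
  \<comment> \<open>\<delta>' < \<delta> gives the chord estimate within each covering set;
    \<delta>' \<le> \<epsilon> r makes the covering sets small compared with the radius.\<close>
  define \<delta>' where "\<delta>' = min (\<delta> / 2) (\<epsilon> * r)"
  have \<delta>': "\<delta>' > 0" "\<delta>' < \<delta>" "\<delta>' \<le> \<epsilon> * r" using \<delta>(1) \<epsilon> r by (auto simp: \<delta>'_def)
  have "hausdorff_content 1 \<delta>' M \<le> hausdorff 1 M" by (rule hausdorff_content_le_hausdorff[OF \<delta>'(1)])
  also have "\<dots> < hausdorff 1 M + ennreal \<epsilon>"
    using fin \<epsilon> by (simp add: ennreal_add_left_cancel_less[of _ 0, simplified])
  finally have "\<exists>S\<in>hausdorff_covers \<delta>' M. (\<Sum>i. hausdorff_weight 1 (S i)) < hausdorff 1 M + ennreal \<epsilon>"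
    unfolding hausdorff_content_def by (simp only: INF_less_iff)
  then obtain S where S: "M \<subseteq> (\<Union>i. S i)" "\<And>i. bounded (S i)" "\<And>i. diameter (S i) \<le> \<delta>'"
    and "(\<Sum>i. hausdorff_weight 1 (S i)) < hausdorff 1 M + ennreal \<epsilon>"
    by (auto simp: hausdorff_covers_def)
  moreover have "hausdorff_weight 1 (S i) = ennreal (diameter (S i))" for i
    by (rule hausdorff_weight_1[OF S(2)])
  ultimately have sum: "(\<Sum>i. ennreal (diameter (S i))) \<le> hausdorff 1 M + ennreal \<epsilon>"
    by (simp only: less_imp_le)
  define e0 :: 'a where "e0 = (SOME b. b \<in> Basis)"
  have e0: "norm e0 = 1" unfolding e0_def by (intro norm_Basis SOME_Basis)
  define zz where "zz i = (SOME z. z \<in> S i \<inter> M)" for i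
  have zz: "zz i \<in> S i \<inter> M" if "S i \<inter> M \<noteq> {}" for i
    unfolding zz_def by (rule someI_ex[of "\<lambda>z. z \<in> S i \<inter> M"]) (use that in blast)
  \<comment> \<open>A covering set that misses \<open>M\<close> has an arbitrary sample point, where
    \<open>t\<close> is uncontrolled; \<open>t'\<close> is a unit vector everywhere, as the integral
    over directions requires.\<close>
  define t' where "t' y = (if y \<in> M then t y else e0)" for y
  have t'1: "norm (t' y) = 1" for y using t e0 by (auto simp: t'_def curve_orientation_def)
  have t': "tangent_approx \<epsilon> t' y z w" if "y \<in> M" "z \<in> M" "w \<in> M" "dist y z < \<delta>" "dist y w < \<delta>" for y z w
    using \<delta>(2)[OF that] that(1) by (simp add: tangent_approx_def t'_def)
  have [measurable]: "cball (0::'a) 1 \<in> sets borel" by simp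
  let ?n = "ennreal (real DIM('a))"
  let ?c = "ennreal (V * ((1 + \<epsilon>) * r) ^ (DIM('a) - 1))"
  let ?f = "\<lambda>i x. ennreal (diameter (S i)) * (ennreal (\<bar>t' (zz i) \<bullet> (x /\<^sub>R norm x)\<bar> + \<epsilon>) * indicator (cball 0 1) x)"
  have "(\<integral>\<^sup>+x. emeasure lborel {p. (p, x /\<^sub>R norm x, r) \<in> meeting_discs M} * indicator (cball 0 1) x \<partial>lborel)
      \<le> (\<integral>\<^sup>+x. (\<Sum>i. ?f i x) * ?c \<partial>lborel)"
  proof (rule nn_integral_mono)
    fix x :: 'a
    show "emeasure lborel {p. (p, x /\<^sub>R norm x, r) \<in> meeting_discs M} * indicator (cball 0 1) x \<le> (\<Sum>i. ?f i x) * ?c"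
    proof (cases "x \<noteq> 0 \<and> x \<in> cball 0 1")
      case True
      then have u: "norm (x /\<^sub>R norm x) = 1" by simp
      have "emeasure lborel {p. (p, x /\<^sub>R norm x, r) \<in> meeting_discs M} \<le>
        (\<Sum>i. ennreal (diameter (S i)) * ennreal (\<bar>t' (zz i) \<bullet> (x /\<^sub>R norm x)\<bar> + \<epsilon>)) * ?c"
        unfolding V_def
      proof (rule slice_upper_bound[OF u r \<epsilon> t' S(1,2)])
        show "diameter (S i) < \<delta>" "diameter (S i) \<le> \<epsilon> * r" for i using S(3)[of i] \<delta>'(2,3) by linarith+
      qed (use zz in auto)
      then show ?thesis using True by simp
    next
      case False
      then show ?thesis
      proof (cases "x = 0")
        case True
        then have "{p. (p, x /\<^sub>R norm x, r) \<in> meeting_discs M} = {}" by (auto simp: meeting_discs_def)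
        then show ?thesis by simp
      qed auto
    qed
  qed
  also have "\<dots> = (\<integral>\<^sup>+x. (\<Sum>i. ?f i x) \<partial>lborel) * ?c"
    by (rule nn_integral_multc) measurable
  also have "(\<integral>\<^sup>+x. (\<Sum>i. ?f i x) \<partial>lborel) = (\<Sum>i. \<integral>\<^sup>+x. ?f i x \<partial>lborel)"
    by (rule nn_integral_suminf) measurable
  finally have "?n * (\<integral>\<^sup>+x. emeasure lborel {p. (p, x /\<^sub>R norm x, r) \<in> meeting_discs M} * indicator (cball 0 1) x \<partial>lborel)
      \<le> ?n * ((\<Sum>i. \<integral>\<^sup>+x. ?f i x \<partial>lborel) * ?c)"
    by (rule mult_left_mono) simp
  also have "\<dots> = (\<Sum>i. ?n * (\<integral>\<^sup>+x. ?f i x \<partial>lborel)) * ?c"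
    by (simp add: mult.assoc)
  also have "(\<Sum>i. ?n * (\<integral>\<^sup>+x. ?f i x \<partial>lborel)) = (\<Sum>i. ennreal (diameter (S i)) * ennreal (2 * V + \<epsilon> * direction_mass TYPE('a)))"
  proof (rule suminf_cong)
    fix i
    have "?n * (\<integral>\<^sup>+x. ?f i x \<partial>lborel) = ?n * (ennreal (diameter (S i)) * (\<integral>\<^sup>+x. ennreal (\<bar>t' (zz i) \<bullet> (x /\<^sub>R norm x)\<bar> + \<epsilon>) * indicator (cball 0 1) x \<partial>lborel))"
      by (subst nn_integral_cmult) auto
    also have "\<dots> = ennreal (diameter (S i)) * (?n * (\<integral>\<^sup>+x. ennreal (\<bar>t' (zz i) \<bullet> (x /\<^sub>R norm x)\<bar> + \<epsilon>) * indicator (cball 0 1) x \<partial>lborel))"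
      by (simp only: mult_ac)
    also have "\<dots> = ennreal (diameter (S i)) * ennreal (2 * V + \<epsilon> * direction_mass TYPE('a))"
      using nn_integral_direction_inner_add[OF t'1[of "zz i"], of \<epsilon>] \<epsilon> by (simp only: V_def less_imp_le)
    finally show "?n * (\<integral>\<^sup>+x. ?f i x \<partial>lborel) = ennreal (diameter (S i)) * ennreal (2 * V + \<epsilon> * direction_mass TYPE('a))" .
  qed
  also have "\<dots> = (\<Sum>i. ennreal (diameter (S i))) * ennreal (2 * V + \<epsilon> * direction_mass TYPE('a))"
    by simp
  also have "\<dots> * ?c \<le> (hausdorff 1 M + ennreal \<epsilon>) * ennreal (2 * V + \<epsilon> * direction_mass TYPE('a)) * ?c"
    using sum by (intro mult_right_mono) auto
  also have "\<dots> = (hausdorff 1 M + ennreal \<epsilon>) * ennreal ((2 * V + \<epsilon> * direction_mass TYPE('a)) * (V * ((1 + \<epsilon>) * r) ^ (DIM('a) - 1)))"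
    using \<epsilon> r direction_mass_nonneg[where 'a = 'a] by (simp add: V_def mult.assoc ennreal_mult)
  finally show ?thesis .
qed

text \<open>\<epsilon> tends to 0 at fixed radius. For infinite length the right side is infinite
  because its coefficient is positive.\<close>

theorem crofton_upper_bound:
  fixes M :: "'a::euclidean_space set"
  assumes M: "compact M" and t: "curve_orientation M t" and r: "r > 0"
  defines "V \<equiv> unit_ball_vol (real (DIM('a) - 1))"
  shows "ennreal (real DIM('a)) * (\<integral>\<^sup>+x. emeasure lborel {p. (p, x /\<^sub>R norm x, r) \<in> meeting_discs M} * indicator (cball 0 1) x \<partial>lborel)
    \<le> ennreal (2 * V\<^sup>2 * r ^ (DIM('a) - 1)) * hausdorff 1 M"
proof (cases "hausdorff 1 M")
  case (real h)
  have V: "V > 0" by (simp add: V_def)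
  let ?L = "ennreal (real DIM('a)) * (\<integral>\<^sup>+x. emeasure lborel {p. (p, x /\<^sub>R norm x, r) \<in> meeting_discs M} * indicator (cball 0 1) x \<partial>lborel)"
  let ?g = "\<lambda>\<epsilon>. (h + \<epsilon>) * ((2 * V + \<epsilon> * direction_mass TYPE('a)) * (V * ((1 + \<epsilon>) * r) ^ (DIM('a) - 1)))"
  have "?L \<le> ennreal (?g \<epsilon>)" if "\<epsilon> > 0" for \<epsilon>
  proof -
    have "?L \<le> (hausdorff 1 M + ennreal \<epsilon>) * ennreal ((2 * V + \<epsilon> * direction_mass TYPE('a)) * (V * ((1 + \<epsilon>) * r) ^ (DIM('a) - 1)))"
      unfolding V_def by (rule crofton_upper_bound_eps[OF M t r that]) (use real in simp)
    also have "\<dots> = ennreal (?g \<epsilon>)"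
      using real that V r direction_mass_nonneg[where 'a = 'a]
      by (subst ennreal_mult) (auto simp: ennreal_plus)
    finally show ?thesis .
  qed
  then have "eventually (\<lambda>\<epsilon>. ?L \<le> ennreal (?g \<epsilon>)) (at_right 0)"
    by (simp add: eventually_at_filter)
  moreover have "((\<lambda>\<epsilon>. ennreal (?g \<epsilon>)) \<longlongrightarrow> ennreal (?g 0)) (at_right 0)"
    by (intro tendsto_ennrealI tendsto_intros)
  ultimately have "?L \<le> ennreal (?g 0)"
    by (intro tendsto_lowerbound[where F = "at_right (0::real)"]) auto
  also have "\<dots> = ennreal (2 * V\<^sup>2 * r ^ (DIM('a) - 1)) * hausdorff 1 M"
    using real V r by (simp add: ennreal_mult[symmetric] power2_eq_square mult_ac)
  finally show ?thesis .
next
  case top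
  have "V > 0" by (simp add: V_def)
  define X where "X = 2 * V\<^sup>2 * r ^ (DIM('a) - 1)"
  have "X > 0" using \<open>V > 0\<close> r by (simp add: X_def)
  then have *: "ennreal X * hausdorff 1 M = top" unfolding top by (simp add: ennreal_mult_top)
  show ?thesis by (simp only: X_def[symmetric] * top_greatest)
qed

text \<open>Contains the discs of radius \<open>r > 2 R\<close> that meet a set inside the ball of radius \<open>R\<close> and have a boundary
  point in that ball.\<close>

definition far_discs :: "real \<Rightarrow> ('a::euclidean_space \<times> 'a \<times> real) set" where
  "far_discs R = {(p, u, r). norm u = 1 \<and> r > 0 \<and> \<bar>p \<bullet> u\<bar> \<le> R \<and> r - 2 * R < norm (perp u p) \<and> norm (perp u p) \<le> r + 2 * R}"

lemma sets_far_discs: "far_discs R \<in> sets borel"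
proof -
  have "far_discs R = discs \<inter> {z. \<bar>fst z \<bullet> fst (snd z)\<bar> \<le> R} \<inter> {z. snd (snd z) - 2 * R < norm (perp (fst (snd z)) (fst z))} \<inter>
      {z :: 'a \<times> 'a \<times> real. norm (perp (fst (snd z)) (fst z)) \<le> snd (snd z) + 2 * R}"
    by (auto simp: far_discs_def discs_def)
  then show ?thesis
    by (simp only:) (intro sets.Int sets_discs borel_closed borel_open closed_Collect_le open_Collect_less continuous_intros)
qed

text \<open>Slab height 2 R times \<omega> times the difference of the (n-1)-st powers of r + 2 R
  and r - 2 R. That difference is 4 R times a sum of n - 1 products of degree n - 2, each at most (2
  r)^(n-2) because 2 R < r.\<close>

lemma far_discs_slice:
  assumes R: "R > 0" and n: "DIM('a::euclidean_space) \<ge> 2"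
  defines "K \<equiv> 2 * R * (unit_ball_vol (real (DIM('a) - 1)) * (real (DIM('a) - 1) * (4 * R) * 2 ^ (DIM('a) - 2)))"
  assumes r: "r > 2 * R"
  shows "emeasure lborel {p::'a. (p, u, r) \<in> far_discs R} \<le> ennreal (K * r ^ (DIM('a) - 2))"
proof (cases "norm u = 1")
  case True
  let ?m = "DIM('a) - 1"
  have m: "?m = Suc (DIM('a) - 2)" using n by simp
  have "(r + 2 * R) ^ ?m - (r - 2 * R) ^ ?m = 4 * R * (\<Sum>i<?m. (r - 2 * R) ^ (?m - Suc i) * (r + 2 * R) ^ i)"
    using power_diff_sumr2[of "r + 2 * R" ?m "r - 2 * R"] by simp
  also have "\<dots> \<le> 4 * R * (\<Sum>i<?m. (2 * r) ^ (DIM('a) - 2))"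
  proof (intro mult_left_mono sum_mono)
    fix i assume "i \<in> {..<?m}"
    then have i: "(?m - Suc i) + i = DIM('a) - 2" by auto
    have "(r - 2 * R) ^ (?m - Suc i) * (r + 2 * R) ^ i \<le> (2 * r) ^ (?m - Suc i) * (2 * r) ^ i"
      using R r by (intro mult_mono power_mono) auto
    then show "(r - 2 * R) ^ (?m - Suc i) * (r + 2 * R) ^ i \<le> (2 * r) ^ (DIM('a) - 2)"
      by (simp only: power_add[symmetric] i)
  qed (use R in auto)
  also have "\<dots> = real ?m * (4 * R) * 2 ^ (DIM('a) - 2) * r ^ (DIM('a) - 2)"
    by (simp add: power_mult_distrib mult_ac)
  finally have diff: "(r + 2 * R) ^ ?m - (r - 2 * R) ^ ?m \<le> real ?m * (4 * R) * 2 ^ (DIM('a) - 2) * r ^ (DIM('a) - 2)" .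
  have "{p::'a. (p, u, r) \<in> far_discs R} = {p. p \<bullet> u \<in> {-R..R} \<and> r - 2 * R < norm (perp u p) \<and> norm (perp u p) \<le> r + 2 * R}"
    using True r R by (auto simp: far_discs_def abs_le_iff)
  then have "emeasure lborel {p::'a. (p, u, r) \<in> far_discs R} =
      ennreal (2 * R) * ennreal (unit_ball_vol (real ?m) * ((r + 2 * R) ^ ?m - (r - 2 * R) ^ ?m))"
    using emeasure_perp_shell[OF True, of "{-R..R}" "r - 2 * R" "r + 2 * R"] r R by simp
  also have "\<dots> \<le> ennreal (2 * R) * ennreal (unit_ball_vol (real ?m) * (real ?m * (4 * R) * 2 ^ (DIM('a) - 2) * r ^ (DIM('a) - 2)))"
    using diff by (intro mult_left_mono ennreal_leI) auto
  also have "\<dots> = ennreal (K * r ^ (DIM('a) - 2))"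
    using R r by (simp add: K_def ennreal_mult[symmetric] mult_ac)
  finally show ?thesis .
next
  case False
  then have "{p::'a. (p, u, r) \<in> far_discs R} = {}" by (auto simp: far_discs_def)
  then show ?thesis by simp
qed

section \<open>Discs crossing a curve exactly once\<close>

text \<open>Discs of small radius that meet \<open>K\<close> in their relative interior at an angle
  bounded away from tangency. For \<open>K\<close> the closure without its boundary points and small
  \<open>r0\<close>, each of them has a single curve point.\<close>

definition crossing_discs :: "'a::euclidean_space set \<Rightarrow> ('a \<Rightarrow> 'a) \<Rightarrow> real \<Rightarrow> real \<Rightarrow> ('a \<times> 'a \<times> real) set" where
  "crossing_discs K t \<epsilon> r0 = {(p, u, r). norm u = 1 \<and> 0 < r \<and> r < r0 \<and>
     (\<exists>z\<in>K. (z - p) \<bullet> u = 0 \<and> norm (z - p) < r \<and> \<epsilon> < \<bar>t z \<bullet> u\<bar>)}"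

lemma minus_finite_eq_UN_compact:
  fixes M :: "'a::euclidean_space set"
  assumes "finite F"
  shows "M - F = (\<Union>m. M - (\<Union>f\<in>F. ball f (inverse (real (Suc m)))))"
proof (intro equalityI subsetI)
  fix x assume x: "x \<in> M - F"
  obtain d where d: "d > 0" "\<forall>f\<in>F. f \<noteq> x \<longrightarrow> d \<le> dist x f"
    using finite_set_avoid[OF assms, of x] by blast
  obtain m where m: "inverse (real (Suc m)) < d" using reals_Archimedean[OF d(1)] by blast
  have "x \<notin> ball f (inverse (real (Suc m)))" if "f \<in> F" for f
  proof -
    have "d \<le> dist f x" using d(2) that x by (auto simp: dist_commute)
    then show ?thesis using m by simp
  qed
  then have "x \<in> M - (\<Union>f\<in>F. ball f (inverse (real (Suc m))))" using x by blast
  then show "x \<in> (\<Union>m. M - (\<Union>f\<in>F. ball f (inverse (real (Suc m)))))" by blast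
next
  fix x assume "x \<in> (\<Union>m. M - (\<Union>f\<in>F. ball f (inverse (real (Suc m)))))"
  then obtain m where m: "x \<in> M" "x \<notin> (\<Union>f\<in>F. ball f (inverse (real (Suc m))))" by blast
  have "x \<notin> F"
  proof
    assume "x \<in> F"
    moreover have "x \<in> ball x (inverse (real (Suc m)))" by simp
    ultimately show False using m(2) by blast
  qed
  with m(1) show "x \<in> M - F" by blast
qed

text \<open>The strict inequalities in the existential part are exhausted by margins 1 / (m + 1),
  and \<open>M - F\<close> by compact sets \<open>K m\<close>; each stage is closed by
  \<open>closed_compact_projection\<close>.\<close>

lemma sets_crossing_discs:
  fixes M :: "'a::euclidean_space set"
  assumes M: "compact M" and F: "finite F" and t: "continuous_on M t"
  shows "crossing_discs (M - F) t \<epsilon> r0 \<in> sets borel"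
proof -
  let ?a = "\<lambda>m::nat. inverse (real (Suc m))"
  define K where "K m = M - (\<Union>f\<in>F. ball f (?a m))" for m
  have K: "compact (K m)" for m unfolding K_def by (intro compact_diff M open_UN ballI open_ball)
  have KM: "K m \<subseteq> M" for m by (auto simp: K_def)
  have a_anti: "?a m \<le> ?a k" if "k \<le> m" for k m using that by simp
  have K_mono: "K k \<subseteq> K m" if "k \<le> m" for k m
  proof -
    have "ball f (?a m) \<subseteq> ball f (?a k)" for f :: 'a using a_anti[OF that] by (rule subset_ball)
    then show ?thesis unfolding K_def by blast
  qed
  define \<phi> where "\<phi> m = (\<lambda>x::'a \<times> 'a \<times> 'a \<times> real. max \<bar>(fst x - fst (snd x)) \<bullet> fst (snd (snd x))\<bar>
    (max (norm (fst x - fst (snd x)) - snd (snd (snd x)) + ?a m) (\<epsilon> + ?a m - \<bar>t (fst x) \<bullet> fst (snd (snd x))\<bar>)))" for m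
  have closed: "closed {x. \<exists>z\<in>K m. \<phi> m (z, x) \<le> 0}" for m
  proof (rule closed_compact_projection[OF K])
    have "continuous_on (K m \<times> UNIV) (\<lambda>x. t (fst x))"
      by (rule continuous_on_compose2[OF continuous_on_subset[OF t KM[of m]] continuous_on_fst[OF continuous_on_id]]) auto
    then show "continuous_on (K m \<times> UNIV) (\<phi> m)" unfolding \<phi>_def by (intro continuous_intros)
  qed
  have open_r: "open {x::'a \<times> 'a \<times> real. snd (snd x) < r0}"
    by (intro open_Collect_less continuous_intros)
  have eq: "crossing_discs (M - F) t \<epsilon> r0 = discs \<inter> {x. snd (snd x) < r0} \<inter> (\<Union>m. {x. \<exists>z\<in>K m. \<phi> m (z, x) \<le> 0})"
  proof (intro equalityI subsetI)
    fix x assume x: "x \<in> crossing_discs (M - F) t \<epsilon> r0"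
    obtain p u r where pur: "x = (p, u, r)" by (cases x)
    from x pur obtain z where z: "norm u = 1" "0 < r" "r < r0" "z \<in> M - F" "(z - p) \<bullet> u = 0" "norm (z - p) < r" "\<epsilon> < \<bar>t z \<bullet> u\<bar>"
      by (auto simp: crossing_discs_def)
    obtain m1 where m1: "z \<in> K m1" using z(4) minus_finite_eq_UN_compact[OF F, of M] unfolding K_def by blast
    have "r - norm (z - p) > 0" "\<bar>t z \<bullet> u\<bar> - \<epsilon> > 0" using z by auto
    then obtain m2 m3 where m23: "?a m2 < r - norm (z - p)" "?a m3 < \<bar>t z \<bullet> u\<bar> - \<epsilon>"
      using reals_Archimedean by metis
    define m where "m = max m1 (max m2 m3)"
    have "z \<in> K m" using K_mono[of m1 m] m1 by (auto simp: m_def)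
    moreover have "?a m \<le> r - norm (z - p)" "?a m \<le> \<bar>t z \<bullet> u\<bar> - \<epsilon>"
    proof -
      have "m2 \<le> m" "m3 \<le> m" by (simp_all add: m_def)
      then show "?a m \<le> r - norm (z - p)" "?a m \<le> \<bar>t z \<bullet> u\<bar> - \<epsilon>"
        using m23 a_anti[of m2 m] a_anti[of m3 m] by linarith+
    qed
    then have "\<phi> m (z, x) \<le> 0" using z(5) by (simp add: \<phi>_def pur)
    ultimately have "x \<in> {x. \<exists>z\<in>K m. \<phi> m (z, x) \<le> 0}" by blast
    moreover have "x \<in> discs" "snd (snd x) < r0" using z by (auto simp: discs_def pur)
    ultimately show "x \<in> discs \<inter> {x. snd (snd x) < r0} \<inter> (\<Union>m. {x. \<exists>z\<in>K m. \<phi> m (z, x) \<le> 0})" by blast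
  next
    fix x assume x: "x \<in> discs \<inter> {x. snd (snd x) < r0} \<inter> (\<Union>m. {x. \<exists>z\<in>K m. \<phi> m (z, x) \<le> 0})"
    obtain p u r where pur: "x = (p, u, r)" by (cases x)
    from x obtain m z where z: "z \<in> K m" "\<phi> m (z, x) \<le> 0" by blast
    have "z \<in> M - F" using z(1) minus_finite_eq_UN_compact[OF F, of M] unfolding K_def by blast
    moreover have "?a m > 0" by simp
    moreover have "\<bar>(z - p) \<bullet> u\<bar> \<le> 0" "norm (z - p) - r + ?a m \<le> 0" "\<epsilon> + ?a m - \<bar>t z \<bullet> u\<bar> \<le> 0"
      using z(2) unfolding \<phi>_def pur by (simp_all only: fst_conv snd_conv max.bounded_iff)
    ultimately have "z \<in> M - F" "\<bar>(z - p) \<bullet> u\<bar> \<le> 0" "norm (z - p) < r" "\<epsilon> < \<bar>t z \<bullet> u\<bar>"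
      by (assumption | linarith)+
    then show "x \<in> crossing_discs (M - F) t \<epsilon> r0"
      using x by (auto simp: crossing_discs_def discs_def pur)
  qed
  have UN: "(\<Union>m. {x. \<exists>z\<in>K m. \<phi> m (z, x) \<le> 0}) \<in> sets borel"
    by (intro sets.countable_UN) (auto intro: borel_closed closed)
  show ?thesis
    unfolding eq by (intro sets.Int sets_discs borel_open[OF open_r] UN)
qed

text \<open>A nonzero chord in the plane of the disc has no component along \<open>u\<close>, so the
  chord estimate would give \<bar>t z \<bullet> u\<bar> \<le> \<epsilon>.\<close>

lemma crossing_unique:
  assumes u: "norm u = 1" and ta: "tangent_approx \<epsilon> t z z w" and orth: "(w - z) \<bullet> u = 0" and tz: "\<epsilon> < \<bar>t z \<bullet> u\<bar>"
  shows "w = z"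
proof (rule ccontr)
  assume "w \<noteq> z"
  then have pos: "norm (w - z) > 0" by simp
  have "\<bar>\<bar>(w - z) \<bullet> u\<bar> - norm (w - z) * \<bar>t z \<bullet> u\<bar>\<bar> \<le> \<epsilon> * norm (w - z)"
    using ta u unfolding tangent_approx_def by blast
  then have "norm (w - z) * \<bar>t z \<bullet> u\<bar> \<le> norm (w - z) * \<epsilon>" by (simp add: orth mult.commute)
  then have "\<bar>t z \<bullet> u\<bar> \<le> \<epsilon>" using pos by (simp only: mult_le_cancel_left_pos)
  then show False using tz by simp
qed

text \<open>To a piece that is not nearly parallel to the plane belongs a cylinder of centres whose
  discs hit the piece: connectedness guarantees a hit at every intermediate height. Uniqueness of
  crossings makes the cylinders of different pieces disjoint, so their volumes add.\<close>

lemma slice_lower_bound: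
  fixes M :: "'a::euclidean_space set" and B :: "nat \<Rightarrow> 'a set"
  assumes u: "norm u = 1" and r: "0 < r" "r < r0" "2 * r < \<delta>" and \<epsilon>: "\<epsilon> > 0" and \<eta>: "0 < \<eta>" "\<eta> < 1/2"
    and t: "\<And>y z w. y \<in> M \<Longrightarrow> z \<in> M \<Longrightarrow> w \<in> M \<Longrightarrow> dist y z < \<delta> \<Longrightarrow> dist y w < \<delta> \<Longrightarrow> tangent_approx \<epsilon> t y z w"
    and B: "disjoint_family B" "(\<Union>i. B i) \<subseteq> M" "\<And>i. connected (B i)" "\<And>i x y. x \<in> B i \<Longrightarrow> y \<in> B i \<Longrightarrow> dist x y \<le> \<eta> * r"
    and z: "\<And>i. B i \<noteq> {} \<Longrightarrow> zz i \<in> B i"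
    and sets: "crossing_discs (\<Union>i. B i) t \<epsilon> r0 \<in> sets borel"
  shows "(\<Sum>i. ennreal (diameter (B i)) * ennreal (\<bar>t (zz i) \<bullet> u\<bar> - 3 * \<epsilon>)) *
      ennreal (unit_ball_vol (real (DIM('a) - 1)) * ((1 - 2 * \<eta>) * r) ^ (DIM('a) - 1))
    \<le> emeasure lborel {p. (p, u, r) \<in> crossing_discs (\<Union>i. B i) t \<epsilon> r0}"
proof -
  let ?c = "ennreal (unit_ball_vol (real (DIM('a) - 1)) * ((1 - 2 * \<eta>) * r) ^ (DIM('a) - 1))"
  have \<eta>r: "\<eta> * r < \<delta>"
  proof -
    have "\<eta> * r \<le> 1 * r" using r \<eta> by (intro mult_right_mono) auto
    then show ?thesis using r by linarith
  qed
  have ta: "\<bar>\<bar>(w - x) \<bullet> u\<bar> - norm (w - x) * \<bar>t y \<bullet> u\<bar>\<bar> \<le> \<epsilon> * norm (w - x)" if "x \<in> B i" "y \<in> B i" "w \<in> B i" for x y w i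
  proof -
    have "dist y x < \<delta>" "dist y w < \<delta>" using B(4) that \<eta>r by (meson le_less_trans)+
    then have "tangent_approx \<epsilon> t y x w" using that B(2) by (intro t) auto
    then show ?thesis using u unfolding tangent_approx_def by blast
  qed
  \<comment> \<open>The threshold 3 \<epsilon> at the sample point leaves \<bar>t x \<bullet>
    u\<bar> > \<epsilon> on the whole piece, since comparing the tangents at two points through
    their chord costs 2 \<epsilon>.\<close>
  define good where "good i \<longleftrightarrow> B i \<noteq> {} \<and> 3 * \<epsilon> < \<bar>t (zz i) \<bullet> u\<bar>" for i
  define X where "X i = (\<lambda>x. x \<bullet> u) ` B i" for i
  \<comment> \<open>An open interval, because the extreme heights need not be attained.\<close>
  define J where "J i = {Inf (X i) <..< Sup (X i)}" for i
  \<comment> \<open>The crossing point is at most \<eta> r away from \<open>zz i\<close>; reducing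
    the radius by 2 \<eta> r keeps its distance from the centre at most r - \<eta> r, strictly below
    \<open>r\<close>.\<close>
  define cyl where "cyl i = (if good i then {p. p \<bullet> u \<in> J i \<and> norm (perp u (p - zz i)) \<le> (1 - 2 * \<eta>) * r} else {})" for i
  have cyl_sets: "cyl i \<in> sets borel" for i unfolding cyl_def J_def by simp
  have t_large: "\<epsilon> < \<bar>t x \<bullet> u\<bar>" if g: "good i" and x: "x \<in> B i" for i x
  proof (cases "x = zz i")
    case True
    then show ?thesis using g \<epsilon> by (simp add: good_def)
  next
    case False
    then have pos: "norm (x - zz i) > 0" by simp
    have zi: "zz i \<in> B i" using z g by (simp add: good_def)
    have "norm (x - zz i) * \<bar>t (zz i) \<bullet> u\<bar> - \<epsilon> * norm (x - zz i) \<le> norm (x - zz i) * \<bar>t x \<bullet> u\<bar> + \<epsilon> * norm (x - zz i)"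
      using ta[OF zi zi x] ta[OF zi x x] by linarith
    then have "norm (x - zz i) * (\<bar>t (zz i) \<bullet> u\<bar> - 2 * \<epsilon>) \<le> norm (x - zz i) * \<bar>t x \<bullet> u\<bar>" by (simp add: algebra_simps)
    then have "\<bar>t (zz i) \<bullet> u\<bar> - 2 * \<epsilon> \<le> \<bar>t x \<bullet> u\<bar>" using pos by (simp only: mult_le_cancel_left_pos)
    then show ?thesis using g by (simp add: good_def)
  qed
  have hit: "\<exists>x\<in>B i. (x - p) \<bullet> u = 0 \<and> norm (x - p) < r" if p: "p \<in> cyl i" for p i
  proof -
    have g: "good i" using p by (auto simp: cyl_def split: if_splits)
    then have pJ: "p \<bullet> u \<in> J i" "norm (perp u (p - zz i)) \<le> (1 - 2 * \<eta>) * r" using p by (auto simp: cyl_def)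
    have ne: "X i \<noteq> {}" using g by (simp add: good_def X_def)
    have "connected (X i)" unfolding X_def using B(3) by (intro connected_continuous_image continuous_intros)
    then have int: "is_interval (X i)" by (simp add: is_interval_connected_1)
    have zi: "zz i \<in> B i" using z g by (simp add: good_def)
    have dX: "\<bar>a - b\<bar> \<le> \<eta> * r" if "a \<in> X i" "b \<in> X i" for a b
    proof -
      from that obtain x y where xy: "x \<in> B i" "y \<in> B i" "a = x \<bullet> u" "b = y \<bullet> u" by (auto simp: X_def)
      have "\<bar>(x - y) \<bullet> u\<bar> \<le> norm (x - y) * norm u" by (rule Cauchy_Schwarz_ineq2)
      then show ?thesis using B(4)[OF xy(1,2)] u xy(3,4) by (simp add: inner_diff_left dist_norm)
    qed
    obtain a0 where a0: "a0 \<in> X i" using ne by blast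
    have bdd: "bdd_below (X i)" "bdd_above (X i)"
      using dX[OF a0] by (auto intro!: bdd_belowI[of _ "a0 - \<eta> * r"] bdd_aboveI[of _ "a0 + \<eta> * r"] simp: abs_le_iff algebra_simps)
    have "Inf (X i) < p \<bullet> u" "p \<bullet> u < Sup (X i)" using pJ by (auto simp: J_def)
    then obtain a b where "a \<in> X i" "a < p \<bullet> u" "b \<in> X i" "p \<bullet> u < b"
      using ne bdd by (auto simp: cInf_less_iff less_cSup_iff)
    then have "p \<bullet> u \<in> X i" using int unfolding is_interval_1 by (meson less_imp_le)
    then obtain x where x: "x \<in> B i" "x \<bullet> u = p \<bullet> u" by (auto simp: X_def)
    have orth: "(x - p) \<bullet> u = 0" using x by (simp add: inner_diff_left)
    then have "x - p = perp u (x - zz i) - perp u (p - zz i)" by (simp add: perp_diff[symmetric]) (simp add: perp_def)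
    then have "norm (x - p) \<le> norm (perp u (x - zz i)) + norm (perp u (p - zz i))"
      by (metis norm_triangle_ineq4)
    also have "\<dots> \<le> \<eta> * r + (1 - 2 * \<eta>) * r"
      using norm_perp_le[OF u, of "x - zz i"] B(4)[OF x(1) zi] pJ(2) by (intro add_mono) (auto simp: dist_norm)
    also have "\<dots> = r - \<eta> * r" by (simp add: algebra_simps)
    also have "\<dots> < r" using \<eta> r by simp
    finally show ?thesis using x(1) orth by blast
  qed
  have "disjoint_family cyl"
    unfolding disjoint_family_on_def
  proof (intro ballI impI)
    fix i j :: nat assume ij: "i \<noteq> j"
    show "cyl i \<inter> cyl j = {}"
    proof (rule ccontr)
      assume "cyl i \<inter> cyl j \<noteq> {}"
      then obtain p where p: "p \<in> cyl i" "p \<in> cyl j" by blast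
      obtain x where x: "x \<in> B i" "(x - p) \<bullet> u = 0" "norm (x - p) < r" using hit[OF p(1)] by blast
      obtain y where y: "y \<in> B j" "(y - p) \<bullet> u = 0" "norm (y - p) < r" using hit[OF p(2)] by blast
      have "good i" using p(1) by (auto simp: cyl_def split: if_splits)
      \<comment> \<open>Two crossing points of one disc are less than 2 r < \<delta> apart, so they
        coincide, against the disjointness of the pieces.\<close>
      have "dist x y \<le> norm (x - p) + norm (y - p)"
        using dist_triangle2[of x y p] by (simp add: dist_norm)
      then have "dist x y < \<delta>" using x y r by linarith
      then have "tangent_approx \<epsilon> t x x y" using x(1) y(1) B(2) \<eta>r r by (intro t) auto
      moreover have "(y - x) \<bullet> u = 0" using x(2) y(2) by (simp add: inner_diff_left)
      ultimately have "y = x" using t_large[OF \<open>good i\<close> x(1)] by (intro crossing_unique[OF u])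
      then have "x \<in> B i \<inter> B j" using x(1) y(1) by simp
      then show False using B(1) ij by (auto simp: disjoint_family_on_def)
    qed
  qed
  have len: "diameter (B i) * (\<bar>t (zz i) \<bullet> u\<bar> - 3 * \<epsilon>) \<le> Sup (X i) - Inf (X i)" if g: "good i" for i
  proof -
    have zi: "zz i \<in> B i" using z g by (simp add: good_def)
    have \<tau>: "\<bar>t (zz i) \<bullet> u\<bar> - 3 * \<epsilon> > 0" using g by (simp add: good_def)
    have bd: "bdd_below (X i)" "bdd_above (X i)"
    proof -
      have "\<bar>x \<bullet> u - zz i \<bullet> u\<bar> \<le> \<eta> * r" if "x \<in> B i" for x
        using Cauchy_Schwarz_ineq2[of "x - zz i" u] B(4)[OF that zi] u by (simp add: inner_diff_left dist_norm)
      then show "bdd_below (X i)" "bdd_above (X i)"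
        by (auto simp: X_def abs_le_iff algebra_simps intro!: bdd_belowI[of _ "zz i \<bullet> u - \<eta> * r"] bdd_aboveI[of _ "zz i \<bullet> u + \<eta> * r"])
    qed
    have "dist x y \<le> (Sup (X i) - Inf (X i)) / (\<bar>t (zz i) \<bullet> u\<bar> - 3 * \<epsilon>)" if "x \<in> B i" "y \<in> B i" for x y
    proof -
      have "norm (x - y) * (\<bar>t (zz i) \<bullet> u\<bar> - \<epsilon>) \<le> \<bar>(x - y) \<bullet> u\<bar>"
        using ta[OF that(2) zi that(1)] by (simp add: algebra_simps)
      moreover have "norm (x - y) * (\<bar>t (zz i) \<bullet> u\<bar> - 3 * \<epsilon>) \<le> norm (x - y) * (\<bar>t (zz i) \<bullet> u\<bar> - \<epsilon>)"
        using \<epsilon> by (intro mult_left_mono) auto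
      moreover have "\<bar>(x - y) \<bullet> u\<bar> \<le> Sup (X i) - Inf (X i)"
      proof -
        have "x \<bullet> u \<in> X i" "y \<bullet> u \<in> X i" using that by (auto simp: X_def)
        then have "x \<bullet> u \<le> Sup (X i)" "y \<bullet> u \<le> Sup (X i)" "Inf (X i) \<le> x \<bullet> u" "Inf (X i) \<le> y \<bullet> u"
          using bd by (auto intro: cSup_upper cInf_lower)
        then show ?thesis by (simp add: inner_diff_left abs_le_iff)
      qed
      ultimately show ?thesis using \<tau> by (simp add: dist_norm pos_le_divide_eq)
    qed
    moreover have "0 \<le> (Sup (X i) - Inf (X i)) / (\<bar>t (zz i) \<bullet> u\<bar> - 3 * \<epsilon>)"
      using calculation[OF zi zi] by simp
    ultimately have "diameter (B i) \<le> (Sup (X i) - Inf (X i)) / (\<bar>t (zz i) \<bullet> u\<bar> - 3 * \<epsilon>)"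
      by (intro diameter_le_of_dist_le)
    then show ?thesis using \<tau> by (simp add: pos_le_divide_eq)
  qed
  have bB: "bounded (B i)" for i using B(4) unfolding bounded_two_points by blast
  have summand: "ennreal (diameter (B i)) * ennreal (\<bar>t (zz i) \<bullet> u\<bar> - 3 * \<epsilon>) * ?c \<le> emeasure lborel (cyl i)" for i
  proof (cases "good i")
    case True
    have d0: "diameter (B i) \<ge> 0" by (rule diameter_ge_0[OF bB])
    have \<tau>: "\<bar>t (zz i) \<bullet> u\<bar> - 3 * \<epsilon> > 0" using True by (simp add: good_def)
    have SI: "Inf (X i) \<le> Sup (X i)" using len[OF True] d0 \<tau> by (smt (verit) mult_nonneg_nonneg)
    have "emeasure lborel (cyl i) = emeasure lborel (J i) * ?c"
    proof -
      have "J i \<in> sets borel" "0 < (1 - 2 * \<eta>) * r" using \<eta> r by (simp_all add: J_def)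
      from emeasure_cylinder[OF u this] show ?thesis by (simp only: cyl_def True if_True)
    qed
    also have "emeasure lborel (J i) = ennreal (Sup (X i) - Inf (X i))"
      unfolding J_def using SI by simp
    finally have "emeasure lborel (cyl i) = ennreal (Sup (X i) - Inf (X i)) * ?c" .
    moreover have "ennreal (diameter (B i)) * ennreal (\<bar>t (zz i) \<bullet> u\<bar> - 3 * \<epsilon>) \<le> ennreal (Sup (X i) - Inf (X i))"
      using len[OF True] d0 \<tau> by (simp add: ennreal_mult[symmetric] ennreal_leI)
    ultimately show ?thesis by (simp add: mult_right_mono)
  next
    case False
    \<comment> \<open>\<open>ennreal\<close> of a negative number is 0, so the remaining pieces
      contribute nothing to the left side.\<close>
    then have "B i = {} \<or> \<bar>t (zz i) \<bullet> u\<bar> - 3 * \<epsilon> \<le> 0" by (auto simp: good_def)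
    then show ?thesis by (auto simp: ennreal_neg)
  qed
  have "(\<Sum>i. ennreal (diameter (B i)) * ennreal (\<bar>t (zz i) \<bullet> u\<bar> - 3 * \<epsilon>)) * ?c =
      (\<Sum>i. ennreal (diameter (B i)) * ennreal (\<bar>t (zz i) \<bullet> u\<bar> - 3 * \<epsilon>) * ?c)"
    by simp
  also have "\<dots> \<le> (\<Sum>i. emeasure lborel (cyl i))"
    by (intro suminf_le summand summableI)
  also have "\<dots> = emeasure lborel (\<Union>i. cyl i)"
    using \<open>disjoint_family cyl\<close> cyl_sets by (intro suminf_emeasure) auto
  also have "\<dots> \<le> emeasure lborel {p. (p, u, r) \<in> crossing_discs (\<Union>i. B i) t \<epsilon> r0}"
  proof (rule emeasure_mono)
    show "(\<Union>i. cyl i) \<subseteq> {p. (p, u, r) \<in> crossing_discs (\<Union>i. B i) t \<epsilon> r0}"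
    proof
      fix p assume "p \<in> (\<Union>i. cyl i)"
      then obtain i where p: "p \<in> cyl i" by blast
      obtain x where x: "x \<in> B i" "(x - p) \<bullet> u = 0" "norm (x - p) < r" using hit[OF p] by blast
      have "good i" using p by (auto simp: cyl_def split: if_splits)
      then have "\<epsilon> < \<bar>t x \<bullet> u\<bar>" using x(1) by (rule t_large)
      then show "p \<in> {p. (p, u, r) \<in> crossing_discs (\<Union>i. B i) t \<epsilon> r0}"
        using x u r(1,2) unfolding crossing_discs_def by blast
    qed
    have [measurable]: "crossing_discs (\<Union>i. B i) t \<epsilon> r0 \<in> sets (borel \<Otimes>\<^sub>M borel \<Otimes>\<^sub>M borel)"
      using sets unfolding borel_prod by assumption
    show "{p. (p, u, r) \<in> crossing_discs (\<Union>i. B i) t \<epsilon> r0} \<in> sets lborel"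
      by measurable
  qed
  finally show ?thesis .
qed

lemma hausdorff_content_1_finite:
  fixes F :: "'a::metric_space set"
  assumes F: "finite F" and \<delta>: "\<delta> > 0"
  shows "hausdorff_content 1 \<delta> F = 0"
  using F
proof (induction F rule: finite_induct)
  case empty
  show ?case by (rule hausdorff_content_empty[OF \<delta>])
next
  case (insert x F)
  have "hausdorff_content 1 \<delta> {x} \<le> (\<Sum>i::nat. hausdorff_weight 1 {x})"
    using \<delta> by (intro hausdorff_content_le_suminf) auto
  also have "\<dots> = 0" by (simp add: hausdorff_weight_def)
  finally have "hausdorff_content 1 \<delta> {x} = 0" by simp
  then show ?case
    using hausdorff_content_Un_le[OF \<delta>, of 1 "{x}" F] insert.IH by simp
qed

text \<open>Truncation of negative values by \<open>ennreal\<close> can only help: the truncated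
  difference plus \<open>c\<close> is still at least the absolute value of the inner
  product.\<close>

lemma nn_integral_direction_inner_diff:
  fixes b :: "'a::euclidean_space"
  assumes b: "norm b = 1" and c: "c \<ge> 0"
  shows "ennreal (2 * unit_ball_vol (real (DIM('a) - 1)) - c * direction_mass TYPE('a)) \<le>
    ennreal (real DIM('a)) * (\<integral>\<^sup>+x. ennreal (\<bar>b \<bullet> (x /\<^sub>R norm x)\<bar> - c) * indicator (cball 0 1) x \<partial>lborel)"
proof -
  let ?n = "ennreal (real DIM('a))"
  let ?I = "?n * (\<integral>\<^sup>+x. ennreal (\<bar>b \<bullet> (x /\<^sub>R norm x)\<bar> - c) * indicator (cball 0 1) x \<partial>lborel)"
  have [measurable]: "cball (0::'a) 1 \<in> sets borel" by simp
  have "?n * (\<integral>\<^sup>+x. ennreal (\<bar>b \<bullet> (x /\<^sub>R norm x)\<bar> + 0) * indicator (cball 0 1) x \<partial>lborel) \<le>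
      ?n * (\<integral>\<^sup>+x. ennreal (\<bar>b \<bullet> (x /\<^sub>R norm x)\<bar> - c) * indicator (cball 0 1) x + ennreal c * indicator (cball (0::'a) 1) x \<partial>lborel)"
  proof (intro mult_left_mono nn_integral_mono)
    fix x :: 'a
    have "ennreal \<bar>b \<bullet> (x /\<^sub>R norm x)\<bar> \<le> ennreal (\<bar>b \<bullet> (x /\<^sub>R norm x)\<bar> - c) + ennreal c"
    proof (cases "\<bar>b \<bullet> (x /\<^sub>R norm x)\<bar> \<le> c")
      case True
      then show ?thesis by (intro add_increasing ennreal_leI) auto
    next
      case False
      then show ?thesis using c by (subst ennreal_plus[symmetric]) auto
    qed
    then show "ennreal (\<bar>b \<bullet> (x /\<^sub>R norm x)\<bar> + 0) * indicator (cball 0 1) x \<le>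
        ennreal (\<bar>b \<bullet> (x /\<^sub>R norm x)\<bar> - c) * indicator (cball 0 1) x + ennreal c * indicator (cball (0::'a) 1) x"
      by (simp add: indicator_def)
  qed simp
  also have "\<dots> = ?I + ennreal (c * direction_mass TYPE('a))"
    using nn_integral_direction_const[OF c, where 'a = 'a]
    by (subst nn_integral_add) (auto simp: distrib_left)
  finally have "ennreal (2 * unit_ball_vol (real (DIM('a) - 1))) \<le> ?I + ennreal (c * direction_mass TYPE('a))"
    using nn_integral_direction_inner_add[OF b, of 0] by simp
  then have "ennreal (2 * unit_ball_vol (real (DIM('a) - 1))) - ennreal (c * direction_mass TYPE('a)) \<le> ?I"
    by (simp add: ennreal_minus_le_iff add.commute)
  then show ?thesis
    using c direction_mass_nonneg[where 'a = 'a] by (simp add: ennreal_minus)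
qed

text \<open>The pieces of \<open>curve_partition\<close> cover \<open>M - F\<close>, and the finite
  set \<open>F\<close> has one-dimensional content 0. Hence the sum of their diameters is bounded
  below by the content of \<open>M\<close> at the scale \<eta> r, which becomes the measure only as
  \<eta> tends to 0.\<close>

lemma crofton_lower_bound_eps:
  fixes M :: "'a::euclidean_space set"
  assumes M: "compact M" "C1_curve_with_boundary M" and F: "finite F" and t: "curve_orientation M t"
    and r: "0 < r" "r < r0" "2 * r < \<delta>" and \<epsilon>: "\<epsilon> > 0" and \<eta>: "0 < \<eta>" "\<eta> < 1/2"
    and \<delta>: "\<And>y z w. y \<in> M \<Longrightarrow> z \<in> M \<Longrightarrow> w \<in> M \<Longrightarrow> dist y z < \<delta> \<Longrightarrow> dist y w < \<delta> \<Longrightarrow> tangent_approx \<epsilon> t y z w"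
  defines "V \<equiv> unit_ball_vol (real (DIM('a) - 1))"
  shows "hausdorff_content 1 (\<eta> * r) M * (ennreal (2 * V - 3 * \<epsilon> * direction_mass TYPE('a)) * ennreal (V * ((1 - 2 * \<eta>) * r) ^ (DIM('a) - 1)))
    \<le> ennreal (real DIM('a)) * (\<integral>\<^sup>+x. emeasure lborel {p. (p, x /\<^sub>R norm x, r) \<in> crossing_discs (M - F) t \<epsilon> r0} * indicator (cball 0 1) x \<partial>lborel)"
proof -
  have \<eta>r: "\<eta> * r > 0" using \<eta> r by simp
  obtain B :: "nat \<Rightarrow> 'a set" where B: "disjoint_family B" "(\<Union>i. B i) = M - F" "\<And>i. connected (B i)"
    "\<And>i x y. x \<in> B i \<Longrightarrow> y \<in> B i \<Longrightarrow> dist x y \<le> \<eta> * r"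
    by (rule curve_partition[OF M F \<eta>r]) (rule that)
  have bB: "bounded (B i)" for i using B(4) unfolding bounded_two_points by blast
  have "hausdorff_content 1 (\<eta> * r) M \<le> hausdorff_content 1 (\<eta> * r) (F \<union> (M - F))"
    by (rule hausdorff_content_mono) blast
  also have "\<dots> \<le> hausdorff_content 1 (\<eta> * r) F + hausdorff_content 1 (\<eta> * r) (M - F)"
    by (rule hausdorff_content_Un_le[OF \<eta>r])
  also have "\<dots> = hausdorff_content 1 (\<eta> * r) (M - F)"
    by (simp only: hausdorff_content_1_finite[OF F \<eta>r] add_0)
  also have "\<dots> \<le> (\<Sum>i. hausdorff_weight 1 (B i))"
  proof (rule hausdorff_content_le_suminf)
    show "diameter (B i) \<le> \<eta> * r" for i using B(4) \<eta>r by (intro diameter_le_of_dist_le) auto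
  qed (use B(2) bB in auto)
  also have "\<dots> = (\<Sum>i. ennreal (diameter (B i)))"
    by (simp only: hausdorff_weight_1[OF bB])
  finally have content: "hausdorff_content 1 (\<eta> * r) M \<le> (\<Sum>i. ennreal (diameter (B i)))" .
  have sets: "crossing_discs (\<Union>i. B i) t \<epsilon> r0 \<in> sets borel"
    unfolding B(2) using t by (intro sets_crossing_discs M F) (simp add: curve_orientation_def)
  define e0 :: 'a where "e0 = (SOME b. b \<in> Basis)"
  have e0: "norm e0 = 1" unfolding e0_def by (intro norm_Basis SOME_Basis)
  define zz where "zz i = (SOME z. z \<in> B i)" for i
  have zz: "zz i \<in> B i" if "B i \<noteq> {}" for i
    unfolding zz_def by (rule someI_ex[of "\<lambda>z. z \<in> B i"]) (use that in blast)
  define t' where "t' y = (if y \<in> M then t y else e0)" for y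
  have t'1: "norm (t' y) = 1" for y using t e0 by (auto simp: t'_def curve_orientation_def)
  have t': "tangent_approx \<epsilon> t' y z w" if "y \<in> M" "z \<in> M" "w \<in> M" "dist y z < \<delta>" "dist y w < \<delta>" for y z w
    using \<delta>[OF that] that(1) by (simp add: tangent_approx_def t'_def)
  have cross_t': "crossing_discs (\<Union>i. B i) t' \<epsilon> r0 = crossing_discs (\<Union>i. B i) t \<epsilon> r0"
    unfolding B(2) crossing_discs_def t'_def by auto
  have [measurable]: "cball (0::'a) 1 \<in> sets borel" by simp
  let ?n = "ennreal (real DIM('a))"
  let ?c = "ennreal (V * ((1 - 2 * \<eta>) * r) ^ (DIM('a) - 1))"
  let ?k = "ennreal (2 * V - 3 * \<epsilon> * direction_mass TYPE('a))"
  let ?f = "\<lambda>i x. ennreal (diameter (B i)) * (ennreal (\<bar>t' (zz i) \<bullet> (x /\<^sub>R norm x)\<bar> - 3 * \<epsilon>) * indicator (cball 0 1) x)"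
  have "hausdorff_content 1 (\<eta> * r) M * (?k * ?c) \<le> (\<Sum>i. ennreal (diameter (B i))) * (?k * ?c)"
    by (rule mult_right_mono[OF content]) simp
  also have "\<dots> = (\<Sum>i. ennreal (diameter (B i)) * ?k) * ?c"
    by (simp add: mult.assoc)
  also have "\<dots> \<le> (\<Sum>i. ?n * (\<integral>\<^sup>+x. ?f i x \<partial>lborel)) * ?c"
  proof (intro mult_right_mono suminf_le summableI)
    fix i
    have "ennreal (diameter (B i)) * ?k \<le> ennreal (diameter (B i)) *
        (?n * (\<integral>\<^sup>+x. ennreal (\<bar>t' (zz i) \<bullet> (x /\<^sub>R norm x)\<bar> - 3 * \<epsilon>) * indicator (cball 0 1) x \<partial>lborel))"
      unfolding V_def using \<epsilon> by (intro mult_left_mono nn_integral_direction_inner_diff t'1) auto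
    also have "\<dots> = ?n * (ennreal (diameter (B i)) * (\<integral>\<^sup>+x. ennreal (\<bar>t' (zz i) \<bullet> (x /\<^sub>R norm x)\<bar> - 3 * \<epsilon>) * indicator (cball 0 1) x \<partial>lborel))"
      by (simp only: mult_ac)
    also have "\<dots> = ?n * (\<integral>\<^sup>+x. ?f i x \<partial>lborel)"
      by (subst nn_integral_cmult) auto
    finally show "ennreal (diameter (B i)) * ?k \<le> ?n * (\<integral>\<^sup>+x. ?f i x \<partial>lborel)" .
  qed simp
  also have "\<dots> = ?n * ((\<Sum>i. \<integral>\<^sup>+x. ?f i x \<partial>lborel) * ?c)"
    by (simp add: mult.assoc)
  also have "(\<Sum>i. \<integral>\<^sup>+x. ?f i x \<partial>lborel) = (\<integral>\<^sup>+x. (\<Sum>i. ?f i x) \<partial>lborel)"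
    by (rule nn_integral_suminf[symmetric]) measurable
  also have "(\<integral>\<^sup>+x. (\<Sum>i. ?f i x) \<partial>lborel) * ?c = (\<integral>\<^sup>+x. (\<Sum>i. ?f i x) * ?c \<partial>lborel)"
    by (rule nn_integral_multc[symmetric]) measurable
  also have "?n * \<dots> \<le> ?n * (\<integral>\<^sup>+x. emeasure lborel {p. (p, x /\<^sub>R norm x, r) \<in> crossing_discs (M - F) t \<epsilon> r0} * indicator (cball 0 1) x \<partial>lborel)"
  proof (rule mult_left_mono, rule nn_integral_mono_AE)
    have "AE x in lborel. x \<noteq> (0::'a)" by (rule AE_lborel_singleton)
    then show "AE x in lborel. (\<Sum>i. ?f i x) * ?c \<le> emeasure lborel {p. (p, x /\<^sub>R norm x, r) \<in> crossing_discs (M - F) t \<epsilon> r0} * indicator (cball 0 1) x"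
    proof eventually_elim
      case (elim x)
      then have u: "norm (x /\<^sub>R norm x) = 1" by simp
      show ?case
      proof (cases "x \<in> cball 0 1")
        case True
        have "(\<Sum>i. ennreal (diameter (B i)) * ennreal (\<bar>t' (zz i) \<bullet> (x /\<^sub>R norm x)\<bar> - 3 * \<epsilon>)) * ?c \<le>
            emeasure lborel {p. (p, x /\<^sub>R norm x, r) \<in> crossing_discs (\<Union>i. B i) t' \<epsilon> r0}"
          unfolding V_def
        proof (rule slice_lower_bound[OF u r \<epsilon> \<eta> t' B(1) _ B(3,4) zz])
          show "(\<Union>i. B i) \<subseteq> M" using B(2) by blast
          show "crossing_discs (\<Union>i. B i) t' \<epsilon> r0 \<in> sets borel" unfolding cross_t' by (rule sets)
        qed
        note * = this[unfolded cross_t', unfolded B(2)]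
        from True * show ?thesis by simp
      qed simp
    qed
  qed simp
  finally show ?thesis .
qed

theorem crofton_lower_bound:
  fixes M :: "'a::euclidean_space set"
  assumes M: "compact M" "C1_curve_with_boundary M" and F: "finite F" and t: "curve_orientation M t"
    and r: "0 < r" "r < r0" "2 * r < \<delta>" and \<epsilon>: "\<epsilon> > 0"
    and \<delta>: "\<And>y z w. y \<in> M \<Longrightarrow> z \<in> M \<Longrightarrow> w \<in> M \<Longrightarrow> dist y z < \<delta> \<Longrightarrow> dist y w < \<delta> \<Longrightarrow> tangent_approx \<epsilon> t y z w"
  defines "V \<equiv> unit_ball_vol (real (DIM('a) - 1))"
  assumes pos: "2 * V - 3 * \<epsilon> * direction_mass TYPE('a) > 0"
  shows "hausdorff 1 M * ennreal ((2 * V - 3 * \<epsilon> * direction_mass TYPE('a)) * (V * r ^ (DIM('a) - 1)))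
    \<le> ennreal (real DIM('a)) * (\<integral>\<^sup>+x. emeasure lborel {p. (p, x /\<^sub>R norm x, r) \<in> crossing_discs (M - F) t \<epsilon> r0} * indicator (cball 0 1) x \<partial>lborel)"
    (is "_ \<le> ?R")
proof -
  let ?k = "2 * V - 3 * \<epsilon> * direction_mass TYPE('a)"
  let ?a = "\<lambda>i::nat. inverse (real (Suc i))"
  let ?g = "\<lambda>i. ?k * (V * ((1 - 2 * (?a i / r)) * r) ^ (DIM('a) - 1))"
  have V: "V > 0" by (simp add: V_def)
  have a0: "?a \<longlonglongrightarrow> 0" by (rule LIMSEQ_inverse_real_of_nat)
  have "?g \<longlonglongrightarrow> ?k * (V * ((1 - 2 * (0 / r)) * r) ^ (DIM('a) - 1))"
    using r by (intro tendsto_intros a0) auto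
  then have "?g \<longlonglongrightarrow> ?k * (V * r ^ (DIM('a) - 1))" by simp
  then have lim: "(\<lambda>i. hausdorff_content 1 (?a i) M * ennreal (?g i)) \<longlonglongrightarrow> hausdorff 1 M * ennreal (?k * (V * r ^ (DIM('a) - 1)))"
    using pos V r by (intro tendsto_mult_ennreal hausdorff_content_LIMSEQ tendsto_ennrealI) auto
  have "eventually (\<lambda>i. ?a i < r / 2) sequentially"
    using order_tendstoD(2)[OF a0, of "r / 2"] r by simp
  then have "eventually (\<lambda>i. hausdorff_content 1 (?a i) M * ennreal (?g i) \<le> ?R) sequentially"
  proof eventually_elim
    case (elim i)
    \<comment> \<open>\<eta> = 1 / ((i + 1) r) turns the scale \<eta> r into 1 / (i + 1), along
      which the contents converge to the measure.\<close>
    have \<eta>: "0 < ?a i / r" "?a i / r < 1 / 2" using elim r by (auto simp: field_simps)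
    have "hausdorff_content 1 (?a i / r * r) M * (ennreal ?k * ennreal (V * ((1 - 2 * (?a i / r)) * r) ^ (DIM('a) - 1))) \<le> ?R"
      unfolding V_def by (rule crofton_lower_bound_eps[OF M F t r \<epsilon> \<eta> \<delta>])
    moreover have "?a i / r * r = ?a i" using r by simp
    moreover have "ennreal ?k * ennreal (V * ((1 - 2 * (?a i / r)) * r) ^ (DIM('a) - 1)) = ennreal (?g i)"
      using pos by (intro ennreal_mult'[symmetric]) simp
    ultimately show ?case by (simp only:)
  qed
  with lim show ?thesis
    by (intro tendsto_upperbound[OF lim]) auto
qed

text \<open>All points of a closed disc of radius r < r0 are within 2 r0 \<le> \<delta> of the
  crossing point, so no other point of the closure lies on it. This excludes boundary points,
  tangencies and contact with the rim at once, and the count is 1.\<close>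

lemma crossing_subset_discs_odd:
  fixes C :: "'a::euclidean_space set"
  assumes adm: "admissible_curve C t" and n: "DIM('a) \<ge> 2" and r0: "2 * r0 \<le> \<delta>" and \<epsilon>: "\<epsilon> > 0"
    and \<delta>: "\<And>y z w. y \<in> closure C \<Longrightarrow> z \<in> closure C \<Longrightarrow> w \<in> closure C \<Longrightarrow> dist y z < \<delta> \<Longrightarrow> dist y w < \<delta> \<Longrightarrow> tangent_approx \<epsilon> t y z w"
  shows "crossing_discs (closure C - curve_boundary (closure C)) t \<epsilon> r0 \<subseteq> discs_odd C t"
proof
  let ?M = "closure C" and ?F = "curve_boundary (closure C)"
  fix x assume x: "x \<in> crossing_discs (?M - ?F) t \<epsilon> r0"
  obtain p u r where pur: "x = (p, u, r)" by (cases x)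
  from x pur obtain z where u: "norm u = 1" and r: "0 < r" "r < r0" and z: "z \<in> ?M" "z \<notin> ?F" "(z - p) \<bullet> u = 0" "norm (z - p) < r" "\<epsilon> < \<bar>t z \<bullet> u\<bar>"
    by (auto simp: crossing_discs_def)
  have unique: "w = z" if w: "w \<in> ?M" "w \<in> closed_disc p u r" for w
  proof (rule crossing_unique[OF u])
    have w': "(w - p) \<bullet> u = 0" "norm (w - p) \<le> r" using w(2) r n by (simp_all add: closed_disc_iff)
    have "dist z w \<le> norm (z - p) + norm (w - p)" using dist_triangle2[of z w p] by (simp add: dist_norm)
    then have "dist z w < \<delta>" using w' z r r0 by linarith
    then show "tangent_approx \<epsilon> t z z w" using z(1) w(1) r r0 by (intro \<delta>) auto
    show "(w - z) \<bullet> u = 0" using w'(1) z(3) by (simp add: inner_diff_left)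
  qed (rule z(5))
  have CM: "C \<subseteq> ?M" by (rule closure_subset)
  have FM: "?F \<subseteq> ?M" by (auto simp: curve_boundary_def)
  have zC: "z \<in> C" using z(1,2) adm unfolding admissible_curve_def by blast
  have sub: "disc p u r \<subseteq> closed_disc p u r" "disc_boundary p u r \<subseteq> closed_disc p u r" by (auto simp: closed_disc_def)
  have zd: "z \<in> disc p u r" using z r n by (simp add: disc_iff)
  have D: "x \<in> discs" using u r by (simp add: pur discs_def)
  have 1: "x \<notin> discs_boundary_pt C" using unique FM z(2) by (auto simp: discs_boundary_pt_def pur)
  have 2: "x \<notin> discs_tan C t" using unique z(5) \<epsilon> by (auto simp: discs_tan_def pur)
  have 3: "x \<notin> discs_touching C"
  proof
    assume "x \<in> discs_touching C"
    then obtain w where w: "w \<in> disc_boundary p u r" "w \<in> C" by (auto simp: discs_touching_def pur)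
    then have "w = z" using unique CM sub by blast
    then show False using w(1) z(4) r by (simp add: disc_boundary_iff)
  qed
  have "disc p u r \<inter> C = {z}" using unique zC zd CM sub by blast
  then have "hausdorff 0 (disc p u r \<inter> C) = of_nat 1" by (simp add: hausdorff_0_singleton)
  then have "\<exists>m::nat. odd m \<and> hausdorff 0 (disc p u r \<inter> C) = of_nat m" by (intro exI[of _ 1]) auto
  with D 1 2 3 show "x \<in> discs_odd C t" by (auto simp: discs_odd_def pur)
qed

section \<open>The limit\<close>

lemma nn_integral_powr_from_0:
  assumes "0 < \<sigma>" "\<sigma> < 1" "a > 0"
  shows "(\<integral>\<^sup>+r. ennreal (r powr (-\<sigma>)) * indicator {0..a} r \<partial>lborel) = ennreal (a powr (1 - \<sigma>) / (1 - \<sigma>))"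
proof -
  have "((\<lambda>r. r powr (-\<sigma>)) has_integral (a powr (-\<sigma> + 1) / (-\<sigma> + 1))) {0..a}"
    using assms by (intro has_integral_powr_from_0) auto
  then have "(\<integral>\<^sup>+r. ennreal (indicator {0..a} r * r powr (-\<sigma>)) \<partial>lborel) = ennreal (a powr (-\<sigma> + 1) / (-\<sigma> + 1))"
    by (intro nn_integral_has_integral_lebesgue) auto
  moreover have "ennreal (indicator {0..a} r * r powr (-\<sigma>)) = ennreal (r powr (-\<sigma>)) * indicator {0..a} r" for r
    by (simp add: indicator_def)
  ultimately show ?thesis by simp
qed

lemma nn_integral_powr_to_inf:
  assumes "0 < \<sigma>" "a > 0"
  shows "(\<integral>\<^sup>+r. ennreal (r powr (-1 - \<sigma>)) * indicator {a..} r \<partial>lborel) = ennreal (a powr (-\<sigma>) / \<sigma>)"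
proof -
  have "((\<lambda>r. r powr (-1 - \<sigma>)) has_integral (- (a powr (-1 - \<sigma> + 1)) / (-1 - \<sigma> + 1))) {a..}"
    using assms by (intro has_integral_powr_to_inf) auto
  then have "(\<integral>\<^sup>+r. ennreal (indicator {a..} r * r powr (-1 - \<sigma>)) \<partial>lborel) = ennreal (- (a powr (-1 - \<sigma> + 1)) / (-1 - \<sigma> + 1))"
    by (intro nn_integral_has_integral_lebesgue) auto
  moreover have "ennreal (indicator {a..} r * r powr (-1 - \<sigma>)) = ennreal (r powr (-1 - \<sigma>)) * indicator {a..} r" for r
    by (simp add: indicator_def)
  ultimately show ?thesis by simp
qed

text \<open>With the weight exponent 1 - n - \<sigma> the powers r^(n-1) and r^(n-2) become r powr
  (- \<sigma>), integrable at 0, and r powr (- 1 - \<sigma>), integrable at infinity.\<close>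

lemma powr_mult_nat_power:
  assumes "r > 0" "real k + e = f"
  shows "r powr e * r ^ k = r powr f"
  using assms by (simp add: powr_add[symmetric] powr_realpow[symmetric] add.commute)

definition hyperplane_ball_vol :: "'a::euclidean_space itself \<Rightarrow> real" where
  "hyperplane_ball_vol _ = unit_ball_vol (real (DIM('a) - 1))"

lemma hyperplane_ball_vol_pos: "hyperplane_ball_vol TYPE('a::euclidean_space) > 0"
  by (simp add: hyperplane_ball_vol_def)

lemma discs_odd_meeting:
  fixes C :: "'a::euclidean_space set"
  assumes "(p, u, r) \<in> discs_odd C t" and n: "DIM('a) \<ge> 2"
  shows "(p, u, r) \<in> meeting_discs (closure C)"
proof -
  have ur: "norm u = 1" "r > 0" using assms by (auto simp: discs_odd_def discs_def)
  from assms obtain m :: nat where m: "odd m" "hausdorff 0 (disc p u r \<inter> C) = of_nat m" by (auto simp: discs_odd_def)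
  have "disc p u r \<inter> C \<noteq> {}"
  proof
    assume "disc p u r \<inter> C = {}"
    then have "of_nat m = (0::ennreal)" using m(2) by simp
    then have "m = 0" by simp
    then show False using m(1) by simp
  qed
  then obtain z where "z \<in> disc p u r" "z \<in> closure C" using closure_subset[of C] by blast
  then show ?thesis using ur n by (auto simp: meeting_discs_def disc_iff)
qed

text \<open>The centre has the height of a curve point, which is at most \<open>R\<close> in size. A
  rim point in \<Omega> projects into the ball of radius \<open>R\<close>, so norm (perp u p)
  differs from \<open>r\<close> by at most \<open>R\<close>.\<close>

lemma discs_odd_far:
  fixes C :: "'a::euclidean_space set"
  assumes odd: "(p, u, r) \<in> discs_odd C t" and n: "DIM('a) \<ge> 2" and R: "\<And>x. x \<in> closure C \<Longrightarrow> norm x \<le> R" "\<And>x. x \<in> \<Omega> \<Longrightarrow> norm x \<le> R" "R > 0"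
    and a: "a \<in> unit_perp u" "p + r *\<^sub>R a \<in> \<Omega>"
  shows "(p, u, r) \<in> far_discs R"
proof -
  from discs_odd_meeting[OF odd n] obtain z where z: "norm u = 1" "r > 0" "z \<in> closure C" "(z - p) \<bullet> u = 0"
    by (auto simp: meeting_discs_def)
  have "p \<bullet> u = z \<bullet> u" using z(4) by (simp add: inner_diff_left)
  also have "\<bar>z \<bullet> u\<bar> \<le> norm z * norm u" by (rule Cauchy_Schwarz_ineq2)
  finally have pu: "\<bar>p \<bullet> u\<bar> \<le> R" using R(1)[OF z(3)] z(1) by simp
  have a': "norm a = 1" "perp u a = a" using a(1) by (auto simp: unit_perp_iff perp_def)
  have "norm (perp u p + r *\<^sub>R a) = norm (perp u (p + r *\<^sub>R a))" by (simp add: perp_add perp_scaleR a')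
  also have "\<dots> \<le> norm (p + r *\<^sub>R a)" by (rule norm_perp_le[OF z(1)])
  also have "\<dots> \<le> R" by (rule R(2)[OF a(2)])
  finally have "norm (perp u p + r *\<^sub>R a) \<le> R" .
  moreover have "norm (r *\<^sub>R a) = r" using a' z by simp
  ultimately have "\<bar>norm (perp u p) - r\<bar> \<le> R"
    using norm_triangle_ineq2[of "perp u p" "- (r *\<^sub>R a)"] norm_triangle_ineq2[of "- (r *\<^sub>R a)" "perp u p"]
    by (simp add: norm_minus_commute abs_le_iff algebra_simps)
  then show ?thesis using z pu R(3) by (auto simp: far_discs_def abs_le_iff)
qed

lemma measurable_borel_hausdorff: "f \<in> borel_measurable borel \<Longrightarrow> f \<in> borel_measurable (hausdorff_measure k)"
  using measurable_compose[OF measurable_id_hausdorff] by blast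

lemma measurable_weight_indicator:
  fixes S :: "('a::euclidean_space \<times> 'a \<times> real) set" and w :: "real \<Rightarrow> real"
  assumes [measurable]: "w \<in> borel_measurable borel" "S \<in> sets borel"
  shows "(\<lambda>z. ennreal (w (snd (snd z))) * indicator S z) \<in> borel_measurable borel"
proof -
  have [measurable]: "(\<lambda>z::'a \<times> 'a \<times> real. w (snd (snd z))) \<in> borel_measurable borel"
    unfolding borel_prod[symmetric] by measurable
  show ?thesis by measurable
qed

section \<open>Contributions of small and of large radii\<close>

lemma sigma_length_near:
  fixes C :: "'a::euclidean_space set"
  assumes adm: "admissible_curve C t" and n: "DIM('a) \<ge> 2" and \<sigma>: "0 < \<sigma>" "\<sigma> < 1" and a: "a > 0"
  defines "w \<equiv> \<lambda>r. if r \<le> a then r powr (1 - real DIM('a) - \<sigma>) else 0"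
  shows "(\<integral>\<^sup>+z. ennreal (w (snd (snd z))) * indicator (meeting_discs (closure C)) z \<partial>hausdorff_measure (2 * DIM('a)))
    \<le> ennreal (2 * (hyperplane_ball_vol TYPE('a))\<^sup>2) * hausdorff 1 (closure C) * ennreal (a powr (1 - \<sigma>) / (1 - \<sigma>))"
proof -
  let ?M = "closure C" and ?H = "hausdorff 1 (closure C)"
  have M: "compact ?M" "curve_orientation ?M t" using adm by (auto simp: admissible_curve_def)
  have [measurable]: "w \<in> borel_measurable borel" unfolding w_def by measurable
  have sub: "meeting_discs ?M \<subseteq> discs" by (auto simp: meeting_discs_def discs_def)
  have "(\<integral>\<^sup>+z. ennreal (w (snd (snd z))) * indicator (meeting_discs ?M) z \<partial>hausdorff_measure (2 * DIM('a))) =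
    (\<integral>\<^sup>+r. ennreal (w r) * (ennreal (real DIM('a)) *
      (\<integral>\<^sup>+x. emeasure lborel {p. (p, x /\<^sub>R norm x, r) \<in> meeting_discs ?M} * indicator (cball 0 1) x \<partial>lborel)) \<partial>lborel)"
    by (rule nn_integral_weighted_discs[OF sets_meeting_discs[OF M(1)] sub]) measurable
  also have "\<dots> \<le> (\<integral>\<^sup>+r. ennreal (2 * (hyperplane_ball_vol TYPE('a))\<^sup>2) * ?H * (ennreal (r powr (-\<sigma>)) * indicator {0..a} r) \<partial>lborel)"
  proof (rule nn_integral_mono)
    fix r :: real
    let ?L = "ennreal (real DIM('a)) * (\<integral>\<^sup>+x. emeasure lborel {p. (p, x /\<^sub>R norm x, r) \<in> meeting_discs ?M} * indicator (cball 0 1) x \<partial>lborel)"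
    show "ennreal (w r) * ?L \<le> ennreal (2 * (hyperplane_ball_vol TYPE('a))\<^sup>2) * ?H * (ennreal (r powr (-\<sigma>)) * indicator {0..a} r)"
    proof (cases "0 < r \<and> r \<le> a")
      case True
      have "?L \<le> ennreal (2 * (hyperplane_ball_vol TYPE('a))\<^sup>2 * r ^ (DIM('a) - 1)) * ?H"
        unfolding hyperplane_ball_vol_def by (rule crofton_upper_bound[OF M]) (use True in simp)
      then have "ennreal (w r) * ?L \<le> ennreal (w r) * (ennreal (2 * (hyperplane_ball_vol TYPE('a))\<^sup>2 * r ^ (DIM('a) - 1)) * ?H)"
        by (rule mult_left_mono) simp
      also have "\<dots> = ennreal (w r * (2 * (hyperplane_ball_vol TYPE('a))\<^sup>2 * r ^ (DIM('a) - 1))) * ?H"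
        using True by (subst ennreal_mult) (auto simp: w_def mult.assoc)
      also have "w r * (2 * (hyperplane_ball_vol TYPE('a))\<^sup>2 * r ^ (DIM('a) - 1)) = 2 * (hyperplane_ball_vol TYPE('a))\<^sup>2 * (w r * r ^ (DIM('a) - 1))"
        by simp
      also have "w r * r ^ (DIM('a) - 1) = r powr (-\<sigma>)"
        unfolding w_def using True n by (simp add: powr_mult_nat_power of_nat_diff)
      also have "ennreal (2 * (hyperplane_ball_vol TYPE('a))\<^sup>2 * r powr (-\<sigma>)) * ?H = ennreal (2 * (hyperplane_ball_vol TYPE('a))\<^sup>2) * ?H * (ennreal (r powr (-\<sigma>)) * indicator {0..a} r)"
        using True by (simp add: ennreal_mult mult_ac)
      finally show ?thesis .
    next
      case False
      then consider "r \<le> 0" | "r > a" by linarith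
      then show ?thesis
      proof cases
        case 1
        then have "{p. (p, x /\<^sub>R norm x, r) \<in> meeting_discs ?M} = {}" for x by (auto simp: meeting_discs_def)
        then show ?thesis by simp
      qed (simp add: w_def)
    qed
  qed
  also have "\<dots> = ennreal (2 * (hyperplane_ball_vol TYPE('a))\<^sup>2) * ?H * (\<integral>\<^sup>+r. ennreal (r powr (-\<sigma>)) * indicator {0..a} r \<partial>lborel)"
    by (rule nn_integral_cmult) measurable
  finally show ?thesis by (simp only: nn_integral_powr_from_0[OF \<sigma> a])
qed

lemma sigma_length_far:
  assumes n: "DIM('a::euclidean_space) \<ge> 2" and R: "R > 0"
  obtains K where "K \<ge> 0" "\<And>\<sigma>. 0 < \<sigma> \<Longrightarrow>
    (\<integral>\<^sup>+z. ennreal (if 2 * R < snd (snd z) then snd (snd z) powr (1 - real DIM('a) - \<sigma>) else 0) * indicator (far_discs R :: ('a \<times> 'a \<times> real) set) z \<partial>hausdorff_measure (2 * DIM('a)))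
      \<le> ennreal (K * ((2 * R) powr (-\<sigma>) / \<sigma>))"
proof -
  define K0 where "K0 = 2 * R * (unit_ball_vol (real (DIM('a) - 1)) * (real (DIM('a) - 1) * (4 * R) * 2 ^ (DIM('a) - 2)))"
  have K0: "K0 \<ge> 0" using R by (simp add: K0_def)
  let ?m = "direction_mass TYPE('a)"
  have m0: "?m \<ge> 0" by (rule direction_mass_nonneg)
  show ?thesis
  proof (rule that[of "K0 * ?m"])
    show "K0 * ?m \<ge> 0" using K0 m0 by simp
    fix \<sigma> :: real assume \<sigma>: "0 < \<sigma>"
    define w where "w r = (if 2 * R < r then r powr (1 - real DIM('a) - \<sigma>) else 0)" for r
    have [measurable]: "w \<in> borel_measurable borel" unfolding w_def by measurable
    let ?F = "far_discs R :: ('a \<times> 'a \<times> real) set"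
    have sub: "?F \<subseteq> discs" by (auto simp: far_discs_def discs_def)
    have "(\<integral>\<^sup>+z. ennreal (w (snd (snd z))) * indicator ?F z \<partial>hausdorff_measure (2 * DIM('a))) =
      (\<integral>\<^sup>+r. ennreal (w r) * (ennreal (real DIM('a)) *
        (\<integral>\<^sup>+x. emeasure lborel {p. (p, x /\<^sub>R norm x, r) \<in> ?F} * indicator (cball 0 1) x \<partial>lborel)) \<partial>lborel)"
      by (rule nn_integral_weighted_discs[OF sets_far_discs sub]) measurable
    also have "\<dots> \<le> (\<integral>\<^sup>+r. ennreal (K0 * ?m) * (ennreal (r powr (-1 - \<sigma>)) * indicator {2 * R..} r) \<partial>lborel)"
    proof (rule nn_integral_mono)
      fix r :: real
      show "ennreal (w r) * (ennreal (real DIM('a)) *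
          (\<integral>\<^sup>+x. emeasure lborel {p. (p, x /\<^sub>R norm x, r) \<in> ?F} * indicator (cball 0 1) x \<partial>lborel))
        \<le> ennreal (K0 * ?m) * (ennreal (r powr (-1 - \<sigma>)) * indicator {2 * R..} r)"
      proof (cases "2 * R < r")
        case True
        have r: "r > 0" using True R by simp
        have "ennreal (real DIM('a)) * (\<integral>\<^sup>+x. emeasure lborel {p. (p, x /\<^sub>R norm x, r) \<in> ?F} * indicator (cball 0 1) x \<partial>lborel)
            \<le> ennreal (real DIM('a)) * (\<integral>\<^sup>+x. ennreal (K0 * r ^ (DIM('a) - 2)) * indicator (cball (0::'a) 1) x \<partial>lborel)"
          unfolding K0_def by (intro mult_left_mono nn_integral_mono mult_right_mono far_discs_slice R n True) auto
        also have "\<dots> = ennreal (K0 * r ^ (DIM('a) - 2) * ?m)"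
          using K0 r by (intro nn_integral_direction_const) simp
        finally have "ennreal (w r) * (ennreal (real DIM('a)) * (\<integral>\<^sup>+x. emeasure lborel {p. (p, x /\<^sub>R norm x, r) \<in> ?F} * indicator (cball 0 1) x \<partial>lborel))
            \<le> ennreal (w r) * ennreal (K0 * r ^ (DIM('a) - 2) * ?m)"
          by (rule mult_left_mono) simp
        also have "\<dots> = ennreal (K0 * ?m * (w r * r ^ (DIM('a) - 2)))"
          using K0 r m0 by (subst ennreal_mult[symmetric]) (auto simp: w_def mult_ac)
        also have "w r * r ^ (DIM('a) - 2) = r powr (-1 - \<sigma>)"
          unfolding w_def using True r n by (simp add: powr_mult_nat_power of_nat_diff)
        also have "ennreal (K0 * ?m * r powr (-1 - \<sigma>)) = ennreal (K0 * ?m) * (ennreal (r powr (-1 - \<sigma>)) * indicator {2 * R..} r)"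
          using True K0 m0 by (simp add: ennreal_mult)
        finally show ?thesis .
      qed (simp add: w_def)
    qed
    also have "\<dots> = ennreal (K0 * ?m) * (\<integral>\<^sup>+r. ennreal (r powr (-1 - \<sigma>)) * indicator {2 * R..} r \<partial>lborel)"
      by (rule nn_integral_cmult) measurable
    also have "\<dots> = ennreal (K0 * ?m * ((2 * R) powr (-\<sigma>) / \<sigma>))"
      using \<sigma> R K0 m0 by (simp add: nn_integral_powr_to_inf flip: ennreal_mult)
    finally show "(\<integral>\<^sup>+z. ennreal (if 2 * R < snd (snd z) then snd (snd z) powr (1 - real DIM('a) - \<sigma>) else 0) * indicator ?F z \<partial>hausdorff_measure (2 * DIM('a)))
      \<le> ennreal (K0 * ?m * ((2 * R) powr (-\<sigma>) / \<sigma>))"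
      by (simp only: w_def)
  qed
qed

text \<open>Odd discs are \<open>meeting_discs\<close>; beyond the splitting radius only those with
  a rim point in \<Omega> have a nonzero supremum, and these are \<open>far_discs\<close>. Their
  contribution stays bounded as \<sigma> tends to 1, so the factor 1 - \<sigma> removes it.\<close>

lemma sigma_length_upper:
  fixes C :: "'a::euclidean_space set"
  assumes adm: "admissible_curve C t" and n: "DIM('a) \<ge> 2" and \<Omega>: "bounded \<Omega>"
  obtains R K where "R > 0" "K \<ge> 0" "\<And>\<sigma>. 0 < \<sigma> \<Longrightarrow> \<sigma> < 1 \<Longrightarrow> ennreal (1 - \<sigma>) * sigma_length \<sigma> C t \<Omega>
    \<le> ennreal (2 * (hyperplane_ball_vol TYPE('a))\<^sup>2 * R powr (1 - \<sigma>)) * hausdorff 1 (closure C) + ennreal ((1 - \<sigma>) * (K * (R powr (-\<sigma>) / \<sigma>)))"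
proof -
  let ?M = "closure C"
  have M: "compact ?M" using adm by (simp add: admissible_curve_def)
  have "bounded (?M \<union> \<Omega>)" using \<Omega> compact_imp_bounded[OF M] by simp
  then obtain R where R: "R > 0" "\<And>x. x \<in> ?M \<union> \<Omega> \<Longrightarrow> norm x \<le> R" unfolding bounded_pos by blast
  obtain K where K: "K \<ge> 0" "\<And>\<sigma>. 0 < \<sigma> \<Longrightarrow>
    (\<integral>\<^sup>+z. ennreal (if 2 * R < snd (snd z) then snd (snd z) powr (1 - real DIM('a) - \<sigma>) else 0) * indicator (far_discs R :: ('a \<times> 'a \<times> real) set) z \<partial>hausdorff_measure (2 * DIM('a)))
      \<le> ennreal (K * ((2 * R) powr (-\<sigma>) / \<sigma>))"
    by (rule sigma_length_far[OF n R(1)]) (rule that)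
  show ?thesis
  \<comment> \<open>The splitting radius is twice the radius of a ball that contains the curve and
    \<Omega>.\<close>
  proof (rule that[of "2 * R" K])
    show "2 * R > 0" using R by simp
    show "K \<ge> 0" by (rule K(1))
    fix \<sigma> :: real assume \<sigma>: "0 < \<sigma>" "\<sigma> < 1"
    let ?w1 = "\<lambda>r. if r \<le> 2 * R then r powr (1 - real DIM('a) - \<sigma>) else 0"
    let ?w2 = "\<lambda>r. if 2 * R < r then r powr (1 - real DIM('a) - \<sigma>) else 0"
    let ?g1 = "\<lambda>z. ennreal (?w1 (snd (snd z))) * indicator (meeting_discs ?M) z"
    let ?g2 = "\<lambda>z. ennreal (?w2 (snd (snd z))) * indicator (far_discs R) z"
    let ?\<mu> = "hausdorff_measure (2 * DIM('a)) :: ('a \<times> 'a \<times> real) measure"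
    have "sigma_length \<sigma> C t \<Omega> \<le> (\<integral>\<^sup>+z. ?g1 z + ?g2 z \<partial>?\<mu>)"
      unfolding sigma_length_def
    proof (rule nn_integral_mono)
      fix z :: "'a \<times> 'a \<times> real"
      obtain p u r where z: "z = (p, u, r)" by (cases z)
      let ?S = "SUP a\<in>unit_perp u. indicator \<Omega> (p + r *\<^sub>R a) :: ennreal"
      have S1: "?S \<le> 1" by (rule SUP_least) (simp add: indicator_def)
      have "ennreal (r powr (1 - real DIM('a) - \<sigma>)) * ?S * indicator (discs_odd C t) z \<le> ?g1 z + ?g2 z"
      proof (cases "z \<in> discs_odd C t")
        case True
        then have meet: "(p, u, r) \<in> meeting_discs ?M" using discs_odd_meeting n z by blast
        have le: "ennreal (r powr (1 - real DIM('a) - \<sigma>)) * ?S \<le> ennreal (r powr (1 - real DIM('a) - \<sigma>)) * 1"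
          by (rule mult_left_mono[OF S1]) simp
        show ?thesis
        proof (cases "r \<le> 2 * R")
          case True
          then show ?thesis using le meet \<open>z \<in> discs_odd C t\<close> by (simp add: z)
        next
          case False
          show ?thesis
          proof (cases "\<exists>a\<in>unit_perp u. p + r *\<^sub>R a \<in> \<Omega>")
            case True
            then obtain a where a: "a \<in> unit_perp u" "p + r *\<^sub>R a \<in> \<Omega>" by blast
            have "(p, u, r) \<in> far_discs R"
              by (rule discs_odd_far[OF _ n _ _ R(1) a]) (use \<open>z \<in> discs_odd C t\<close> z R(2) in auto)
            then show ?thesis using le False \<open>z \<in> discs_odd C t\<close> by (simp add: z)
          next
            case nex: False
            have "?S \<le> 0" using nex by (intro SUP_least) (auto simp: indicator_def)
            then have "?S = 0" by simp
            then show ?thesis by (simp only: mult_zero_right mult_zero_left zero_le)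
          qed
        qed
      qed simp
      then show "(case z of (p, u, r) \<Rightarrow> ennreal (r powr (1 - real DIM('a) - \<sigma>)) * (SUP a\<in>unit_perp u. indicator \<Omega> (p + r *\<^sub>R a))) * indicator (discs_odd C t) z \<le> ?g1 z + ?g2 z"
        by (simp only: z prod.case)
    qed
    also have "\<dots> = (\<integral>\<^sup>+z. ?g1 z \<partial>?\<mu>) + (\<integral>\<^sup>+z. ?g2 z \<partial>?\<mu>)"
    proof (rule nn_integral_add)
      have "?w1 \<in> borel_measurable borel" "?w2 \<in> borel_measurable borel" by measurable
      then show "?g1 \<in> borel_measurable ?\<mu>" "?g2 \<in> borel_measurable ?\<mu>"
        by (auto intro!: measurable_borel_hausdorff measurable_weight_indicator sets_meeting_discs M sets_far_discs)
    qed
    also have "\<dots> \<le> ennreal (2 * (hyperplane_ball_vol TYPE('a))\<^sup>2) * hausdorff 1 ?M * ennreal ((2 * R) powr (1 - \<sigma>) / (1 - \<sigma>)) + ennreal (K * ((2 * R) powr (-\<sigma>) / \<sigma>))"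
      using R(1) by (intro add_mono K(2)[OF \<sigma>(1)] sigma_length_near[OF adm n \<sigma>]) auto
    finally have "ennreal (1 - \<sigma>) * sigma_length \<sigma> C t \<Omega> \<le> ennreal (1 - \<sigma>) *
        (ennreal (2 * (hyperplane_ball_vol TYPE('a))\<^sup>2) * hausdorff 1 ?M * ennreal ((2 * R) powr (1 - \<sigma>) / (1 - \<sigma>)) + ennreal (K * ((2 * R) powr (-\<sigma>) / \<sigma>)))"
      by (rule mult_left_mono) simp
    also have "\<dots> = ennreal (2 * (hyperplane_ball_vol TYPE('a))\<^sup>2) * hausdorff 1 ?M * (ennreal (1 - \<sigma>) * ennreal ((2 * R) powr (1 - \<sigma>) / (1 - \<sigma>))) +
        ennreal (1 - \<sigma>) * ennreal (K * ((2 * R) powr (-\<sigma>) / \<sigma>))"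
      by (simp only: distrib_left mult_ac)
    also have "ennreal (1 - \<sigma>) * ennreal ((2 * R) powr (1 - \<sigma>) / (1 - \<sigma>)) = ennreal ((2 * R) powr (1 - \<sigma>))"
      using \<sigma> by (simp add: ennreal_mult[symmetric])
    also have "ennreal (1 - \<sigma>) * ennreal (K * ((2 * R) powr (-\<sigma>) / \<sigma>)) = ennreal ((1 - \<sigma>) * (K * ((2 * R) powr (-\<sigma>) / \<sigma>)))"
      using \<sigma> K(1) by (intro ennreal_mult[symmetric]) auto
    also have "ennreal (2 * (hyperplane_ball_vol TYPE('a))\<^sup>2) * hausdorff 1 ?M * ennreal ((2 * R) powr (1 - \<sigma>)) = ennreal (2 * (hyperplane_ball_vol TYPE('a))\<^sup>2 * (2 * R) powr (1 - \<sigma>)) * hausdorff 1 ?M"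
      by (simp add: ennreal_mult mult_ac)
    finally show "ennreal (1 - \<sigma>) * sigma_length \<sigma> C t \<Omega>
      \<le> ennreal (2 * (hyperplane_ball_vol TYPE('a))\<^sup>2 * (2 * R) powr (1 - \<sigma>)) * hausdorff 1 ?M + ennreal ((1 - \<sigma>) * (K * ((2 * R) powr (-\<sigma>) / \<sigma>)))" .
  qed
qed

lemma sigma_length_lower:
  fixes C :: "'a::euclidean_space set"
  assumes adm: "admissible_curve C t" and n: "DIM('a) \<ge> 2" and \<Omega>: "open \<Omega>" "closure C \<subseteq> \<Omega>" and \<epsilon>: "\<epsilon> > 0"
    and pos: "2 * hyperplane_ball_vol TYPE('a) - 3 * \<epsilon> * direction_mass TYPE('a) > 0"
  obtains a where "a > 0" "\<And>\<sigma>. 0 < \<sigma> \<Longrightarrow> \<sigma> < 1 \<Longrightarrow>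
    ennreal ((2 * hyperplane_ball_vol TYPE('a) - 3 * \<epsilon> * direction_mass TYPE('a)) * hyperplane_ball_vol TYPE('a) * a powr (1 - \<sigma>)) * hausdorff 1 (closure C)
      \<le> ennreal (1 - \<sigma>) * sigma_length \<sigma> C t \<Omega>"
proof -
  let ?M = "closure C" and ?F = "curve_boundary (closure C)" and ?H = "hausdorff 1 (closure C)"
  let ?k = "2 * hyperplane_ball_vol TYPE('a) - 3 * \<epsilon> * direction_mass TYPE('a)"
  have M: "compact ?M" "C1_curve_with_boundary ?M" "curve_orientation ?M t" "finite ?F"
    using adm by (auto simp: admissible_curve_def)
  obtain \<delta> where \<delta>: "\<delta> > 0"
    "\<And>y z w. y \<in> ?M \<Longrightarrow> z \<in> ?M \<Longrightarrow> w \<in> ?M \<Longrightarrow> dist y z < \<delta> \<Longrightarrow> dist y w < \<delta> \<Longrightarrow> tangent_approx \<epsilon> t y z w"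
    by (rule uniform_tangent_approx[OF M(1,3) \<epsilon>]) (rule that)
  obtain d where d: "d > 0" "\<And>z x. z \<in> ?M \<Longrightarrow> dist z x < d \<Longrightarrow> x \<in> \<Omega>"
  proof -
    obtain e where "e > 0" "(\<Union>z\<in>?M. ball z e) \<subseteq> \<Omega>"
      by (rule compact_subset_open_imp_ball_epsilon_subset[OF M(1) \<Omega>])
    show ?thesis
    proof (rule that[OF \<open>e > 0\<close>])
      show "x \<in> \<Omega>" if "z \<in> ?M" "dist z x < e" for z x
        using that by (intro subsetD[OF \<open>(\<Union>z\<in>?M. ball z e) \<subseteq> \<Omega>\<close>] UN_I[of z]) auto
    qed
  qed
  \<comment> \<open>\<delta> / 2 makes the crossing unique; d / 2 puts every rim point within 2 r <
    d of a curve point, hence in \<Omega>, so that the supremum in the weight is 1.\<close>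
  define r0 where "r0 = min (\<delta> / 2) (d / 2)"
  have r0: "r0 > 0" "2 * r0 \<le> \<delta>" "2 * r0 \<le> d" using \<delta>(1) d(1) by (auto simp: r0_def)
  let ?X = "crossing_discs (?M - ?F) t \<epsilon> r0"
  have X: "?X \<in> sets borel" using M by (intro sets_crossing_discs) (auto simp: curve_orientation_def)
  have Xodd: "?X \<subseteq> discs_odd C t" by (rule crossing_subset_discs_odd[OF adm n r0(2) \<epsilon> \<delta>(2)])
  have Xdiscs: "?X \<subseteq> discs" by (auto simp: crossing_discs_def discs_def)
  show ?thesis
  \<comment> \<open>Half of \<open>r0\<close>, because \<open>crossing_discs\<close> requires r < r0
    while the integral runs over a closed interval.\<close>
  proof (rule that[of "r0 / 2"])
    show "r0 / 2 > 0" using r0 by simp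
    fix \<sigma> :: real assume \<sigma>: "0 < \<sigma>" "\<sigma> < 1"
    let ?w = "\<lambda>r. r powr (1 - real DIM('a) - \<sigma>)"
    have [measurable]: "?w \<in> borel_measurable borel" by measurable
    have kV: "?k * hyperplane_ball_vol TYPE('a) \<ge> 0" using pos hyperplane_ball_vol_pos[where 'a = 'a] by simp
    have "ennreal (?k * hyperplane_ball_vol TYPE('a)) * ?H * ennreal ((r0 / 2) powr (1 - \<sigma>) / (1 - \<sigma>)) =
        ennreal (?k * hyperplane_ball_vol TYPE('a)) * ?H * (\<integral>\<^sup>+r. ennreal (r powr (-\<sigma>)) * indicator {0..r0 / 2} r \<partial>lborel)"
      using nn_integral_powr_from_0[OF \<sigma>, of "r0 / 2"] r0(1) by simp
    also have "\<dots> = (\<integral>\<^sup>+r. ennreal (?k * hyperplane_ball_vol TYPE('a)) * ?H * (ennreal (r powr (-\<sigma>)) * indicator {0..r0 / 2} r) \<partial>lborel)"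
      by (rule nn_integral_cmult[symmetric]) measurable
    also have "\<dots> \<le> (\<integral>\<^sup>+r. ennreal (?w r) * (ennreal (real DIM('a)) *
      (\<integral>\<^sup>+x. emeasure lborel {p. (p, x /\<^sub>R norm x, r) \<in> ?X} * indicator (cball 0 1) x \<partial>lborel)) \<partial>lborel)"
    proof (rule nn_integral_mono)
      fix r :: real
      let ?L = "ennreal (real DIM('a)) * (\<integral>\<^sup>+x. emeasure lborel {p. (p, x /\<^sub>R norm x, r) \<in> ?X} * indicator (cball 0 1) x \<partial>lborel)"
      show "ennreal (?k * hyperplane_ball_vol TYPE('a)) * ?H * (ennreal (r powr (-\<sigma>)) * indicator {0..r0 / 2} r) \<le> ennreal (?w r) * ?L"
      proof (cases "0 < r \<and> r \<le> r0 / 2")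
        case True
        then have r: "0 < r" "r < r0" "2 * r < \<delta>" using r0 by auto
        have "r powr (-\<sigma>) = ?w r * r ^ (DIM('a) - 1)"
          using r n by (simp add: powr_mult_nat_power of_nat_diff)
        then have "ennreal (?k * hyperplane_ball_vol TYPE('a)) * ?H * (ennreal (r powr (-\<sigma>)) * indicator {0..r0 / 2} r) =
            ennreal (?k * hyperplane_ball_vol TYPE('a)) * ?H * (ennreal (?w r * r ^ (DIM('a) - 1)))"
          using True by simp
        also have "\<dots> = ennreal (?w r) * (?H * (ennreal (?k * hyperplane_ball_vol TYPE('a)) * ennreal (r ^ (DIM('a) - 1))))"
          using r by (simp add: ennreal_mult mult_ac)
        also have "ennreal (?k * hyperplane_ball_vol TYPE('a)) * ennreal (r ^ (DIM('a) - 1)) = ennreal (?k * (hyperplane_ball_vol TYPE('a) * r ^ (DIM('a) - 1)))"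
          using kV r by (subst ennreal_mult[symmetric]) (auto simp: mult.assoc)
        also have "ennreal (?w r) * (?H * ennreal (?k * (hyperplane_ball_vol TYPE('a) * r ^ (DIM('a) - 1)))) \<le> ennreal (?w r) * ?L"
          using pos unfolding hyperplane_ball_vol_def
          by (intro mult_left_mono crofton_lower_bound[OF M(1,2,4,3) r \<epsilon> \<delta>(2)]) auto
        finally show ?thesis .
      next
        case False
        then have *: "ennreal (r powr (-\<sigma>)) * indicator {0..r0 / 2} r = 0"
          by (cases "r = 0") (auto simp: indicator_def)
        show ?thesis by (simp only: * mult_zero_right zero_le)
      qed
    qed
    also have "\<dots> = (\<integral>\<^sup>+z. ennreal (?w (snd (snd z))) * indicator ?X z \<partial>hausdorff_measure (2 * DIM('a)))"
      by (rule nn_integral_weighted_discs[OF X Xdiscs, symmetric]) measurable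
    also have "\<dots> \<le> sigma_length \<sigma> C t \<Omega>"
      unfolding sigma_length_def
    proof (rule nn_integral_mono)
      fix z :: "'a \<times> 'a \<times> real"
      obtain p u r where z: "z = (p, u, r)" by (cases z)
      have "ennreal (?w r) * indicator ?X z \<le> ennreal (?w r) * (SUP a\<in>unit_perp u. indicator \<Omega> (p + r *\<^sub>R a)) * indicator (discs_odd C t) z"
      proof (cases "z \<in> ?X")
        case True
        then obtain y where y: "y \<in> ?M" "norm (y - p) < r" "0 < r" "r < r0" by (auto simp: z crossing_discs_def)
        obtain a where a: "a \<in> unit_perp u" by (rule unit_perp_nonempty[OF n])
        have "norm a = 1" using a by (simp add: unit_perp_iff)
        have "dist y (p + r *\<^sub>R a) \<le> norm (y - p) + norm (r *\<^sub>R a)"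
          using norm_triangle_ineq4[of "y - p" "r *\<^sub>R a"] by (simp add: dist_norm algebra_simps)
        then have "dist y (p + r *\<^sub>R a) < d" using y r0 \<open>norm a = 1\<close> by simp
        then have "p + r *\<^sub>R a \<in> \<Omega>" using d(2) y(1) by blast
        then have "1 \<le> (SUP a\<in>unit_perp u. indicator \<Omega> (p + r *\<^sub>R a) :: ennreal)"
          using a by (intro SUP_upper2[of a]) auto
        then have "ennreal (?w r) * 1 \<le> ennreal (?w r) * (SUP a\<in>unit_perp u. indicator \<Omega> (p + r *\<^sub>R a))"
          by (rule mult_left_mono) simp
        then show ?thesis using True subsetD[OF Xodd True] by simp
      qed simp
      then show "ennreal (?w (snd (snd z))) * indicator ?X z \<le>
          (case z of (p, u, r) \<Rightarrow> ennreal (?w r) * (SUP a\<in>unit_perp u. indicator \<Omega> (p + r *\<^sub>R a))) * indicator (discs_odd C t) z"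
        by (simp only: z prod.case snd_conv)
    qed
    finally have "ennreal (1 - \<sigma>) * (ennreal (?k * hyperplane_ball_vol TYPE('a)) * ?H * ennreal ((r0 / 2) powr (1 - \<sigma>) / (1 - \<sigma>))) \<le> ennreal (1 - \<sigma>) * sigma_length \<sigma> C t \<Omega>"
      by (rule mult_left_mono) simp
    moreover have "ennreal (1 - \<sigma>) * (ennreal (?k * hyperplane_ball_vol TYPE('a)) * ?H * ennreal ((r0 / 2) powr (1 - \<sigma>) / (1 - \<sigma>))) =
        ennreal (?k * hyperplane_ball_vol TYPE('a)) * (ennreal (1 - \<sigma>) * ennreal ((r0 / 2) powr (1 - \<sigma>) / (1 - \<sigma>))) * ?H"
      by (simp only: mult_ac)
    moreover have "ennreal (1 - \<sigma>) * ennreal ((r0 / 2) powr (1 - \<sigma>) / (1 - \<sigma>)) = ennreal ((r0 / 2) powr (1 - \<sigma>))"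
      using \<sigma> by (simp add: ennreal_mult[symmetric])
    moreover have "ennreal (?k * hyperplane_ball_vol TYPE('a)) * ennreal ((r0 / 2) powr (1 - \<sigma>)) = ennreal (?k * hyperplane_ball_vol TYPE('a) * (r0 / 2) powr (1 - \<sigma>))"
      using kV by (intro ennreal_mult[symmetric]) auto
    ultimately show "ennreal (?k * hyperplane_ball_vol TYPE('a) * (r0 / 2) powr (1 - \<sigma>)) * ?H \<le> ennreal (1 - \<sigma>) * sigma_length \<sigma> C t \<Omega>"
      by (simp only:)
  qed
qed

text \<open>For a level \<open>y\<close> below the limit, first \<epsilon> is fixed with the
  constant still above \<open>y\<close>, and this determines the radius \<open>a\<close>; only then
  \<sigma> tends to 1 and with it a powr (1 - \<sigma>). A level above the limit is handled by
  \<open>sigma_length_upper\<close> directly.\<close>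

theorem sigma_length_tendsto:
  fixes C :: "'a::euclidean_space set"
  assumes adm: "admissible_curve C t" and n: "DIM('a) \<ge> 2" and \<Omega>: "open \<Omega>" "bounded \<Omega>" "closure C \<subseteq> \<Omega>"
  shows "((\<lambda>\<sigma>. ennreal (1 - \<sigma>) * sigma_length \<sigma> C t \<Omega>) \<longlongrightarrow> ennreal (2 * (hyperplane_ball_vol TYPE('a))\<^sup>2) * hausdorff 1 (closure C)) (at_left 1)"
proof -
  let ?H = "hausdorff 1 (closure C)" and ?\<omega> = "hyperplane_ball_vol TYPE('a)" and ?m = "direction_mass TYPE('a)"
  let ?X = "\<lambda>\<sigma>. ennreal (1 - \<sigma>) * sigma_length \<sigma> C t \<Omega>"
  have \<omega>: "?\<omega> > 0" by (rule hyperplane_ball_vol_pos)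
  have ev: "eventually (\<lambda>\<sigma>. 0 < \<sigma> \<and> \<sigma> < 1) (at_left (1::real))"
    by (auto simp: eventually_at_left_field intro: exI[of _ 0])
  have id: "((\<lambda>\<sigma>. \<sigma>) \<longlongrightarrow> 1) (at_left (1::real))" by (rule tendsto_ident_at)
  have powr: "((\<lambda>\<sigma>. c * a powr (1 - \<sigma>)) \<longlongrightarrow> c) (at_left (1::real))" if "a > 0" for c a :: real
  proof -
    have "((\<lambda>\<sigma>. c * a powr (1 - \<sigma>)) \<longlongrightarrow> c * a powr (1 - 1)) (at_left (1::real))"
      using that by (intro tendsto_intros id) auto
    then show ?thesis using that by simp
  qed
  show ?thesis
  proof (rule order_tendstoI)
    fix y assume y: "y < ennreal (2 * ?\<omega>\<^sup>2) * ?H"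
    let ?k = "\<lambda>\<epsilon>. (2 * ?\<omega> - 3 * \<epsilon> * ?m) * ?\<omega>"
    have "(?k \<longlongrightarrow> ?k 0) (at_right 0)" by (intro tendsto_intros)
    then have "((\<lambda>\<epsilon>. ennreal (?k \<epsilon>) * ?H) \<longlongrightarrow> ennreal (?k 0) * ?H) (at_right 0)"
      using \<omega> by (intro tendsto_mult_ennreal tendsto_ennrealI tendsto_const) auto
    moreover have "?k 0 = 2 * ?\<omega>\<^sup>2" by (simp add: power2_eq_square)
    ultimately have "((\<lambda>\<epsilon>. ennreal (?k \<epsilon>) * ?H) \<longlongrightarrow> ennreal (2 * ?\<omega>\<^sup>2) * ?H) (at_right 0)"
      by (simp only:)
    then have 1: "eventually (\<lambda>\<epsilon>. y < ennreal (?k \<epsilon>) * ?H) (at_right 0)"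
      using y by (rule order_tendstoD)
    have "((\<lambda>\<epsilon>. 2 * ?\<omega> - 3 * \<epsilon> * ?m) \<longlongrightarrow> 2 * ?\<omega> - 3 * 0 * ?m) (at_right 0)" by (intro tendsto_intros)
    then have 2: "eventually (\<lambda>\<epsilon>. 2 * ?\<omega> - 3 * \<epsilon> * ?m > 0) (at_right 0)"
      by (rule order_tendstoD) (use \<omega> in simp)
    have 3: "eventually (\<lambda>\<epsilon>. \<epsilon> > (0::real)) (at_right 0)" by (simp add: eventually_at_right_less)
    obtain \<epsilon> where \<epsilon>: "y < ennreal (?k \<epsilon>) * ?H" "2 * ?\<omega> - 3 * \<epsilon> * ?m > 0" "\<epsilon> > 0"
      using eventually_happens[OF eventually_conj[OF 1 eventually_conj[OF 2 3]]] by (auto simp: trivial_limit_at_right_real)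
    obtain a where a: "a > 0" "\<And>\<sigma>. 0 < \<sigma> \<Longrightarrow> \<sigma> < 1 \<Longrightarrow> ennreal (?k \<epsilon> * a powr (1 - \<sigma>)) * ?H \<le> ?X \<sigma>"
      by (rule sigma_length_lower[OF adm n \<Omega>(1,3) \<epsilon>(3,2)]) (rule that)
    have "((\<lambda>\<sigma>. ennreal (?k \<epsilon> * a powr (1 - \<sigma>)) * ?H) \<longlongrightarrow> ennreal (?k \<epsilon>) * ?H) (at_left 1)"
      using \<omega> \<epsilon>(2) by (intro tendsto_mult_ennreal tendsto_ennrealI powr a(1) tendsto_const) auto
    then have "eventually (\<lambda>\<sigma>. y < ennreal (?k \<epsilon> * a powr (1 - \<sigma>)) * ?H) (at_left 1)"
      using \<epsilon>(1) by (rule order_tendstoD)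
    then show "eventually (\<lambda>\<sigma>. y < ?X \<sigma>) (at_left 1)"
      using ev by eventually_elim (use a(2) order_less_le_trans in blast)
  next
    fix y assume y: "ennreal (2 * ?\<omega>\<^sup>2) * ?H < y"
    obtain R K where R: "R > 0" "K \<ge> 0" "\<And>\<sigma>. 0 < \<sigma> \<Longrightarrow> \<sigma> < 1 \<Longrightarrow>
      ?X \<sigma> \<le> ennreal (2 * ?\<omega>\<^sup>2 * R powr (1 - \<sigma>)) * ?H + ennreal ((1 - \<sigma>) * (K * (R powr (-\<sigma>) / \<sigma>)))"
      by (rule sigma_length_upper[OF adm n \<Omega>(2)]) (rule that)
    have "((\<lambda>\<sigma>. (1 - \<sigma>) * (K * (R powr (-\<sigma>) / \<sigma>))) \<longlongrightarrow> (1 - 1) * (K * (R powr (-1) / 1))) (at_left 1)"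
      using R(1) by (intro tendsto_intros id) auto
    then have "((\<lambda>\<sigma>. ennreal ((1 - \<sigma>) * (K * (R powr (-\<sigma>) / \<sigma>)))) \<longlongrightarrow> ennreal ((1 - 1) * (K * (R powr (-1) / 1)))) (at_left 1)"
      by (rule tendsto_ennrealI)
    moreover have "((\<lambda>\<sigma>. ennreal (2 * ?\<omega>\<^sup>2 * R powr (1 - \<sigma>)) * ?H) \<longlongrightarrow> ennreal (2 * ?\<omega>\<^sup>2) * ?H) (at_left 1)"
      using \<omega> by (intro tendsto_mult_ennreal tendsto_ennrealI powr R(1) tendsto_const) auto
    ultimately have "((\<lambda>\<sigma>. ennreal (2 * ?\<omega>\<^sup>2 * R powr (1 - \<sigma>)) * ?H + ennreal ((1 - \<sigma>) * (K * (R powr (-\<sigma>) / \<sigma>)))) \<longlongrightarrow>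
        ennreal (2 * ?\<omega>\<^sup>2) * ?H + ennreal ((1 - 1) * (K * (R powr (-1) / 1)))) (at_left 1)"
      by (intro tendsto_add)
    then have "eventually (\<lambda>\<sigma>. ennreal (2 * ?\<omega>\<^sup>2 * R powr (1 - \<sigma>)) * ?H + ennreal ((1 - \<sigma>) * (K * (R powr (-\<sigma>) / \<sigma>))) < y) (at_left 1)"
      by (rule order_tendstoD) (use y in simp)
    then show "eventually (\<lambda>\<sigma>. ?X \<sigma> < y) (at_left 1)"
      using ev by eventually_elim (use R(3) order_le_less_trans in blast)
  qed
qed

text \<open>With x = (n - 1) / 2 the volume is pi powr x / Gamma (x + 1). Of the two factors Gamma
  (x + 1) = x Gamma x in the square one is kept and the other is split, and 2 x = n - 1 turns the 2
  in the numerator into 4.\<close>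

lemma two_hyperplane_ball_vol_sq:
  assumes "n \<ge> 2"
  shows "2 * (unit_ball_vol (real (n - 1)))\<^sup>2 = 4 * pi ^ (n - 1) / (Gamma ((real n + 1) / 2) * Gamma ((real n - 1) / 2) * (real n - 1))"
proof -
  define x where "x = (real n - 1) / 2"
  have x: "x > 0" using assms by (simp add: x_def)
  have "Gamma (x + 1) = x * Gamma x" using x by (intro Gamma_plus1) (auto simp: nonpos_Ints_def)
  have G: "Gamma x > 0" using x by (rule Gamma_real_pos)
  have "(pi powr x)\<^sup>2 = pi powr (real (n - 1))"
    using assms by (simp add: x_def power2_eq_square powr_add[symmetric] of_nat_diff)
  also have "\<dots> = pi ^ (n - 1)" by (rule powr_realpow) simp
  finally have "(pi powr x)\<^sup>2 = pi ^ (n - 1)" .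
  have "real (n - 1) / 2 = x" using assms by (simp add: x_def of_nat_diff)
  then have "unit_ball_vol (real (n - 1)) = pi powr x / (x * Gamma x)"
    using \<open>Gamma (x + 1) = x * Gamma x\<close> by (simp add: unit_ball_vol_def)
  then have "2 * (unit_ball_vol (real (n - 1)))\<^sup>2 = 2 * pi ^ (n - 1) / (x * Gamma x)\<^sup>2"
    by (simp add: power_divide \<open>(pi powr x)\<^sup>2 = pi ^ (n - 1)\<close>)
  also have "\<dots> = 4 * pi ^ (n - 1) / ((x * Gamma x) * Gamma x * (2 * x))"
    using x G by (simp add: power2_eq_square field_simps)
  also have "x * Gamma x = Gamma ((real n + 1) / 2)"
    using \<open>Gamma (x + 1) = x * Gamma x\<close> by (simp add: x_def field_simps)
  also have "2 * x = real n - 1" by (simp add: x_def)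
  finally show ?thesis by (simp add: x_def)
qed

theorem theorem3p2:
  fixes C \<Omega> :: "(real ^ 'n) set" and t :: "real ^ 'n \<Rightarrow> real ^ 'n" and n :: nat
  assumes "n = CARD('n)" and "n \<ge> 2"
    and "admissible_curve C t"
    and "open \<Omega>" and "bounded \<Omega>" and "closure C \<subseteq> \<Omega>"
  shows "((\<lambda>\<sigma>. ennreal (1 - \<sigma>) * sigma_length \<sigma> C t \<Omega>) \<longlongrightarrow>
      ennreal (4 * pi ^ (n - 1) /
        (Gamma ((real n + 1) / 2) * Gamma ((real n - 1) / 2) * (real n - 1))) *
      hausdorff 1 (closure C)) (at_left 1)"
proof -
  have n: "n = DIM(real ^ 'n)" using assms(1) by simp
  have "2 * (hyperplane_ball_vol TYPE(real ^ 'n))\<^sup>2 = 4 * pi ^ (n - 1) / (Gamma ((real n + 1) / 2) * Gamma ((real n - 1) / 2) * (real n - 1))"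
    unfolding hyperplane_ball_vol_def n[symmetric] by (rule two_hyperplane_ball_vol_sq[OF assms(2)])
  then show ?thesis
    using sigma_length_tendsto[OF assms(3) _ assms(4-6)] assms(2) n by simp
qed

end
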